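(* Let $G=\mathbb{Z}_2\wr\mathbb{Z}=\left(\bigoplus_{\mathbb{Z}}\mathbb{Z}_2\right)\rtimes\mathbb{Z}$ be the lamplighter group, let $p\in(0,1)$ with $p\ne\frac12$, and let $$H=a\cdot\big(p\,e_0+(1-p)\,t_0\big)+\big(p\,e_0+(1-p)\,t_0\big)\cdot a^{-1}\in\mathbb{C}[G].$$ Then the spectral measure of $H$ satisfies, as $\varepsilon\to0^+$, $$\mu_H(-\varepsilon,\varepsilon)=\frac{C}{|\log\varepsilon|^2}\,(1+o(1)),\qquad C=\tfrac14\big(\log|2p-1|\big)^2 .$$
   Context: $\mathbb{Z}$, with generator $a$, acts on $\bigoplus_{\mathbb{Z}}\mathbb{Z}_2$ by translations of the coordinates. Write $\mathbb{Z}_2=\{e,t\}$; $e_0$ is the identity element of $\bigoplus_{\mathbb{Z}}\mathbb{Z}_2$ and $t_0$ is the element with $t$ at position $0$ and $e$ elsewhere. A self-adjoint $H\in\mathbb{C}[G]$ acts by convolution as a bounded self-adjoint operator on $\ell^2(G)$; its spectral measure $\mu_H$ is the unique measure on $\mathbb{R}$ with $\langle\delta_e,H^k\delta_e\rangle=\int_{\mathbb{R}}x^k\,d\mu_H(x)$ for all $k\ge0$, where $\delta_e$ is the indicator of the identity of $G$. *)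

theory Defs
  imports "HOL-Analysis.Analysis" "HOL-Library.Landau_Symbols" "HOL-Algebra.Product_Groups"
begin

section \<open>The lamplighter group\<close>

definition semidirect_product ::
  "('a, 'm) monoid_scheme \<Rightarrow> ('b, 'n) monoid_scheme \<Rightarrow> ('b \<Rightarrow> 'a \<Rightarrow> 'a) \<Rightarrow> ('a \<times> 'b) monoid" where
  "semidirect_product N Q \<phi> =
     \<lparr>carrier = carrier N \<times> carrier Q,
      monoid.mult = (\<lambda>(x, q) (y, r). (x \<otimes>\<^bsub>N\<^esub> \<phi> q y, q \<otimes>\<^bsub>Q\<^esub> r)),
      one = (\<one>\<^bsub>N\<^esub>, \<one>\<^bsub>Q\<^esub>)\<rparr>"

lemma group_semidirect_product:
  assumes N: "group N" and Q: "group Q"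
    and hom: "\<And>q. q \<in> carrier Q \<Longrightarrow> \<phi> q \<in> hom N N"
    and one: "\<And>x. x \<in> carrier N \<Longrightarrow> \<phi> \<one>\<^bsub>Q\<^esub> x = x"
    and mult: "\<And>q r x. q \<in> carrier Q \<Longrightarrow> r \<in> carrier Q \<Longrightarrow> x \<in> carrier N
                 \<Longrightarrow> \<phi> (q \<otimes>\<^bsub>Q\<^esub> r) x = \<phi> q (\<phi> r x)"
  shows "group (semidirect_product N Q \<phi>)"
proof -
  interpret N: group N by (rule N)
  interpret Q: group Q by (rule Q)
  have cl: "\<phi> q x \<in> carrier N" if "q \<in> carrier Q" "x \<in> carrier N" for q x
    using hom[OF that(1)] that(2) by (auto simp: hom_def)
  have hm: "\<phi> q (x \<otimes>\<^bsub>N\<^esub> y) = \<phi> q x \<otimes>\<^bsub>N\<^esub> \<phi> q y"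
    if "q \<in> carrier Q" "x \<in> carrier N" "y \<in> carrier N" for q x y
    using hom[OF that(1)] that(2,3) by (auto simp: hom_def)
  show ?thesis
  proof (rule groupI, goal_cases)
    case (5 z)
    then obtain x q where z: "z = (x, q)" and xq: "x \<in> carrier N" "q \<in> carrier Q"
      by (auto simp: semidirect_product_def)
    have "\<phi> (inv\<^bsub>Q\<^esub> q) (inv\<^bsub>N\<^esub> x) \<otimes>\<^bsub>N\<^esub> \<phi> (inv\<^bsub>Q\<^esub> q) x = \<phi> (inv\<^bsub>Q\<^esub> q) \<one>\<^bsub>N\<^esub>"
      using xq by (simp flip: hm)
    also have "\<dots> = \<one>\<^bsub>N\<^esub>"
      using hom_one[OF hom N N] xq by simp
    finally show ?case
      using z xq cl
      by (intro bexI[of _ "(\<phi> (inv\<^bsub>Q\<^esub> q) (inv\<^bsub>N\<^esub> x), inv\<^bsub>Q\<^esub> q)"])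
         (auto simp: semidirect_product_def)
  qed (auto simp: semidirect_product_def cl hm one mult N.m_assoc Q.m_assoc)
qed

text \<open>The group \<open>\<Z>\<^sub>2\<close> is \<^term>\<open>integer_mod_group 2\<close>, so \<open>e\<close> is \<open>0\<close> and \<open>t\<close> is \<open>1\<close>.\<close>

definition lamps :: "(int \<Rightarrow> int) monoid" where
  "lamps = sum_group UNIV (\<lambda>_. integer_mod_group 2)"

definition lamp_shift :: "int \<Rightarrow> (int \<Rightarrow> int) \<Rightarrow> (int \<Rightarrow> int)" where
  "lamp_shift k f = (\<lambda>i. f (i - k))"

definition lamplighter :: "((int \<Rightarrow> int) \<times> int) monoid" where
  "lamplighter = semidirect_product lamps integer_group lamp_shift"

definition gen_a :: "(int \<Rightarrow> int) \<times> int" where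
  "gen_a = (\<one>\<^bsub>lamps\<^esub>, 1)"

definition lamp_e0 :: "(int \<Rightarrow> int) \<times> int" where
  "lamp_e0 = (\<one>\<^bsub>lamps\<^esub>, 0)"

definition lamp_t0 :: "(int \<Rightarrow> int) \<times> int" where
  "lamp_t0 = ((\<lambda>i. if i = 0 then 1 else 0), 0)"

lemma carrier_lamps: "carrier lamps = {f. range f \<subseteq> {0, 1} \<and> finite {i. f i \<noteq> 0}}"
proof -
  have "{0..<2} = {0, 1 :: int}" by auto
  then show ?thesis
    by (auto simp: lamps_def carrier_sum_group carrier_integer_mod_group image_subset_iff PiE_UNIV_domain)
qed

lemma one_lamps: "\<one>\<^bsub>lamps\<^esub> = (\<lambda>_. 0)"
  by (auto simp: lamps_def)

lemma mult_lamps: "f \<otimes>\<^bsub>lamps\<^esub> g = (\<lambda>i. (f i + g i) mod 2)"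
  by (auto simp: lamps_def)

lemma group_lamps: "group lamps"
  by (simp add: lamps_def)

lemma lamp_shift_closed:
  assumes "f \<in> carrier lamps" shows "lamp_shift k f \<in> carrier lamps"
proof -
  have "{i. f (i - k) \<noteq> 0} = (\<lambda>i. i + k) ` {i. f i \<noteq> 0}"
    by (auto simp: image_iff) (metis diff_add_cancel)
  then show ?thesis
    using assms by (auto simp: carrier_lamps lamp_shift_def image_subset_iff)
qed

lemma group_lamplighter: "group lamplighter"
  unfolding lamplighter_def
proof (rule group_semidirect_product)
  show "lamp_shift k \<in> hom lamps lamps" for k
    by (auto simp: hom_def lamp_shift_closed) (simp add: mult_lamps lamp_shift_def)
qed (auto simp: group_lamps lamp_shift_def algebra_simps)

section \<open>The complex group algebra and its action on square-summable functions\<close>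

text \<open>Functions on \<open>G\<close> are total functions vanishing outside \<^term>\<open>carrier G\<close>.\<close>

definition group_algebra :: "('g, 'm) monoid_scheme \<Rightarrow> ('g \<Rightarrow> complex) set" where
  "group_algebra G = {f. finite {x. f x \<noteq> 0} \<and> {x. f x \<noteq> 0} \<subseteq> carrier G}"

definition ell2 :: "('g, 'm) monoid_scheme \<Rightarrow> ('g \<Rightarrow> complex) set" where
  "ell2 G = {\<psi>. (\<lambda>x. (cmod (\<psi> x))\<^sup>2) summable_on carrier G \<and> (\<forall>x. x \<notin> carrier G \<longrightarrow> \<psi> x = 0)}"

definition ell2_inner ::
  "('g, 'm) monoid_scheme \<Rightarrow> ('g \<Rightarrow> complex) \<Rightarrow> ('g \<Rightarrow> complex) \<Rightarrow> complex" where
  "ell2_inner G \<phi> \<psi> = (\<Sum>\<^sub>\<infinity>x\<in>carrier G. cnj (\<phi> x) * \<psi> x)"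

definition delta :: "'g \<Rightarrow> 'g \<Rightarrow> complex" where
  "delta g = (\<lambda>x. if x = g then 1 else 0)"

text \<open>For \<open>f\<close> in the group algebra this is both the product with another element of the algebra
  and the operator by which \<open>f\<close> acts on \<^term>\<open>ell2 G\<close>. The sum is over the
  support of \<open>f\<close>, so the definition is only meant for finitely supported \<open>f\<close>.\<close>

definition convolution ::
  "('g, 'm) monoid_scheme \<Rightarrow> ('g \<Rightarrow> complex) \<Rightarrow> ('g \<Rightarrow> complex) \<Rightarrow> ('g \<Rightarrow> complex)" where
  "convolution G f \<psi> =
     (\<lambda>x. if x \<in> carrier G
          then \<Sum>y\<in>{y \<in> carrier G. f y \<noteq> 0}. f y * \<psi> (inv\<^bsub>G\<^esub> y \<otimes>\<^bsub>G\<^esub> x) else 0)"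

definition self_adjoint :: "('g, 'm) monoid_scheme \<Rightarrow> ('g \<Rightarrow> complex) \<Rightarrow> bool" where
  "self_adjoint G f \<longleftrightarrow> f \<in> group_algebra G \<and> (\<forall>x\<in>carrier G. f (inv\<^bsub>G\<^esub> x) = cnj (f x))"

lemma convolution_superset:
  assumes "finite S" "S \<subseteq> carrier G" "{x. f x \<noteq> 0} \<subseteq> S" "x \<in> carrier G"
  shows "convolution G f \<psi> x = (\<Sum>y\<in>S. f y * \<psi> (inv\<^bsub>G\<^esub> y \<otimes>\<^bsub>G\<^esub> x))"
  unfolding convolution_def using assms by (auto intro!: sum.mono_neutral_left)

lemma convolution_delta_delta:
  assumes "group G" "g \<in> carrier G" "h \<in> carrier G"
  shows "convolution G (delta g) (delta h) = delta (g \<otimes>\<^bsub>G\<^esub> h)"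
proof
  interpret group G by fact
  fix x
  show "convolution G (delta g) (delta h) x = delta (g \<otimes>\<^bsub>G\<^esub> h) x"
  proof (cases "x \<in> carrier G")
    case True
    have "convolution G (delta g) (delta h) x
        = (\<Sum>y\<in>{g}. delta g y * delta h (inv\<^bsub>G\<^esub> y \<otimes>\<^bsub>G\<^esub> x))"
      using assms True by (intro convolution_superset) (auto simp: delta_def split: if_splits)
    also have "inv\<^bsub>G\<^esub> g \<otimes>\<^bsub>G\<^esub> x = h \<longleftrightarrow> x = g \<otimes>\<^bsub>G\<^esub> h"
      using assms(2,3) True by (metis inv_closed inv_solve_left inv_inv)
    then have "(\<Sum>y\<in>{g}. delta g y * delta h (inv\<^bsub>G\<^esub> y \<otimes>\<^bsub>G\<^esub> x)) = delta (g \<otimes>\<^bsub>G\<^esub> h) x"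
      by (simp add: delta_def)
    finally show ?thesis .
  next
    case False
    then show ?thesis
      using assms by (auto simp: convolution_def delta_def)
  qed
qed

lemma delta_in_ell2: "g \<in> carrier G \<Longrightarrow> delta g \<in> ell2 G"
proof -
  assume "g \<in> carrier G"
  then have "(\<lambda>x. (cmod (delta g x))\<^sup>2) summable_on carrier G \<longleftrightarrow>
        (\<lambda>x. (cmod (delta g x))\<^sup>2) summable_on {g}"
    by (intro summable_on_cong_neutral) (auto simp: delta_def)
  with \<open>g \<in> carrier G\<close> show ?thesis
    by (auto simp: ell2_def delta_def)
qed

lemma convolution_in_ell2:
  assumes "group G" and f: "f \<in> group_algebra G" and psi: "\<psi> \<in> ell2 G"
  shows "convolution G f \<psi> \<in> ell2 G"
proof -
  interpret group G by fact
  define S where "S = {y \<in> carrier G. f y \<noteq> 0}"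
  have S: "finite S" "S \<subseteq> carrier G"
    using f by (auto simp: S_def group_algebra_def intro: finite_subset)
  have trans: "(\<lambda>x. (cmod (\<psi> (inv\<^bsub>G\<^esub> y \<otimes>\<^bsub>G\<^esub> x)))\<^sup>2) summable_on carrier G" if "y \<in> carrier G" for y
  proof -
    have "bij_betw (\<lambda>x. inv\<^bsub>G\<^esub> y \<otimes>\<^bsub>G\<^esub> x) (carrier G) (carrier G)"
      using that by (intro bij_betwI[where g = "\<lambda>x. y \<otimes>\<^bsub>G\<^esub> x"]) (auto simp flip: m_assoc)
    from summable_on_reindex_bij_betw[OF this, of "\<lambda>x. (cmod (\<psi> x))\<^sup>2"] psi
    show ?thesis by (simp add: ell2_def)
  qed
  have "(\<lambda>x. \<Sum>y\<in>S. (cmod (f y))\<^sup>2 * (cmod (\<psi> (inv\<^bsub>G\<^esub> y \<otimes>\<^bsub>G\<^esub> x)))\<^sup>2) summable_on carrier G"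
    using S
  proof (induction S rule: finite_induct)
    case (insert y T)
    then show ?case
      using trans by (auto intro!: summable_on_add summable_on_cmult_right)
  qed auto
  then have "(\<lambda>x. real (card S) * (\<Sum>y\<in>S. (cmod (f y))\<^sup>2 * (cmod (\<psi> (inv\<^bsub>G\<^esub> y \<otimes>\<^bsub>G\<^esub> x)))\<^sup>2))
      summable_on carrier G"
    by (intro summable_on_cmult_right)
  then have "(\<lambda>x. (cmod (convolution G f \<psi> x))\<^sup>2) summable_on carrier G"
  proof (rule summable_on_comparison_test)
    fix x assume "x \<in> carrier G"
    then have "(cmod (convolution G f \<psi> x))\<^sup>2 = (cmod (\<Sum>y\<in>S. f y * \<psi> (inv\<^bsub>G\<^esub> y \<otimes>\<^bsub>G\<^esub> x)))\<^sup>2"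
      by (simp add: convolution_def S_def)
    also have "\<dots> \<le> (\<Sum>y\<in>S. cmod (f y * \<psi> (inv\<^bsub>G\<^esub> y \<otimes>\<^bsub>G\<^esub> x)))\<^sup>2"
      by (intro power_mono norm_sum) auto
    also have "\<dots> \<le> real (card S) * (\<Sum>y\<in>S. (cmod (f y * \<psi> (inv\<^bsub>G\<^esub> y \<otimes>\<^bsub>G\<^esub> x)))\<^sup>2)"
      using Cauchy_Schwarz_ineq_sum[of "\<lambda>_. 1" "\<lambda>y. cmod (f y * \<psi> (inv\<^bsub>G\<^esub> y \<otimes>\<^bsub>G\<^esub> x))" S]
      by simp
    finally show "(cmod (convolution G f \<psi> x))\<^sup>2
        \<le> real (card S) * (\<Sum>y\<in>S. (cmod (f y))\<^sup>2 * (cmod (\<psi> (inv\<^bsub>G\<^esub> y \<otimes>\<^bsub>G\<^esub> x)))\<^sup>2)"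
      by (simp add: norm_mult power_mult_distrib)
  qed auto
  then show ?thesis
    by (auto simp: ell2_def convolution_def)
qed

section \<open>Spectral measures\<close>

definition is_spectral_measure ::
  "('g, 'm) monoid_scheme \<Rightarrow> ('g \<Rightarrow> complex) \<Rightarrow> real measure \<Rightarrow> bool" where
  "is_spectral_measure G H \<mu> \<longleftrightarrow>
     sets \<mu> = sets borel \<and>
     (\<forall>k::nat. integrable \<mu> (\<lambda>x. x ^ k) \<and>
        ell2_inner G (delta \<one>\<^bsub>G\<^esub>) ((convolution G H ^^ k) (delta \<one>\<^bsub>G\<^esub>))
          = complex_of_real (\<integral>x. x ^ k \<partial>\<mu>))"

text \<open>A unique such measure exists when \<open>H\<close> is self-adjoint; for other \<open>H\<close> the value is
  unspecified. The case \<open>k = 0\<close> makes it a probability measure.\<close>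

definition spectral_measure ::
  "('g, 'm) monoid_scheme \<Rightarrow> ('g \<Rightarrow> complex) \<Rightarrow> real measure" where
  "spectral_measure G H = (THE \<mu>. is_spectral_measure G H \<mu>)"

section \<open>The operator\<close>

definition lamp_element :: "real \<Rightarrow> (int \<Rightarrow> int) \<times> int \<Rightarrow> complex" where
  "lamp_element p =
     (\<lambda>x. complex_of_real p * delta lamp_e0 x + complex_of_real (1 - p) * delta lamp_t0 x)"

definition lamplighter_H :: "real \<Rightarrow> (int \<Rightarrow> int) \<times> int \<Rightarrow> complex" where
  "lamplighter_H p =
     (\<lambda>x. convolution lamplighter (delta gen_a) (lamp_element p) x
        + convolution lamplighter (lamp_element p) (delta (inv\<^bsub>lamplighter\<^esub> gen_a)) x)"

lemma lamplighter_simps: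
  "\<one>\<^bsub>lamplighter\<^esub> = (\<lambda>_. 0, 0)"
  "(f, m) \<otimes>\<^bsub>lamplighter\<^esub> (g, n) = (\<lambda>i. (f i + g (i - m)) mod 2, m + n)"
  "carrier lamplighter = carrier lamps \<times> UNIV"
  by (simp_all add: lamplighter_def semidirect_product_def one_lamps mult_lamps lamp_shift_def)

lemma lamps_in_carrier: "(\<lambda>_. 0) \<in> carrier lamps" "(\<lambda>i. if i = j then 1 else 0) \<in> carrier lamps"
  by (auto simp: carrier_lamps)

lemma inv_gen_a: "inv\<^bsub>lamplighter\<^esub> gen_a = (\<lambda>_. 0, -1)"
  by (rule group.inv_equality[OF group_lamplighter])
     (auto simp: gen_a_def lamplighter_simps one_lamps lamps_in_carrier)

lemma lamplighter_H_eq: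
  "lamplighter_H p =
     (\<lambda>x. of_real p * (delta (\<lambda>_. 0, 1) x + delta (\<lambda>_. 0, -1) x)
        + of_real (1 - p) * (delta (\<lambda>i. if i = 1 then 1 else 0, 1) x
                             + delta (\<lambda>i. if i = 0 then 1 else 0, -1) x))"
proof
  fix x :: "(int \<Rightarrow> int) \<times> int"
  let ?G = lamplighter
  interpret group ?G by (rule group_lamplighter)
  have car: "gen_a \<in> carrier ?G" "lamp_e0 \<in> carrier ?G" "lamp_t0 \<in> carrier ?G" "inv\<^bsub>?G\<^esub> gen_a \<in> carrier ?G"
    unfolding inv_gen_a
    by (auto simp: gen_a_def lamp_e0_def lamp_t0_def lamplighter_simps one_lamps lamps_in_carrier)
  have lin: "convolution ?G (delta gen_a) (lamp_element p) x
      = of_real p * convolution ?G (delta gen_a) (delta lamp_e0) x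
      + of_real (1 - p) * convolution ?G (delta gen_a) (delta lamp_t0) x"
    by (simp add: convolution_def lamp_element_def sum_distrib_left algebra_simps
        flip: sum.distrib sum_subtractf)
  have ne: "lamp_e0 \<noteq> lamp_t0"
    by (auto simp: lamp_e0_def lamp_t0_def one_lamps fun_eq_iff)
  have lin': "convolution ?G (lamp_element p) (delta h) x
      = of_real p * convolution ?G (delta lamp_e0) (delta h) x
      + of_real (1 - p) * convolution ?G (delta lamp_t0) (delta h) x" for h
  proof (cases "x \<in> carrier ?G")
    case True
    have conv: "convolution ?G f (delta h) x
        = (\<Sum>y\<in>{lamp_e0, lamp_t0}. f y * delta h (inv\<^bsub>?G\<^esub> y \<otimes>\<^bsub>?G\<^esub> x))"
      if "{x. f x \<noteq> 0} \<subseteq> {lamp_e0, lamp_t0}" for f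
      using car True that by (intro convolution_superset) auto
    have sub: "{x. lamp_element p x \<noteq> 0} \<subseteq> {lamp_e0, lamp_t0}"
      "{x. delta lamp_e0 x \<noteq> 0} \<subseteq> {lamp_e0, lamp_t0}"
      "{x. delta lamp_t0 x \<noteq> 0} \<subseteq> {lamp_e0, lamp_t0}"
      by (auto simp: lamp_element_def delta_def)
    show ?thesis
      unfolding conv[OF sub(1)] conv[OF sub(2)] conv[OF sub(3)]
      using ne by (simp add: lamp_element_def delta_def)
  next
    case False
    then show ?thesis by (simp add: convolution_def)
  qed
  have m: "gen_a \<otimes>\<^bsub>?G\<^esub> lamp_e0 = (\<lambda>_. 0, 1)"
    "gen_a \<otimes>\<^bsub>?G\<^esub> lamp_t0 = (\<lambda>i. if i = 1 then 1 else 0, 1)"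
    "lamp_e0 \<otimes>\<^bsub>?G\<^esub> inv\<^bsub>?G\<^esub> gen_a = (\<lambda>_. 0, -1)"
    "lamp_t0 \<otimes>\<^bsub>?G\<^esub> inv\<^bsub>?G\<^esub> gen_a = (\<lambda>i. if i = 0 then 1 else 0, -1)"
    unfolding inv_gen_a
    by (auto simp: gen_a_def lamp_e0_def lamp_t0_def lamplighter_simps one_lamps)
  show "lamplighter_H p x =
      of_real p * (delta (\<lambda>_. 0, 1) x + delta (\<lambda>_. 0, -1) x)
        + of_real (1 - p) * (delta (\<lambda>i. if i = 1 then 1 else 0, 1) x
                             + delta (\<lambda>i. if i = 0 then 1 else 0, -1) x)"
    by (simp add: lamplighter_H_def lin lin' convolution_delta_delta[OF group_lamplighter] car m
        algebra_simps)
qed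

lemma self_adjoint_lamplighter_H: "self_adjoint lamplighter (lamplighter_H p)"
proof -
  let ?G = lamplighter
  interpret group ?G by (rule group_lamplighter)
  let ?e1 = "(\<lambda>_. 0, 1) :: (int \<Rightarrow> int) \<times> int" and ?e2 = "(\<lambda>_. 0, -1) :: (int \<Rightarrow> int) \<times> int"
  let ?t1 = "(\<lambda>i. if i = 1 then 1 else 0, 1) :: (int \<Rightarrow> int) \<times> int"
  let ?t2 = "(\<lambda>i. if i = 0 then 1 else 0, -1) :: (int \<Rightarrow> int) \<times> int"
  have car: "?e1 \<in> carrier ?G" "?e2 \<in> carrier ?G" "?t1 \<in> carrier ?G" "?t2 \<in> carrier ?G"
    by (auto simp: lamplighter_simps lamps_in_carrier)
  have "{x. lamplighter_H p x \<noteq> 0} \<subseteq> {?e1, ?e2, ?t1, ?t2}"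
    unfolding lamplighter_H_eq delta_def by auto
  then have ga: "lamplighter_H p \<in> group_algebra ?G"
    unfolding group_algebra_def using car by (auto intro: finite_subset)
  have inv: "inv\<^bsub>?G\<^esub> ?e1 = ?e2" "inv\<^bsub>?G\<^esub> ?t1 = ?t2"
    by (rule inv_equality; use car in \<open>auto simp: lamplighter_simps fun_eq_iff\<close>)+
  then have inv': "inv\<^bsub>?G\<^esub> ?e2 = ?e1" "inv\<^bsub>?G\<^esub> ?t2 = ?t1"
    using car by (metis inv_inv)+
  have d: "delta g (inv\<^bsub>?G\<^esub> x) = delta (inv\<^bsub>?G\<^esub> g) x" if "g \<in> carrier ?G" "x \<in> carrier ?G" for g x
    using that unfolding delta_def by (metis inv_inv)
  have c: "cnj (delta g x) = delta g x" for g x :: "(int \<Rightarrow> int) \<times> int"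
    by (simp add: delta_def)
  show ?thesis
    unfolding self_adjoint_def using ga car
    by (auto simp: lamplighter_H_eq d c inv inv' algebra_simps)
qed

end

theory Submission
  imports "HOL-Probability.Probability" "HOL-Real_Asymp.Real_Asymp" Defs
begin

text \<open>
  Fourier transform over the lamps turns the statement into one about a random chain. A character
  of \<open>\<Oplus> \<Z>\<^sub>2\<close> assigns a sign to every site, and under it \<open>p e + (1 - p) t\<close> becomes the weight
  \<open>1\<close> or \<open>q = 2 p - 1\<close>. Hence \<open>H\<close> decomposes into the hopping operators
  \<open>(J u)(n) = w\<^sub>n u(n + 1) + w\<^sub>n\<^sub>-\<^sub>1 u(n - 1)\<close> on \<open>\<Z>\<close>, where the \<open>w\<^sub>n\<close> are independent and equal
  to \<open>1\<close> or \<open>q\<close> with probability one half. The moments of \<open>\<mu>\<^sub>H\<close> are the averaged diagonal entries of the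
  powers of \<open>J\<close> (\<open>walk_coeff_eq_mean\<close>). Since \<open>J\<close>
  exchanges the even and the odd sites, \<open>J\<^sup>2\<close> on the even sites is \<open>B\<^sup>T B\<close> for a bidiagonal \<open>B\<close>, and
  \<open>\<mu>\<^sub>H\<close> is the weak limit, along a subsequence, of the averaged distribution of plus or minus the
  singular values of finite sections of \<open>B\<close> (\<open>spectral_measure_limit\<close>). It remains to count the
  small singular values.

  The solution \<open>z\<close> of \<open>B z = 0\<close> satisfies \<open>\<bar>z\<^sub>j\<bar> = \<bar>q\<bar> powi (- X\<^sub>j)\<close>, where \<open>X\<close> is a lazy random walk
  with steps \<open>-1, 0, 1\<close>. Between two sites at which \<open>X\<close> lies \<open>h\<close> below an intermediate peak, the
  truncation of \<open>z\<close> is an approximate null vector with relative error of order \<open>\<bar>q\<bar>\<^sup>h\<close>, and separated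
  peaks give independent vectors (\<open>chain_count_lower\<close>). Conversely, a vector vanishing at the peaks is
  recovered from its image under \<open>B\<close> by moving downhill along \<open>X\<close>, which costs at most \<open>\<bar>q\<bar>\<^sup>-\<^sup>h\<close> times
  the square root of the distance; forcing zeros at every \<open>L\<close>-th site as well keeps the
  distance bounded (\<open>chain_count_upper\<close>). So the number of singular values below \<open>\<bar>q\<bar>\<^sup>h\<close> is, up to
  negligible terms, the number of peaks of height \<open>h\<close>.

  A peak consists of two legs: a climb by \<open>h\<close> above the running minimum and a fall by \<open>h\<close> below the
  running maximum. The height within the current leg is a walk reflected at \<open>0\<close> and reset at \<open>h\<close>, and
  an explicit quadratic martingale shows that the expected number of legs in \<open>n\<close> steps differs from
  \<open>n / (2 h (h + 1))\<close> by at most one (\<open>config_mean_legs_bounds\<close>). Therefore \<open>\<mu>\<^sub>H(-\<epsilon>, \<epsilon>)\<close> is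
  asymptotically \<open>1 / (4 h\<^sup>2)\<close> with \<open>h = ln \<epsilon> / ln \<bar>q\<bar>\<close>, which is the claim.
\<close>

section \<open>Singular systems of rectangular matrices\<close>

text \<open>Gaussian elimination of one unknown per equation. Both counting principles below, and the
  completeness of an orthonormal system, are dimension counts of this form.\<close>

lemma homogeneous_system_solution:
  fixes a :: "'k \<Rightarrow> 'i \<Rightarrow> real"
  assumes "finite K" "finite I" "card K < card I"
  shows "\<exists>u. (\<exists>i\<in>I. u i \<noteq> 0) \<and> (\<forall>k\<in>K. (\<Sum>i\<in>I. a k i * u i) = 0)"
  using assms
proof (induction K arbitrary: I a rule: finite_induct)
  case empty
  then obtain i where "i \<in> I" by fastforce
  then show ?case by (intro exI[of _ "\<lambda>_. 1"]) auto
next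
  case (insert k K)
  show ?case
  proof (cases "\<forall>i\<in>I. a k i = 0")
    case True
    obtain u where "\<exists>i\<in>I. u i \<noteq> 0" "\<forall>k\<in>K. (\<Sum>i\<in>I. a k i * u i) = 0"
      using insert.IH[of I a] insert.prems insert.hyps by auto
    with True show ?thesis by (intro exI[of _ u]) auto
  next
    case False
    then obtain i0 where i0: "i0 \<in> I" "a k i0 \<noteq> 0" by auto
    define b where "b l i = a l i - a l i0 * a k i / a k i0" for l i
    have "card K < card (I - {i0})"
      using insert.prems insert.hyps i0 by (simp add: card_Diff_singleton)
    then obtain u where u: "\<exists>i\<in>I - {i0}. u i \<noteq> 0"
      "\<forall>l\<in>K. (\<Sum>i\<in>I - {i0}. b l i * u i) = 0"
      using insert.IH[of "I - {i0}" b] insert.prems by auto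
    define c where "c = - (\<Sum>i\<in>I - {i0}. a k i * u i) / a k i0"
    define u' where "u' = u(i0 := c)"
    have split: "(\<Sum>i\<in>I. a l i * u' i) = a l i0 * c + (\<Sum>i\<in>I - {i0}. a l i * u i)" for l
      using i0 insert.prems by (subst sum.remove[of _ i0]) (auto simp: u'_def)
    have k0: "(\<Sum>i\<in>I. a k i * u' i) = 0"
      unfolding split c_def using i0 by simp
    have "(\<Sum>i\<in>I. a l i * u' i) = 0" if "l \<in> K" for l
    proof -
      have "0 = (\<Sum>i\<in>I - {i0}. b l i * u i)" using u that by simp
      also have "\<dots> = (\<Sum>i\<in>I - {i0}. a l i * u i) - (\<Sum>i\<in>I - {i0}. a l i0 / a k i0 * (a k i * u i))"
        unfolding b_def by (simp add: algebra_simps sum_subtractf)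
      also have "(\<Sum>i\<in>I - {i0}. a l i0 / a k i0 * (a k i * u i)) = - a l i0 * c"
        unfolding sum_distrib_left[symmetric] c_def by simp
      finally show ?thesis unfolding split by simp
    qed
    with k0 u show ?thesis
      by (intro exI[of _ u']) (auto simp: u'_def)
  qed
qed

text \<open>Vectors are functions on \<open>nat\<close> of which only the first \<open>N\<close> entries count, so that the
  dimension can grow along a sequence of chains.\<close>

definition dot :: "nat \<Rightarrow> (nat \<Rightarrow> real) \<Rightarrow> (nat \<Rightarrow> real) \<Rightarrow> real" where
  "dot N u v = (\<Sum>i<N. u i * v i)"

definition mat_apply :: "nat \<Rightarrow> (nat \<Rightarrow> nat \<Rightarrow> real) \<Rightarrow> (nat \<Rightarrow> real) \<Rightarrow> nat \<Rightarrow> real" where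
  "mat_apply N a u = (\<lambda>i. \<Sum>j<N. a i j * u j)"

lemma dot_commute: "dot N u v = dot N v u"
  by (simp add: dot_def mult.commute)

lemma dot_add_left: "dot N (\<lambda>i. u i + v i) x = dot N u x + dot N v x"
  by (simp add: dot_def algebra_simps sum.distrib)

lemma dot_scale_left: "dot N (\<lambda>i. c * u i) x = c * dot N u x"
  by (simp add: dot_def algebra_simps sum_distrib_left)

lemma dot_add_right: "dot N x (\<lambda>i. u i + v i) = dot N x u + dot N x v"
  by (simp add: dot_def algebra_simps sum.distrib)

lemma dot_scale_right: "dot N x (\<lambda>i. c * u i) = c * dot N x u"
  by (simp add: dot_def algebra_simps sum_distrib_left)

lemma dot_sum_left: "dot N (\<lambda>i. \<Sum>k\<in>K. c k * v k i) x = (\<Sum>k\<in>K. c k * dot N (v k) x)"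
  unfolding dot_def
  by (simp add: sum_distrib_right sum_distrib_left) (subst sum.swap, simp add: algebra_simps)

lemma dot_self_nonneg: "0 \<le> dot N u u"
  by (simp add: dot_def sum_nonneg)

lemma dot_self_eq_0: "dot N u u = 0 \<longleftrightarrow> (\<forall>i<N. u i = 0)"
  by (simp add: dot_def sum_nonneg_eq_0_iff Ball_def)

lemma dot_cong: "(\<And>i. i < N \<Longrightarrow> u i = u' i) \<Longrightarrow> (\<And>i. i < N \<Longrightarrow> v i = v' i) \<Longrightarrow> dot N u v = dot N u' v'"
  by (simp add: dot_def)

lemma mat_apply_add: "mat_apply N a (\<lambda>i. u i + v i) = (\<lambda>i. mat_apply N a u i + mat_apply N a v i)"
  by (simp add: mat_apply_def algebra_simps sum.distrib)

lemma mat_apply_scale: "mat_apply N a (\<lambda>i. c * u i) = (\<lambda>i. c * mat_apply N a u i)"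
  by (simp add: mat_apply_def algebra_simps sum_distrib_left)

lemma mat_apply_symmetric:
  assumes "\<And>i j. a i j = a j i"
  shows "dot N (mat_apply N a u) v = dot N u (mat_apply N a v)"
  unfolding dot_def mat_apply_def
  by (simp add: sum_distrib_right sum_distrib_left) (subst sum.swap, simp add: algebra_simps assms)

text \<open>The first-order condition at a maximum: the linear term in \<open>t\<close> dominates for small \<open>t\<close>.\<close>

lemma quadratic_le_imp_zero:
  fixes x C :: real
  assumes "0 \<le> x" and "\<And>t. 2 * t * x \<le> t\<^sup>2 * C"
  shows "x = 0"
proof (rule ccontr)
  assume "x \<noteq> 0"
  with assms(1) have x: "x > 0" by simp
  define t where "t = x / (\<bar>C\<bar> + 1)"
  have t: "t > 0" using x by (simp add: t_def)
  have "2 * t * x \<le> t * (t * C)" using assms(2)[of t] by (simp add: power2_eq_square algebra_simps)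
  hence "2 * x \<le> t * C" using t by (simp add: mult.assoc)
  also have "t * C \<le> t * (\<bar>C\<bar> + 1)" using t by (intro mult_left_mono) auto
  also have "\<dots> = x" by (simp add: t_def)
  finally show False using x by simp
qed

text \<open>The entries beyond \<open>N\<close> are pinned to \<open>0\<close> so that Tychonoff applies in the product topology
  on \<open>nat \<Rightarrow> real\<close>.\<close>

lemma compact_unit_sphere_orthogonal:
  "compact {u. (\<forall>i. u i \<in> (if i < N then {-1..1} else {0 :: real})) \<and> dot N u u = 1
             \<and> (\<forall>k<m. dot N u (v k) = 0)}" (is "compact ?S")
proof -
  let ?B = "PiE UNIV (\<lambda>i::nat. if i < N then {-1..1} else {0 :: real})"
  have "compactin (product_topology (\<lambda>_. euclidean) UNIV) ?B"
    by (subst compactin_PiE) auto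
  then have "compact ?B"
    by (simp add: euclidean_product_topology)
  moreover have cont: "continuous_on UNIV (\<lambda>u::nat \<Rightarrow> real. dot N u u)"
     "continuous_on UNIV (\<lambda>u::nat \<Rightarrow> real. dot N u x)" for x
    unfolding dot_def by (intro continuous_intros continuous_on_product_coordinates)+
  have "closed ({u. dot N u u = 1} \<inter> (\<Inter>k\<in>{..<m}. {u. dot N u (v k) = 0}))"
    by (intro closed_Int closed_INT ballI closed_Collect_eq cont continuous_intros)
  ultimately have "compact (?B \<inter> ({u. dot N u u = 1} \<inter> (\<Inter>k\<in>{..<m}. {u. dot N u (v k) = 0})))"
    by (rule compact_Int_closed)
  also have "?B \<inter> ({u. dot N u u = 1} \<inter> (\<Inter>k\<in>{..<m}. {u. dot N u (v k) = 0})) = ?S"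
    by (auto simp: PiE_def Pi_def)
  finally show ?thesis .
qed

text \<open>The spectral theorem by Rayleigh quotients: a maximiser \<open>u\<close> of the quadratic form on the unit
  sphere orthogonal to the previous eigenvectors is again an eigenvector. The residual
  \<open>x = A u - \<mu> u\<close> is orthogonal to \<open>u\<close> and to the previous eigenvectors, and varying \<open>u\<close> in the
  direction \<open>x\<close> shows \<open>x = 0\<close>.\<close>

lemma orthonormal_eigenvectors:
  assumes sym: "\<And>i j. a i j = a j i"
  shows "m \<le> N \<Longrightarrow> \<exists>v ev. (\<forall>k<m. \<forall>l<m. dot N (v k) (v l) = of_bool (k = l)) \<and>
            (\<forall>k<m. \<forall>i<N. mat_apply N a (v k) i = ev k * v k i)"
proof (induction m)
  case 0
  show ?case by simp
next
  case (Suc m)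
  then have "m \<le> N" by simp
  from Suc.IH[OF this] obtain v ev
    where "\<forall>k<m. \<forall>l<m. dot N (v k) (v l) = of_bool (k = l)"
      and "\<forall>k<m. \<forall>i<N. mat_apply N a (v k) i = ev k * v k i"
    by blast
  then have orth: "\<And>k l. k < m \<Longrightarrow> l < m \<Longrightarrow> dot N (v k) (v l) = of_bool (k = l)"
    and eig: "\<And>k i. k < m \<Longrightarrow> i < N \<Longrightarrow> mat_apply N a (v k) i = ev k * v k i"
    by blast+
  define S where "S = {u. (\<forall>i. u i \<in> (if i < N then {-1..1} else {0 :: real})) \<and> dot N u u = 1
             \<and> (\<forall>k<m. dot N u (v k) = 0)}"
  have inS: "(\<lambda>i. if i < N then x i / sqrt (dot N x x) else 0) \<in> S"
    if "dot N x x > 0" "\<And>k. k < m \<Longrightarrow> dot N x (v k) = 0" for x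
  proof -
    let ?s = "sqrt (dot N x x)"
    have s: "?s > 0" "?s * ?s = dot N x x" using that by simp_all
    have "(x i)\<^sup>2 \<le> dot N x x" if "i < N" for i
      using that unfolding dot_def power2_eq_square
      by (intro member_le_sum) auto
    then have "\<bar>x i\<bar> \<le> ?s" if "i < N" for i
      using that by (simp add: real_le_rsqrt)
    then have b: "- 1 \<le> x i / ?s \<and> x i / ?s \<le> 1" if "i < N" for i
      using that s by (force simp: divide_simps abs_le_iff)
    have d: "dot N (\<lambda>i. if i < N then x i / ?s else 0) w = dot N x w / ?s" for w
      by (simp add: dot_def sum_divide_distrib)
    have "dot N (\<lambda>i. if i < N then x i / ?s else 0) (\<lambda>i. if i < N then x i / ?s else 0)
        = dot N x x / ?s / ?s"
      unfolding d by (simp add: dot_def sum_divide_distrib)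
    also have "\<dots> = 1" using s by (simp add: field_simps)
    finally show ?thesis using b that(2) by (auto simp: S_def d)
  qed
  have "card {..<m} < card {..<N}" using Suc.prems by simp
  then obtain x where x: "\<exists>i\<in>{..<N}. x i \<noteq> 0" "\<forall>k\<in>{..<m}. (\<Sum>i<N. v k i * x i) = 0"
    using homogeneous_system_solution[of "{..<m}" "{..<N}" v] by blast
  have "dot N x x > 0" using x(1) dot_self_nonneg[of N x] dot_self_eq_0[of N x] by fastforce
  moreover have "dot N x (v k) = 0" if "k < m" for k
    using x(2) that by (simp add: dot_def mult.commute)
  ultimately have "S \<noteq> {}" using inS by blast
  moreover have "compact S" unfolding S_def by (rule compact_unit_sphere_orthogonal)
  moreover have "continuous_on S (\<lambda>u. dot N (mat_apply N a u) u)"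
    unfolding dot_def mat_apply_def
    by (intro continuous_intros continuous_on_subset[OF continuous_on_product_coordinates]) auto
  ultimately obtain u where u: "u \<in> S"
    and umax: "\<And>w. w \<in> S \<Longrightarrow> dot N (mat_apply N a w) w \<le> dot N (mat_apply N a u) u"
    using continuous_attains_sup[of S "\<lambda>u. dot N (mat_apply N a u) u"] by blast
  define \<mu> where "\<mu> = dot N (mat_apply N a u) u"
  have uu: "dot N u u = 1" and uv: "\<And>k. k < m \<Longrightarrow> dot N u (v k) = 0"
    using u by (auto simp: S_def)
  have Rayleigh: "dot N (mat_apply N a w) w \<le> \<mu> * dot N w w"
    if "\<And>k. k < m \<Longrightarrow> dot N w (v k) = 0" for w
  proof (cases "dot N w w = 0")
    case True
    then have "\<forall>i<N. w i = 0" by (simp add: dot_self_eq_0)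
    then show ?thesis using True by (simp add: dot_def)
  next
    case False
    then have pos: "dot N w w > 0" using dot_self_nonneg[of N w] by simp
    define s where "s = 1 / sqrt (dot N w w)"
    have s: "s\<^sup>2 * dot N w w = 1" using pos by (simp add: s_def power_divide)
    let ?w = "\<lambda>i. if i < N then w i / sqrt (dot N w w) else 0"
    have "dot N (mat_apply N a ?w) ?w = dot N (mat_apply N a (\<lambda>i. s * w i)) (\<lambda>i. s * w i)"
      by (intro dot_cong) (auto simp: mat_apply_def s_def)
    also have "\<dots> = s\<^sup>2 * dot N (mat_apply N a w) w"
      unfolding mat_apply_scale dot_scale_left
      by (simp add: dot_scale_right power2_eq_square)
    finally have "s\<^sup>2 * dot N (mat_apply N a w) w \<le> \<mu>"
      using umax[OF inS[OF pos that]] by (simp add: \<mu>_def)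
    then have "dot N w w * (s\<^sup>2 * dot N (mat_apply N a w) w) \<le> dot N w w * \<mu>"
      using pos by (intro mult_left_mono) auto
    moreover have "dot N w w * (s\<^sup>2 * dot N (mat_apply N a w) w) = (s\<^sup>2 * dot N w w) * dot N (mat_apply N a w) w"
      by (simp add: algebra_simps)
    ultimately show ?thesis using s by (simp add: mult.commute)
  qed
  define x where "x i = mat_apply N a u i + (- \<mu>) * u i" for i
  have xdot: "dot N x w = dot N (mat_apply N a u) w - \<mu> * dot N u w" for w
    unfolding x_def dot_add_left dot_scale_left by simp
  have xu: "dot N x u = 0" unfolding xdot using uu by (simp add: \<mu>_def)
  then have ux: "dot N u x = 0" by (simp add: dot_commute)
  have xv: "dot N x (v k) = 0" if "k < m" for k
  proof -
    have "dot N (mat_apply N a u) (v k) = dot N u (mat_apply N a (v k))"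
      by (rule mat_apply_symmetric[OF sym])
    also have "\<dots> = dot N u (\<lambda>i. ev k * v k i)"
      using eig that by (intro dot_cong) auto
    also have "\<dots> = 0" by (simp add: dot_scale_right uv that)
    finally show ?thesis unfolding xdot using uv that by simp
  qed
  have "dot N x x = 0"
  proof (rule quadratic_le_imp_zero)
    show "0 \<le> dot N x x" by (rule dot_self_nonneg)
    fix t :: real
    let ?w = "\<lambda>i. u i + t * x i"
    have exp: "dot N ?w ?w = 1 + t\<^sup>2 * dot N x x"
      by (simp add: dot_add_left dot_scale_left dot_add_right dot_scale_right uu xu ux power2_eq_square)
    have ax: "dot N (mat_apply N a u) x = dot N x x"
      using xdot[of x] ux by simp
    have ax': "dot N (mat_apply N a x) u = dot N x x"
      unfolding mat_apply_symmetric[OF sym] using ax by (subst dot_commute)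
    have "dot N (mat_apply N a ?w) ?w = \<mu> + 2 * t * dot N x x + t\<^sup>2 * dot N (mat_apply N a x) x"
      using ax ax'
      by (simp add: mat_apply_add mat_apply_scale dot_add_left dot_scale_left
          dot_add_right dot_scale_right \<mu>_def[symmetric] power2_eq_square algebra_simps)
    moreover have "dot N ?w (v k) = 0" if "k < m" for k
      using uv xv that by (simp add: dot_add_left dot_scale_left)
    ultimately have "2 * t * dot N x x + t\<^sup>2 * dot N (mat_apply N a x) x \<le> \<mu> * (t\<^sup>2 * dot N x x)"
      using Rayleigh[of ?w] exp by (simp add: algebra_simps)
    then show "2 * t * dot N x x \<le> t\<^sup>2 * (\<mu> * dot N x x - dot N (mat_apply N a x) x)"
      by (simp add: algebra_simps)
  qed
  then have ueig: "mat_apply N a u i = \<mu> * u i" if "i < N" for i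
    using that by (simp add: dot_self_eq_0 x_def)
  show ?case
  proof (intro exI conjI allI impI)
    fix k l assume "k < Suc m" "l < Suc m"
    then show "dot N ((v(m := u)) k) ((v(m := u)) l) = of_bool (k = l)"
      using orth uu uv by (auto simp: less_Suc_eq dot_commute)
  next
    fix k i assume "k < Suc m" "i < N"
    then show "mat_apply N a ((v(m := u)) k) i = (ev(m := \<mu>)) k * (v(m := u)) k i"
      using eig ueig by (auto simp: less_Suc_eq)
  qed
qed

text \<open>The residual \<open>x\<close> of the expansion and the \<open>N\<close> basis vectors are \<open>N + 1\<close> pairwise orthogonal
  vectors in dimension \<open>N\<close>, hence dependent, which forces \<open>x = 0\<close>.\<close>

lemma orthonormal_basis_expansion:
  assumes orth: "\<And>k l. k < N \<Longrightarrow> l < N \<Longrightarrow> dot N (v k) (v l) = of_bool (k = l)" and "i < N"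
  shows "u i = (\<Sum>k<N. dot N u (v k) * v k i)"
proof -
  define x where "x i = u i + (-1) * (\<Sum>k<N. dot N u (v k) * v k i)" for i
  have xv: "dot N x (v l) = 0" if "l < N" for l
    unfolding x_def dot_add_left dot_scale_left dot_sum_left using that by (simp add: orth sum.delta)
  define V where "V k = (if k < N then v k else x)" for k
  obtain c where c: "\<exists>k\<in>{..N}. c k \<noteq> 0" "\<forall>i\<in>{..<N}. (\<Sum>k\<le>N. V k i * c k) = 0"
    using homogeneous_system_solution[of "{..<N}" "{..N}" "\<lambda>i k. V k i"] by auto
  have z: "(\<Sum>k\<le>N. c k * dot N (V k) w) = 0" for w
  proof -
    have "(\<Sum>k\<le>N. c k * dot N (V k) w) = dot N (\<lambda>i. \<Sum>k\<le>N. c k * V k i) w"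
      by (simp add: dot_sum_left)
    also have "\<dots> = dot N (\<lambda>i. 0) w"
      using c(2) by (intro dot_cong) (auto simp: mult.commute)
    finally show ?thesis by (simp add: dot_def)
  qed
  have cl: "c l = 0" if "l < N" for l
  proof -
    have "(\<Sum>k\<le>N. c k * dot N (V k) (v l)) = (\<Sum>k\<le>N. if k = l then c k else 0)"
      using that xv by (intro sum.cong) (auto simp: V_def orth)
    then show ?thesis using z[of "v l"] that by simp
  qed
  then have "c N \<noteq> 0" using c(1) by (metis atMost_iff le_neq_implies_less)
  moreover have "(\<Sum>k\<le>N. c k * dot N (V k) x) = c N * dot N x x"
    unfolding lessThan_Suc_atMost[symmetric] sum.lessThan_Suc using cl by (simp add: V_def)
  ultimately have "dot N x x = 0" using z[of x] by simp
  then show ?thesis using \<open>i < N\<close> by (simp add: dot_self_eq_0 x_def)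
qed

definition row_apply :: "nat \<Rightarrow> (nat \<Rightarrow> nat \<Rightarrow> real) \<Rightarrow> (nat \<Rightarrow> real) \<Rightarrow> nat \<Rightarrow> real" where
  "row_apply N B u = (\<lambda>r. \<Sum>i<N. B r i * u i)"

definition gram :: "nat \<Rightarrow> (nat \<Rightarrow> nat \<Rightarrow> real) \<Rightarrow> nat \<Rightarrow> nat \<Rightarrow> real" where
  "gram R B i j = (\<Sum>r<R. B r i * B r j)"

lemma mat_apply_gram: "mat_apply N (gram R B) u i = (\<Sum>r<R. B r i * row_apply N B u r)"
  unfolding mat_apply_def gram_def row_apply_def
  by (simp add: sum_distrib_right sum_distrib_left) (subst sum.swap, simp add: algebra_simps)

lemma dot_mat_apply_gram:
  "dot N (mat_apply N (gram R B) u) w = dot R (row_apply N B u) (row_apply N B w)"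
  unfolding dot_def mat_apply_gram
  by (simp add: row_apply_def[of N B w] sum_distrib_right sum_distrib_left)
     (subst sum.swap, simp add: algebra_simps)

text \<open>The numbers \<open>sv k\<close> are the squares of the singular values of the \<open>R \<times> N\<close> matrix \<open>B\<close>, that is, the
  eigenvalues of its Gram matrix \<open>B\<^sup>T B\<close>, and the \<open>v k\<close> are the right singular vectors.\<close>

definition singular_system ::
  "nat \<Rightarrow> nat \<Rightarrow> (nat \<Rightarrow> nat \<Rightarrow> real) \<Rightarrow> (nat \<Rightarrow> nat \<Rightarrow> real) \<Rightarrow> (nat \<Rightarrow> real) \<Rightarrow> bool" where
  "singular_system R N B v sv \<longleftrightarrow>
     (\<forall>k<N. \<forall>l<N. dot N (v k) (v l) = of_bool (k = l)) \<and>
     (\<forall>k<N. \<forall>i<N. mat_apply N (gram R B) (v k) i = sv k * v k i)"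

lemma singular_system_exists: "\<exists>v sv. singular_system R N B v sv"
  unfolding singular_system_def
  by (rule orthonormal_eigenvectors) (simp_all add: gram_def mult.commute)

context
  fixes R N B v sv
  assumes sys: "singular_system R N B v sv"
begin

lemma singular_orth: "k < N \<Longrightarrow> l < N \<Longrightarrow> dot N (v k) (v l) = of_bool (k = l)"
  using sys by (simp add: singular_system_def)

lemma singular_eig: "k < N \<Longrightarrow> i < N \<Longrightarrow> mat_apply N (gram R B) (v k) i = sv k * v k i"
  using sys by (simp add: singular_system_def)

lemma singular_expansion: "i < N \<Longrightarrow> u i = (\<Sum>k<N. dot N u (v k) * v k i)"
  by (rule orthonormal_basis_expansion[OF singular_orth])

lemma singular_Parseval: "dot N u w = (\<Sum>k<N. dot N u (v k) * dot N w (v k))"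
proof -
  have "dot N u w = dot N (\<lambda>i. \<Sum>k<N. dot N u (v k) * v k i) w"
    using singular_expansion by (intro dot_cong) auto
  also have "\<dots> = (\<Sum>k<N. dot N u (v k) * dot N (v k) w)"
    by (rule dot_sum_left)
  finally show ?thesis by (simp add: dot_commute)
qed

lemma dot_gram_singular: "k < N \<Longrightarrow> dot N (mat_apply N (gram R B) u) (v k) = sv k * dot N u (v k)"
proof -
  assume k: "k < N"
  have "dot N (mat_apply N (gram R B) u) (v k) = dot N u (mat_apply N (gram R B) (v k))"
    by (rule mat_apply_symmetric) (simp add: gram_def mult.commute)
  also have "\<dots> = dot N u (\<lambda>i. sv k * v k i)"
    using k singular_eig by (intro dot_cong) auto
  finally show ?thesis by (simp add: dot_scale_right)
qed

lemma singular_quadratic: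
  "dot R (row_apply N B u) (row_apply N B u) = (\<Sum>k<N. sv k * (dot N u (v k))\<^sup>2)"
  unfolding dot_mat_apply_gram[symmetric]
  by (subst singular_Parseval) (simp add: dot_gram_singular power2_eq_square mult.assoc)

lemma singular_value_eq:
  assumes "k < N" shows "sv k = dot R (row_apply N B (v k)) (row_apply N B (v k))"
proof -
  have "(\<Sum>l<N. sv l * (dot N (v k) (v l))\<^sup>2) = (\<Sum>l<N. if l = k then sv l else 0)"
    using assms by (intro sum.cong) (auto simp: singular_orth)
  then show ?thesis using assms by (simp add: singular_quadratic)
qed

lemma singular_value_nonneg: "k < N \<Longrightarrow> 0 \<le> sv k"
  by (simp add: singular_value_eq dot_self_nonneg)

lemma singular_power_diagonal:
  assumes "i < N"
  shows "(mat_apply N (gram R B) ^^ p) (\<lambda>j. of_bool (j = i)) i = (\<Sum>k<N. sv k ^ p * (v k i)\<^sup>2)"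
proof -
  let ?T = "mat_apply N (gram R B)"
  have pow: "dot N ((?T ^^ p) u) (v k) = sv k ^ p * dot N u (v k)" if "k < N" for k u
    by (induction p) (simp_all add: dot_gram_singular that)
  have e: "dot N (\<lambda>j. of_bool (j = i)) (v k) = v k i" for k
  proof -
    have "dot N (\<lambda>j. of_bool (j = i)) (v k) = (\<Sum>j<N. if j = i then v k j else 0)"
      unfolding dot_def by (intro sum.cong) auto
    then show ?thesis using assms by simp
  qed
  have "(?T ^^ p) (\<lambda>j. of_bool (j = i)) i
      = (\<Sum>k<N. dot N ((?T ^^ p) (\<lambda>j. of_bool (j = i))) (v k) * v k i)"
    by (rule singular_expansion[OF assms])
  then show ?thesis by (simp add: pow e power2_eq_square mult.assoc)
qed

lemma singular_diagonal_one: "i < N \<Longrightarrow> (\<Sum>k<N. (v k i)\<^sup>2) = 1"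
  using singular_power_diagonal[of i 0] by simp

lemma singular_trace:
  "(\<Sum>i<N. (mat_apply N (gram R B) ^^ p) (\<lambda>j. of_bool (j = i)) i) = (\<Sum>k<N. sv k ^ p)"
proof -
  have "(\<Sum>i<N. (mat_apply N (gram R B) ^^ p) (\<lambda>j. of_bool (j = i)) i)
      = (\<Sum>i<N. \<Sum>k<N. sv k ^ p * (v k i)\<^sup>2)"
    by (simp add: singular_power_diagonal)
  also have "\<dots> = (\<Sum>k<N. sv k ^ p * dot N (v k) (v k))"
    by (subst sum.swap) (simp add: dot_def sum_distrib_left power2_eq_square)
  finally show ?thesis by (simp add: singular_orth)
qed

text \<open>If the span of \<open>K\<close> independent vectors on which \<open>\<parallel>B u\<parallel>\<^sup>2 \<le> s \<parallel>u\<parallel>\<^sup>2\<close> exceeded the number of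
  squared singular values up to \<open>s\<close>, some nonzero \<open>u\<close> in it would be orthogonal to all the
  corresponding singular vectors and violate the bound.\<close>

lemma singular_count_lower:
  assumes small: "\<And>c. dot R (row_apply N B (\<lambda>i. \<Sum>k<K. c k * \<psi> k i)) (row_apply N B (\<lambda>i. \<Sum>k<K. c k * \<psi> k i))
               \<le> s * dot N (\<lambda>i. \<Sum>k<K. c k * \<psi> k i) (\<lambda>i. \<Sum>k<K. c k * \<psi> k i)"
    and indep: "\<And>c k. k < K \<Longrightarrow> c k \<noteq> 0 \<Longrightarrow>
               0 < dot N (\<lambda>i. \<Sum>k<K. c k * \<psi> k i) (\<lambda>i. \<Sum>k<K. c k * \<psi> k i)"
  shows "K \<le> card {m. m < N \<and> sv m \<le> s}"
proof (rule ccontr)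
  let ?M = "{m. m < N \<and> sv m \<le> s}"
  assume "\<not> K \<le> card ?M"
  then obtain c where c: "\<exists>k\<in>{..<K}. c k \<noteq> 0"
    "\<forall>m\<in>?M. (\<Sum>k<K. dot N (\<psi> k) (v m) * c k) = 0"
    using homogeneous_system_solution[of ?M "{..<K}" "\<lambda>m k. dot N (\<psi> k) (v m)"] by auto
  define u where "u i = (\<Sum>k<K. c k * \<psi> k i)" for i
  have um: "dot N u (v m) = 0" if "m < N" "sv m \<le> s" for m
    unfolding u_def dot_sum_left using c(2) that by (simp add: mult.commute)
  have pos: "0 < dot N u u" unfolding u_def using indep c(1) by blast
  have "\<exists>m<N. dot N u (v m) \<noteq> 0"
  proof (rule ccontr)
    assume "\<not> ?thesis"
    then have "dot N u u = 0" by (subst singular_Parseval) simp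
    with pos show False by simp
  qed
  then obtain m where m: "m < N" "dot N u (v m) \<noteq> 0" by blast
  have "s * dot N u u = (\<Sum>k<N. s * (dot N u (v k))\<^sup>2)"
    by (simp add: singular_Parseval[of u u] sum_distrib_left power2_eq_square)
  also have "\<dots> < (\<Sum>k<N. sv k * (dot N u (v k))\<^sup>2)"
  proof (rule sum_strict_mono_ex1)
    show "\<forall>k\<in>{..<N}. s * (dot N u (v k))\<^sup>2 \<le> sv k * (dot N u (v k))\<^sup>2"
    proof
      fix k assume "k \<in> {..<N}"
      then show "s * (dot N u (v k))\<^sup>2 \<le> sv k * (dot N u (v k))\<^sup>2"
        using um[of k] by (cases "sv k \<le> s") (auto intro!: mult_right_mono)
    qed
    show "\<exists>k\<in>{..<N}. s * (dot N u (v k))\<^sup>2 < sv k * (dot N u (v k))\<^sup>2"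
      using m um[of m] by (intro bexI[of _ m]) (auto simp: not_le[symmetric])
  qed simp
  also have "\<dots> = dot R (row_apply N B u) (row_apply N B u)" by (simp add: singular_quadratic)
  also have "\<dots> \<le> s * dot N u u" unfolding u_def by (rule small)
  finally show False by simp
qed

text \<open>Dually, if more than \<open>card P\<close> squared singular values lay below \<open>s\<close>, some nonzero combination of
  their singular vectors would vanish on \<open>P\<close>.\<close>

lemma singular_count_upper:
  assumes "finite P" "P \<subseteq> {..<N}"
    and large: "\<And>u. (\<forall>c\<in>P. u c = 0) \<Longrightarrow> s * dot N u u \<le> dot R (row_apply N B u) (row_apply N B u)"
  shows "card {m. m < N \<and> sv m < s} \<le> card P"
proof (rule ccontr)
  let ?M = "{m. m < N \<and> sv m < s}"
  assume "\<not> card ?M \<le> card P"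
  then obtain d where d: "\<exists>m\<in>?M. d m \<noteq> 0" "\<forall>c\<in>P. (\<Sum>m\<in>?M. v m c * d m) = 0"
    using homogeneous_system_solution[of P ?M "\<lambda>c m. v m c"] assms(1) by auto
  define u where "u i = (\<Sum>m\<in>?M. d m * v m i)" for i
  have um: "dot N u (v k) = (if k \<in> ?M then d k else 0)" if "k < N" for k
  proof -
    have "dot N u (v k) = (\<Sum>m\<in>?M. if m = k then d m else 0)"
      unfolding u_def dot_sum_left using that by (intro sum.cong) (auto simp: singular_orth)
    then show ?thesis by simp
  qed
  obtain m where m: "m \<in> ?M" "d m \<noteq> 0" using d by blast
  have "dot R (row_apply N B u) (row_apply N B u) = (\<Sum>k<N. sv k * (dot N u (v k))\<^sup>2)"
    by (rule singular_quadratic)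
  also have "\<dots> < (\<Sum>k<N. s * (dot N u (v k))\<^sup>2)"
  proof (rule sum_strict_mono_ex1)
    show "\<forall>k\<in>{..<N}. sv k * (dot N u (v k))\<^sup>2 \<le> s * (dot N u (v k))\<^sup>2"
      by (auto simp: um intro!: mult_right_mono)
    show "\<exists>k\<in>{..<N}. sv k * (dot N u (v k))\<^sup>2 < s * (dot N u (v k))\<^sup>2"
      using m by (intro bexI[of _ m]) (auto simp: um)
  qed simp
  also have "\<dots> = s * dot N u u"
    by (simp add: singular_Parseval[of u u] sum_distrib_left power2_eq_square)
  also have "\<dots> \<le> dot R (row_apply N B u) (row_apply N B u)"
    using d(2) by (intro large) (auto simp: u_def mult.commute)
  finally show False by simp
qed

end

section \<open>Legs and peaks of a walk\<close>

definition walk :: "(nat \<Rightarrow> int) \<Rightarrow> nat \<Rightarrow> int" where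
  "walk \<xi> n = (\<Sum>i<n. \<xi> i)"

text \<open>The state is the number \<open>N\<close> of completed legs and the height \<open>R\<close> reached in the current one. For
  even \<open>N\<close> the walk is climbing and \<open>R\<close> is measured from the running minimum; for odd \<open>N\<close> it is
  falling and \<open>R\<close> is measured from the running maximum. A new extremum resets \<open>R\<close> to \<open>0\<close>, and
  reaching height \<open>h\<close> completes the leg.\<close>

definition leg_step :: "int \<Rightarrow> int \<Rightarrow> nat \<times> int \<Rightarrow> nat \<times> int" where
  "leg_step h x = (\<lambda>(N, R). let R' = max 0 (R + (if even N then x else - x))
                            in if R' = h then (Suc N, 0) else (N, R'))"

primrec legs :: "int \<Rightarrow> (nat \<Rightarrow> int) \<Rightarrow> nat \<Rightarrow> nat \<times> int" where
  "legs h \<xi> 0 = (0, 0)"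
| "legs h \<xi> (Suc n) = leg_step h (\<xi> n) (legs h \<xi> n)"

lemma walk_0 [simp]: "walk \<xi> 0 = 0" and walk_Suc [simp]: "walk \<xi> (Suc n) = walk \<xi> n + \<xi> n"
  by (simp_all add: walk_def)

lemma leg_height_bounds:
  assumes "h \<ge> 1" "\<And>i. \<bar>\<xi> i\<bar> \<le> 1"
  shows "0 \<le> snd (legs h \<xi> n) \<and> snd (legs h \<xi> n) < h"
proof (induction n)
  case (Suc n)
  then show ?case using assms(2)[of n] assms(1)
    by (auto simp: leg_step_def Let_def split: prod.splits if_splits)
qed (use assms in auto)

lemma leg_step_cases:
  assumes "leg_step h x (N, R) = (N', R')" "0 \<le> R" "R < h" "\<bar>x\<bar> \<le> 1"
  shows "R = 0 \<and> (if even N then x else - x) = -1 \<and> N' = N \<and> R' = 0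
    \<or> N' = N \<and> R' = R + (if even N then x else - x) \<and> 0 \<le> R' \<and> R' < h
    \<or> N' = Suc N \<and> R' = 0 \<and> R + (if even N then x else - x) = h \<and> (if even N then x else - x) = 1"
proof -
  define y where "y = (if even N then x else - x)"
  have y: "\<bar>y\<bar> \<le> 1" using assms(4) by (simp add: y_def)
  have st: "(if max 0 (R + y) = h then (Suc N, 0) else (N, max 0 (R + y))) = (N', R')"
    using assms(1) unfolding y_def by (simp only: leg_step_def Let_def prod.case)
  consider "R + y < 0" | "0 \<le> R + y" "R + y < h" | "R + y = h" using y assms(3) by linarith
  then have "R = 0 \<and> y = -1 \<and> N' = N \<and> R' = 0
    \<or> N' = N \<and> R' = R + y \<and> 0 \<le> R' \<and> R' < h \<or> N' = Suc N \<and> R' = 0 \<and> R + y = h \<and> y = 1"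
  proof cases
    case 1
    then have "R = 0" "y = -1" using y assms(2) by auto
    then show ?thesis using st assms(3) by simp
  next
    case 2
    then show ?thesis using st by simp
  next
    case 3
    then show ?thesis using st y assms(2,3) by simp
  qed
  then show ?thesis by (simp only: y_def)
qed

lemma leg_stepE:
  assumes "leg_step h x (N, R) = (N', R')" "0 \<le> R" "R < h" "\<bar>x\<bar> \<le> 1"
  obtains (reset) "R = 0" "(if even N then x else - x) = -1" "N' = N" "R' = 0"
  | (move) "N' = N" "R' = R + (if even N then x else - x)" "0 \<le> R'" "R' < h"
  | (finish) "N' = Suc N" "R' = 0" "R + (if even N then x else - x) = h" "(if even N then x else - x) = 1"
  using leg_step_cases[OF assms] by blast

text \<open>Along the whole stretch between \<open>c\<close> and \<open>i\<close> the walk does not go more than \<open>h\<close> below its value at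
  \<open>i\<close>. With a peak at \<open>c\<close> this says that the way from \<open>c\<close> to \<open>i\<close> is essentially downhill.\<close>

definition covers :: "int \<Rightarrow> (nat \<Rightarrow> int) \<Rightarrow> nat \<Rightarrow> nat \<Rightarrow> bool" where
  "covers h X c i \<longleftrightarrow> (\<forall>k. min c i \<le> k \<and> k \<le> max c i \<longrightarrow> X i - X k \<le> h)"

text \<open>Each pair of a climbing and a falling leg yields an interval running from the last minimum before
  the climb to the end of the fall. The falling leg ends at the first site of the next interval, so
  the half-open interval stops one site earlier, where the walk may be only \<open>h - 1\<close> below the peak.\<close>

lemma legs_separated_peaks:
  assumes h: "h \<ge> 1" and \<xi>: "\<And>i. \<bar>\<xi> i\<bar> \<le> 1"
  defines "X \<equiv> walk \<xi>"
  shows "\<exists>a b. (\<forall>k<fst (legs h \<xi> n) div 2. a k < b k \<and> b k \<le> n \<and>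
            (\<exists>c. a k \<le> c \<and> c < b k \<and> X c - X (a k) \<ge> h - 1 \<and> X c - X (b k - 1) \<ge> h - 1)) \<and>
          (\<forall>l<fst (legs h \<xi> n) div 2. \<forall>k<l. b k \<le> a l)"
proof -
  define good where "good K a b m \<longleftrightarrow> (\<forall>k<K. a k < b k \<and> b k \<le> m \<and>
            (\<exists>c. a k \<le> c \<and> c < b k \<and> X c - X (a k) \<ge> h - 1 \<and> X c - X (b k - 1) \<ge> h - 1)) \<and>
          (\<forall>l<K. \<forall>k<l. b k \<le> a l)" for K and a b :: "nat \<Rightarrow> nat" and m
  have good_mono: "good K a b m \<Longrightarrow> m \<le> m' \<Longrightarrow> good K a b m'" for K a b m m'
    unfolding good_def by (meson order_trans)
  have XS: "X (Suc j) = X j + \<xi> j" for j by (simp add: X_def)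
  \<comment> \<open>Here \<open>s\<close> is the last running minimum and \<open>c\<close>, during a fall, the site where the climb was completed or its later maximum.\<close>
  have "\<exists>a b s. good (fst (legs h \<xi> n) div 2) a b s \<and> s \<le> n \<and>
      (if even (fst (legs h \<xi> n)) then X n - X s = snd (legs h \<xi> n)
       else \<exists>c. s \<le> c \<and> c \<le> n \<and> X c - X s \<ge> h \<and> X c - X n = snd (legs h \<xi> n))"
  proof (induction n)
    case 0
    show ?case by (auto simp: good_def intro!: exI[of _ 0])
  next
    case (Suc n)
    obtain N R where NR: "legs h \<xi> n = (N, R)" by force
    obtain N' R' where NR': "leg_step h (\<xi> n) (N, R) = (N', R')" by force
    have Rb: "0 \<le> R" "R < h" using leg_height_bounds[of h \<xi> n, OF h \<xi>] NR by auto
    from Suc[unfolded NR fst_conv snd_conv] obtain a b s where IH: "good (N div 2) a b s" "s \<le> n"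
      "if even N then X n - X s = R
       else \<exists>c. s \<le> c \<and> c \<le> n \<and> X c - X s \<ge> h \<and> X c - X n = R" by blast
    have step: "legs h \<xi> (Suc n) = (N', R')" using NR NR' by simp
    show ?case
    proof (cases "even N")
      case True
      with IH have R: "X n - X s = R" by simp
      from NR' Rb \<xi>[of n] show ?thesis
      proof (cases rule: leg_stepE)
        case reset
        then show ?thesis unfolding step
          using True good_mono[OF IH(1), of "Suc n"] IH(2)
          by (intro exI[of _ a] exI[of _ b] exI[of _ "Suc n"]) auto
      next
        case move
        then show ?thesis unfolding step
          using True IH R
          by (intro exI[of _ a] exI[of _ b] exI[of _ s]) (auto simp: XS)
      next
        case finish
        then show ?thesis unfolding step
          using True IH R
          by (intro exI[of _ a] exI[of _ b] exI[of _ s]) (auto simp: XS intro!: exI[of _ "Suc n"])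
      qed
    next
      case False
      with IH obtain c where c: "s \<le> c" "c \<le> n" "X c - X s \<ge> h" "X c - X n = R" by auto
      from NR' Rb \<xi>[of n] show ?thesis
      proof (cases rule: leg_stepE)
        case reset
        then show ?thesis unfolding step
          using False c IH
          by (intro exI[of _ a] exI[of _ b] exI[of _ s]) (auto simp: XS intro!: exI[of _ "Suc n"])
      next
        case move
        then show ?thesis unfolding step
          using False c IH
          by (intro exI[of _ a] exI[of _ b] exI[of _ s]) (auto simp: XS intro!: exI[of _ c])
      next
        case finish
        define K where "K = N div 2"
        have K: "Suc N div 2 = Suc K" using False by (auto simp: K_def elim!: oddE)
        have peak: "s < Suc n \<and> (\<exists>c. s \<le> c \<and> c < Suc n \<and> X c - X s \<ge> h - 1 \<and> X c - X n \<ge> h - 1)"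
          using c finish False \<xi>[of n] by (auto intro!: exI[of _ c])
        have "good (Suc K) (a(K := s)) (b(K := Suc n)) (Suc n)"
          using IH(1) IH(2) peak unfolding good_def K_def[symmetric]
          by (auto simp: less_Suc_eq)
        then show ?thesis unfolding step
          using False finish K
          by - (rule exI[of _ "a(K := s)"], rule exI[of _ "b(K := Suc n)"], rule exI[of _ "Suc n"], simp add: fun_upd_def)
      qed
    qed
  qed
  then obtain a b s where "good (fst (legs h \<xi> n) div 2) a b s" "s \<le> n" by auto
  then have "good (fst (legs h \<xi> n) div 2) a b n" using good_mono by blast
  then show ?thesis unfolding good_def by blast
qed

text \<open>The peaks are the maxima between a climbing and the following falling leg. A peak
  covers the sites on both sides of it down to the neighbouring minima: along a climb the walk never drops by more than \<open>h\<close>,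
  since this would have completed a falling leg, and symmetrically along a fall. The starting site
  \<open>0\<close> serves as an initial peak, and an unfinished last leg costs one more.\<close>

lemma legs_peaks_cover:
  assumes h: "h \<ge> 1" and \<xi>: "\<And>i. \<bar>\<xi> i\<bar> \<le> 1"
  shows "\<exists>P. finite P \<and> P \<subseteq> {..n} \<and> card P \<le> fst (legs h \<xi> n) div 2 + 2 \<and>
             (\<forall>i\<le>n. \<exists>c\<in>P. covers h (walk \<xi>) c i)"
proof -
  define X where "X = walk \<xi>"
  have XS: "X (Suc j) = X j + \<xi> j" for j by (simp add: X_def)
  define cov where "cov P m \<longleftrightarrow> (\<forall>i\<le>m. \<exists>c\<in>P. covers h X c i)" for P m
  \<comment> \<open>While climbing, \<open>c\<close> is the last peak, already in \<open>P\<close>, and \<open>s\<close> the running minimum; while falling, \<open>s\<close> is the last minimum and \<open>c\<close> the running maximum, not yet in \<open>P\<close>.\<close>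
  have "\<exists>P c s. finite P \<and> P \<subseteq> {..n} \<and>
      (if even (fst (legs h \<xi> n))
       then card P \<le> fst (legs h \<xi> n) div 2 + 1 \<and> c \<in> P \<and> c \<le> s \<and> s \<le> n \<and> cov P c \<and>
         (\<forall>i m. c \<le> i \<and> i \<le> m \<and> m \<le> n \<longrightarrow> X m - X i \<le> h) \<and>
         (\<forall>i. c \<le> i \<and> i \<le> n \<longrightarrow> X s \<le> X i) \<and> X n - X s = snd (legs h \<xi> n)
       else card P \<le> fst (legs h \<xi> n) div 2 + 1 \<and> s \<le> c \<and> c \<le> n \<and> cov P s \<and>
         (\<forall>i m. s \<le> i \<and> i \<le> m \<and> m \<le> n \<longrightarrow> X i - X m \<le> h) \<and>
         (\<forall>i. s \<le> i \<and> i \<le> n \<longrightarrow> X i \<le> X c) \<and> X c - X n = snd (legs h \<xi> n))"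
  proof (induction n)
    case 0
    show ?case using h by (auto simp: cov_def covers_def intro!: exI[of _ "{0::nat}"])
  next
    case (Suc n)
    obtain N R where NR: "legs h \<xi> n = (N, R)" by force
    obtain N' R' where NR': "leg_step h (\<xi> n) (N, R) = (N', R')" by force
    have Rb: "0 \<le> R" "R < h" using leg_height_bounds[of h \<xi> n, OF h \<xi>] NR by auto
    have step: "legs h \<xi> (Suc n) = (N', R')" using NR NR' by simp
    show ?case
    proof (cases "even N")
      case True
      with Suc[unfolded NR fst_conv snd_conv] obtain P c s where P: "finite P" "P \<subseteq> {..n}" "card P \<le> N div 2 + 1"
        "c \<in> P" "c \<le> s" "s \<le> n" "cov P c"
        and U: "\<And>i m. c \<le> i \<Longrightarrow> i \<le> m \<Longrightarrow> m \<le> n \<Longrightarrow> X m - X i \<le> h"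
        and mn: "\<And>i. c \<le> i \<Longrightarrow> i \<le> n \<Longrightarrow> X s \<le> X i" and R: "X n - X s = R" by auto
      have P': "P \<subseteq> {..Suc n}" using P(2) by auto
      have U': "X m - X i \<le> h" if "c \<le> i" "i \<le> m" "m \<le> Suc n" for i m
      proof (cases "m = Suc n \<and> i \<noteq> Suc n")
        case True
        then have "X s \<le> X i" using that mn[of i] by auto
        then show ?thesis using True R Rb \<xi>[of n] by (auto simp: XS)
      next
        case False
        then show ?thesis using that U[of i m] h by (cases "m = Suc n") auto
      qed
      from NR' Rb \<xi>[of n] show ?thesis
      proof (cases rule: leg_stepE)
        case reset
        have "X (Suc n) \<le> X i" if "c \<le> i" "i \<le> Suc n" for i
          using mn[of i] that reset R True by (cases "i = Suc n") (auto simp: XS)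
        then show ?thesis unfolding step
          using reset True P P' U'
          by (intro exI[of _ P] exI[of _ c] exI[of _ "Suc n"]) auto
      next
        case move
        have "X s \<le> X i" if "c \<le> i" "i \<le> Suc n" for i
          using mn[of i] that move R True by (cases "i = Suc n") (auto simp: XS)
        then show ?thesis unfolding step
          using move True P P' U' R
          by (intro exI[of _ P] exI[of _ c] exI[of _ s]) (auto simp: XS)
      next
        case finish
        have top: "X (Suc n) = X s + h" using finish True R by (auto simp: XS)
        have mx: "X i \<le> X (Suc n)" if "s \<le> i" "i \<le> Suc n" for i
          using U'[of s i] that P(5) top by auto
        have low: "X s \<le> X m" if "s \<le> m" "m \<le> Suc n" for m
          using mn[of m] that P(5) top h by (cases "m = Suc n") auto
        have D: "X i - X m \<le> h" if "s \<le> i" "i \<le> m" "m \<le> Suc n" for i m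
          using mx[of i] low[of m] that top by auto
        have "cov P s"
          unfolding cov_def
        proof (intro allI impI)
          fix i assume "i \<le> s"
          show "\<exists>c\<in>P. covers h X c i"
          proof (cases "i \<le> c")
            case True
            then show ?thesis using P(7) by (auto simp: cov_def)
          next
            case False
            then have "covers h X c i" using U \<open>i \<le> s\<close> P(6) by (auto simp: covers_def)
            then show ?thesis using P(4) by blast
          qed
        qed
        then show ?thesis unfolding step
          using finish True P P' D mx
          by (intro exI[of _ P] exI[of _ "Suc n"] exI[of _ s]) auto
      qed
    next
      case False
      with Suc[unfolded NR fst_conv snd_conv] obtain P c s where P: "finite P" "P \<subseteq> {..n}" "card P \<le> N div 2 + 1"
        "s \<le> c" "c \<le> n" "cov P s"
        and D: "\<And>i m. s \<le> i \<Longrightarrow> i \<le> m \<Longrightarrow> m \<le> n \<Longrightarrow> X i - X m \<le> h"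
        and mx: "\<And>i. s \<le> i \<Longrightarrow> i \<le> n \<Longrightarrow> X i \<le> X c" and R: "X c - X n = R" by auto
      have P': "P \<subseteq> {..Suc n}" using P(2) by auto
      have D': "X i - X m \<le> h" if "s \<le> i" "i \<le> m" "m \<le> Suc n" for i m
      proof (cases "m = Suc n \<and> i \<noteq> Suc n")
        case True
        then have "X i \<le> X c" using that mx[of i] by auto
        then show ?thesis using True R Rb \<xi>[of n] by (auto simp: XS)
      next
        case False
        then show ?thesis using that D[of i m] h by (cases "m = Suc n") auto
      qed
      from NR' Rb \<xi>[of n] show ?thesis
      proof (cases rule: leg_stepE)
        case reset
        have "X i \<le> X (Suc n)" if "s \<le> i" "i \<le> Suc n" for i
          using mx[of i] that reset R False by (cases "i = Suc n") (auto simp: XS)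
        then show ?thesis unfolding step
          using reset False P P' D'
          by (intro exI[of _ P] exI[of _ "Suc n"] exI[of _ s]) auto
      next
        case move
        have "X i \<le> X c" if "s \<le> i" "i \<le> Suc n" for i
          using mx[of i] that move R False by (cases "i = Suc n") (auto simp: XS)
        then show ?thesis unfolding step
          using move False P P' D' R
          by (intro exI[of _ P] exI[of _ c] exI[of _ s]) (auto simp: XS)
      next
        case finish
        have bot: "X (Suc n) = X c - h" using finish False R by (auto simp: XS)
        have mn: "X (Suc n) \<le> X i" if "c \<le> i" "i \<le> Suc n" for i
          using D'[of c i] that P(4) bot by auto
        have up: "X m \<le> X c" if "c \<le> m" "m \<le> Suc n" for m
          using mx[of m] that P(4) bot h by (cases "m = Suc n") auto
        have U: "X m - X i \<le> h" if "c \<le> i" "i \<le> m" "m \<le> Suc n" for i m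
          using mn[of i] up[of m] that bot by auto
        have "cov (insert c P) c"
          unfolding cov_def
        proof (intro allI impI)
          fix i assume "i \<le> c"
          show "\<exists>c\<in>insert c P. covers h X c i"
          proof (cases "i \<le> s")
            case True
            then show ?thesis using P(6) by (auto simp: cov_def)
          next
            case False
            then have "covers h X c i" using D \<open>i \<le> c\<close> P(5) by (auto simp: covers_def)
            then show ?thesis by blast
          qed
        qed
        moreover have "card (insert c P) \<le> Suc N div 2 + 1"
          using P(1,3) False by (auto simp: card_insert_if elim!: oddE)
        moreover have "insert c P \<subseteq> {..Suc n}" using P' P(5) by auto
        ultimately show ?thesis unfolding step
          using finish False P(1,5) U mn
          by (intro exI[of _ "insert c P"] exI[of _ c] exI[of _ "Suc n"]) auto
      qed
    qed
  qed
  then obtain P c s where P: "finite P" "P \<subseteq> {..n}" and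
      *: "if even (fst (legs h \<xi> n))
       then card P \<le> fst (legs h \<xi> n) div 2 + 1 \<and> c \<in> P \<and> c \<le> s \<and> s \<le> n \<and> cov P c \<and>
         (\<forall>i m. c \<le> i \<and> i \<le> m \<and> m \<le> n \<longrightarrow> X m - X i \<le> h) \<and>
         (\<forall>i. c \<le> i \<and> i \<le> n \<longrightarrow> X s \<le> X i) \<and> X n - X s = snd (legs h \<xi> n)
       else card P \<le> fst (legs h \<xi> n) div 2 + 1 \<and> s \<le> c \<and> c \<le> n \<and> cov P s \<and>
         (\<forall>i m. s \<le> i \<and> i \<le> m \<and> m \<le> n \<longrightarrow> X i - X m \<le> h) \<and>
         (\<forall>i. s \<le> i \<and> i \<le> n \<longrightarrow> X i \<le> X c) \<and> X c - X n = snd (legs h \<xi> n)"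
    by blast
  have card: "card (insert c P) \<le> fst (legs h \<xi> n) div 2 + 2"
    using * P(1) by (auto simp: card_insert_if split: if_splits)
  have sub: "insert c P \<subseteq> {..n}" using P(2) * by (auto split: if_splits)
  have "\<exists>c\<in>insert c P. covers h X c i" if i: "i \<le> n" for i
  proof (cases "even (fst (legs h \<xi> n))")
    case True
    with * have "cov P c" "\<forall>i m. c \<le> i \<and> i \<le> m \<and> m \<le> n \<longrightarrow> X m - X i \<le> h" by simp_all
    then show ?thesis using i by (cases "i \<le> c") (auto simp: cov_def covers_def)
  next
    case False
    with * have **: "cov P s" "s \<le> c" "c \<le> n"
      "\<forall>i m. s \<le> i \<and> i \<le> m \<and> m \<le> n \<longrightarrow> X i - X m \<le> h" "\<forall>i. s \<le> i \<and> i \<le> n \<longrightarrow> X i \<le> X c" by simp_all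
    show ?thesis
    proof (cases "i \<le> s")
      case True
      then show ?thesis using **(1) by (auto simp: cov_def)
    next
      case False
      have "X i - X k \<le> h" if k: "min c i \<le> k" "k \<le> max c i" for k
      proof (cases "i \<le> c")
        case True
        then show ?thesis using **(4) False k **(3) by auto
      next
        case gt: False
        then have "X i \<le> X c" "X c - X k \<le> h" using **(2,4,5) k i by auto
        then show ?thesis by simp
      qed
      then have "covers h X c i" by (auto simp: covers_def)
      then show ?thesis by blast
    qed
  qed
  then show ?thesis using card sub P(1) unfolding X_def by blast
qed

section \<open>The expected number of legs\<close>

text \<open>A configuration of signs is encoded by the set \<open>S\<close> of sites with sign \<open>-1\<close>; only the sites in
  the finite window \<open>W\<close> are random.\<close>

definition config_mean :: "int set \<Rightarrow> (int set \<Rightarrow> real) \<Rightarrow> real" where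
  "config_mean W F = (\<Sum>S\<in>Pow W. F S) / 2 ^ card W"

definition hop_step :: "int set \<Rightarrow> nat \<Rightarrow> int" where
  "hop_step S j = of_bool (2 * int j + 1 \<in> S) - of_bool (2 * int j \<in> S)"

lemma hop_step_bound: "\<bar>hop_step S j\<bar> \<le> 1"
  by (simp add: hop_step_def)

lemma sum_Pow_insert:
  assumes "finite W" "x \<notin> W"
  shows "(\<Sum>S\<in>Pow (insert x W). F S) = (\<Sum>S\<in>Pow W. F S + F (insert x S))"
proof -
  have "inj_on (insert x) (Pow W)" using assms(2) by (auto simp: inj_on_def)
  then have "(\<Sum>S\<in>insert x ` Pow W. F S) = (\<Sum>S\<in>Pow W. F (insert x S))"
    by (simp add: sum.reindex)
  moreover have "Pow W \<inter> insert x ` Pow W = {}" using assms(2) by auto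
  ultimately show ?thesis
    using assms(1) by (simp add: Pow_insert sum.union_disjoint sum.distrib)
qed

lemma legs_cong: "(\<And>i. i < n \<Longrightarrow> \<xi> i = \<xi>' i) \<Longrightarrow> legs h \<xi> n = legs h \<xi>' n"
  by (induction n) auto

text \<open>With \<open>G = 2 h (h + 1)\<close> this is \<open>g(R) - G N\<close>, where \<open>g(R) = G - 2 R (R + 1)\<close> is the expected time
  that a leg at height \<open>R\<close> still needs. It satisfies \<open>g(-1) = g(0)\<close>, which handles the reflection,
  and \<open>g(h) = 0\<close>, so that the reset to height \<open>0\<close> on completing a leg raises \<open>g\<close> by as much as \<open>G N\<close>.\<close>

definition leg_potential :: "int \<Rightarrow> nat \<times> int \<Rightarrow> real" where
  "leg_potential h = (\<lambda>(N, R). 2 * h * (h + 1) - 2 * R * (R + 1) - 2 * h * (h + 1) * N)"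

lemma leg_potential_step:
  assumes "0 \<le> R" "R < h"
  shows "2 * leg_potential h (leg_step h 0 (N, R)) + leg_potential h (leg_step h 1 (N, R))
       + leg_potential h (leg_step h (-1) (N, R)) = 4 * leg_potential h (N, R) - 4"
proof -
  define U where "U = (if R + 1 = h then (Suc N, 0) else (N, R + 1))"
  define D where "D = (N, max 0 (R - 1))"
  have up: "leg_potential h U = 2 * h * (h + 1) - 2 * (R + 1) * (R + 2) - 2 * h * (h + 1) * N"
    by (auto simp: U_def leg_potential_def algebra_simps)
  have down: "leg_potential h D = 2 * h * (h + 1) - 2 * (R - 1) * R - 2 * h * (h + 1) * N"
    using assms by (cases "R = 0") (auto simp: D_def leg_potential_def algebra_simps max_def)
  have st: "leg_step h 0 (N, R) = (N, R)" "leg_step h 1 (N, R) = (if even N then U else D)"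
    "leg_step h (-1) (N, R) = (if even N then D else U)"
    using assms by (auto simp: leg_step_def U_def D_def Let_def max_def)
  have "leg_potential h (leg_step h 1 (N, R)) + leg_potential h (leg_step h (-1) (N, R))
      = leg_potential h U + leg_potential h D"
    by (simp add: st)
  moreover have "leg_potential h (N, R) = 2 * h * (h + 1) - 2 * R * (R + 1) - 2 * h * (h + 1) * N"
    by (simp add: leg_potential_def)
  ultimately show ?thesis unfolding st(1) up down by (simp add: algebra_simps)
qed

text \<open>The potential plus time is a martingale; the four sign patterns at the sites \<open>2 n\<close> and \<open>2 n + 1\<close>
  produce the steps \<open>0, 0, 1, -1\<close>.\<close>

lemma leg_potential_mean:
  assumes h: "h \<ge> 1"
  shows "(\<Sum>S\<in>Pow {0..<2 * int n}. leg_potential h (legs h (hop_step S) n))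
          = 4 ^ n * (2 * h * (h + 1) - n)"
proof (induction n)
  case 0
  show ?case by (simp add: leg_potential_def)
next
  case (Suc n)
  let ?W = "{0..<2 * int n}"
  let ?F = "\<lambda>S. leg_potential h (legs h (hop_step S) (Suc n))"
  have W: "{0..<2 * int (Suc n)} = insert (2 * int n) (insert (2 * int n + 1) ?W)" by auto
  have "(\<Sum>S\<in>Pow {0..<2 * int (Suc n)}. ?F S)
      = (\<Sum>S\<in>Pow ?W. ?F S + ?F (insert (2 * int n + 1) S) +
           (?F (insert (2 * int n) S) + ?F (insert (2 * int n) (insert (2 * int n + 1) S))))"
    unfolding W by (simp add: sum_Pow_insert sum.distrib)
  also have "\<dots> = (\<Sum>S\<in>Pow ?W. 4 * leg_potential h (legs h (hop_step S) n) - 4)"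
  proof (rule sum.cong[OF refl])
    fix S assume S: "S \<in> Pow ?W"
    obtain N R where NR: "legs h (hop_step S) n = (N, R)" by force
    have Rb: "0 \<le> R" "R < h"
      using leg_height_bounds[of h "hop_step S" n, OF h hop_step_bound] NR by auto
    have eq: "legs h (hop_step (insert (2 * int n + 1) S)) n = (N, R)"
       "legs h (hop_step (insert (2 * int n) S)) n = (N, R)"
       "legs h (hop_step (insert (2 * int n) (insert (2 * int n + 1) S))) n = (N, R)"
      unfolding NR[symmetric] by (rule legs_cong; simp add: hop_step_def; presburger)+
    have notin: "2 * int n \<notin> S" "2 * int n + 1 \<notin> S" using S by auto
    have st: "hop_step S n = 0" "hop_step (insert (2 * int n + 1) S) n = 1"
        "hop_step (insert (2 * int n) S) n = -1"
        "hop_step (insert (2 * int n) (insert (2 * int n + 1) S)) n = 0"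
      using notin by (auto simp: hop_step_def)
    show "?F S + ?F (insert (2 * int n + 1) S) +
           (?F (insert (2 * int n) S) + ?F (insert (2 * int n) (insert (2 * int n + 1) S)))
        = 4 * leg_potential h (legs h (hop_step S) n) - 4"
      using leg_potential_step[OF Rb, of N] by (simp add: eq st NR)
  qed
  also have "\<dots> = 4 * (\<Sum>S\<in>Pow ?W. leg_potential h (legs h (hop_step S) n)) - 4 * 4 ^ n"
    by (simp add: sum_subtractf sum_distrib_left card_Pow nat_mult_distrib power_mult)
  also have "\<dots> = 4 ^ Suc n * (2 * h * (h + 1) - Suc n)"
    unfolding Suc by (simp add: algebra_simps)
  finally show ?case .
qed

lemma config_mean_legs_bounds:
  fixes n :: nat
  assumes h: "h \<ge> 1"
  defines "m \<equiv> config_mean {0..<2 * int n} (\<lambda>S. real (fst (legs h (hop_step S) n)))"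
  shows "real n / real_of_int (2 * h * (h + 1)) - 1 \<le> m" and "m \<le> real n / real_of_int (2 * h * (h + 1))"
proof -
  define G where "G = real_of_int (2 * h * (h + 1))"
  have G: "G > 0" using h by (simp add: G_def)
  let ?W = "{0..<2 * int n}"
  define g where "g S = G - 2 * snd (legs h (hop_step S) n) * (snd (legs h (hop_step S) n) + 1)" for S
  have cW: "(2::real) ^ card ?W = 4 ^ n" "card (Pow ?W) = 4 ^ n"
    by (simp_all add: card_Pow nat_mult_distrib power_mult)
  have g: "0 \<le> g S" "g S \<le> G" for S
  proof -
    let ?R = "snd (legs h (hop_step S) n)"
    have R: "0 \<le> ?R" "?R < h" using leg_height_bounds[of h "hop_step S" n, OF h hop_step_bound] by auto
    have "2 * ?R * (?R + 1) \<le> 2 * h * (h + 1)" using R by (intro mult_mono) auto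
    then have "real_of_int (2 * ?R * (?R + 1)) \<le> G" unfolding G_def of_int_le_iff .
    then show "0 \<le> g S" by (simp add: g_def)
    have "0 \<le> 2 * ?R * (?R + 1)" using R by simp
    then have "0 \<le> real_of_int (2 * ?R * (?R + 1))" unfolding of_int_0_le_iff .
    then show "g S \<le> G" by (simp add: g_def)
  qed
  have pot: "leg_potential h (legs h (hop_step S) n) = g S - G * fst (legs h (hop_step S) n)" for S
    by (cases "legs h (hop_step S) n") (simp add: leg_potential_def g_def G_def)
  have s2: "(\<Sum>S\<in>Pow ?W. real (fst (legs h (hop_step S) n))) = 4 ^ n * m"
    unfolding m_def config_mean_def cW by simp
  have "(\<Sum>S\<in>Pow ?W. g S) - G * (\<Sum>S\<in>Pow ?W. real (fst (legs h (hop_step S) n))) = 4 ^ n * (G - real n)"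
    using leg_potential_mean[OF h, of n] unfolding pot
    by (simp add: sum_subtractf sum_distrib_left G_def)
  then have "(\<Sum>S\<in>Pow ?W. g S) - 4 ^ n * (G * m) = 4 ^ n * G - 4 ^ n * real n"
    unfolding s2 by (simp only: mult.left_commute[of G] right_diff_distrib)
  moreover have "0 \<le> (\<Sum>S\<in>Pow ?W. g S)" "(\<Sum>S\<in>Pow ?W. g S) \<le> 4 ^ n * G"
    using g sum_bounded_above[of "Pow ?W" g G] cW by (auto intro: sum_nonneg)
  ultimately have "4 ^ n * real n - 4 ^ n * G \<le> 4 ^ n * (G * m)" "4 ^ n * (G * m) \<le> 4 ^ n * real n"
    by linarith+
  then have "4 ^ n * (real n - G) \<le> 4 ^ n * (G * m)" "4 ^ n * (G * m) \<le> 4 ^ n * real n"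
    by (simp_all add: right_diff_distrib del: mult_le_cancel_left)
  then have "n - G \<le> G * m" "G * m \<le> n" by simp_all
  then show "real n / real_of_int (2 * h * (h + 1)) - 1 \<le> m" "m \<le> real n / real_of_int (2 * h * (h + 1))"
    using G unfolding G_def[symmetric] by (simp_all add: field_simps)
qed

section \<open>Small singular values of a random chain\<close>

definition weight :: "real \<Rightarrow> int set \<Rightarrow> int \<Rightarrow> real" where
  "weight q S m = (if m \<in> S then q else 1)"

text \<open>Row \<open>r\<close> is the odd site \<open>2 r + 1\<close> of the line and column \<open>i\<close> the even site \<open>2 i\<close>; the entries are the
  weights of the two edges at the odd site.\<close>

definition chain :: "real \<Rightarrow> int set \<Rightarrow> nat \<Rightarrow> nat \<Rightarrow> real" where
  "chain q S r i = (if i = r then weight q S (2 * int r)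
                    else if i = Suc r then weight q S (2 * int r + 1) else 0)"

lemma row_apply_chain:
  assumes "r < n"
  shows "row_apply (Suc n) (chain q S) u r
       = weight q S (2 * int r) * u r + weight q S (2 * int r + 1) * u (Suc r)"
proof -
  have "row_apply (Suc n) (chain q S) u r = (\<Sum>i\<in>{r, Suc r}. chain q S r i * u i)"
    unfolding row_apply_def using assms
    by (intro sum.mono_neutral_right) (auto simp: chain_def)
  then show ?thesis by (simp add: chain_def)
qed

text \<open>The solutions of \<open>chain q S z = 0\<close> are its multiples.\<close>

primrec zero_mode :: "real \<Rightarrow> int set \<Rightarrow> nat \<Rightarrow> real" where
  "zero_mode q S 0 = 1"
| "zero_mode q S (Suc j)
     = - (weight q S (2 * int j) / weight q S (2 * int j + 1)) * zero_mode q S j"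

context
  fixes q :: real and S :: "int set"
  assumes q0: "q \<noteq> 0" and q1: "\<bar>q\<bar> < 1"
begin

lemma weight_bounds: "weight q S m \<noteq> 0" "\<bar>weight q S m\<bar> \<le> 1" "\<bar>q\<bar> \<le> \<bar>weight q S m\<bar>"
  using q0 q1 by (auto simp: weight_def)

lemma zero_mode_nz: "zero_mode q S j \<noteq> 0"
  by (induction j) (auto simp: weight_bounds)

lemma abs_zero_mode: "\<bar>zero_mode q S j\<bar> = \<bar>q\<bar> powi (- walk (hop_step S) j)"
proof (induction j)
  case (Suc j)
  have w: "\<bar>weight q S m\<bar> = \<bar>q\<bar> powi (of_bool (m \<in> S))" for m
    by (simp add: weight_def)
  have "\<bar>weight q S (2 * int j) / weight q S (2 * int j + 1)\<bar> = \<bar>q\<bar> powi (- hop_step S j)"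
    unfolding abs_divide w using q0 by (simp add: hop_step_def power_int_diff)
  then have "\<bar>zero_mode q S (Suc j)\<bar> = \<bar>q\<bar> powi (- hop_step S j) * \<bar>q\<bar> powi (- walk (hop_step S) j)"
    unfolding Suc[symmetric] zero_mode.simps abs_mult abs_minus_cancel by simp
  also have "\<dots> = \<bar>q\<bar> powi (- hop_step S j + - walk (hop_step S) j)"
    using q0 by (intro power_int_add[symmetric]) simp
  finally show ?case by (simp add: algebra_simps)
qed simp

lemma zero_mode_decay:
  assumes "walk (hop_step S) c - walk (hop_step S) a \<ge> m"
  shows "\<bar>zero_mode q S a\<bar> \<le> \<bar>q\<bar> powi m * \<bar>zero_mode q S c\<bar>"
proof -
  have "\<bar>zero_mode q S a\<bar> \<le> \<bar>q\<bar> powi (m - walk (hop_step S) c)"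
    unfolding abs_zero_mode using assms q0 q1 by (intro power_int_decreasing) auto
  also have "\<dots> = \<bar>q\<bar> powi m * \<bar>zero_mode q S c\<bar>"
    unfolding abs_zero_mode using q0 by (simp add: power_int_add[symmetric])
  finally show ?thesis .
qed

text \<open>Writing a vector as \<open>z \<phi>\<close> turns the chain into a weighted difference operator, so that a truncated
  zero mode is only seen at its two ends.\<close>

lemma row_apply_gauge:
  assumes "r < n"
  shows "row_apply (Suc n) (chain q S) (\<lambda>i. zero_mode q S i * \<phi> i) r
       = weight q S (2 * int r + 1) * zero_mode q S (Suc r) * (\<phi> (Suc r) - \<phi> r)"
  unfolding row_apply_chain[OF assms] using weight_bounds(1)
  by (simp add: field_simps)

lemma row_apply_gauge_bound:
  assumes "r < n"
  shows "(row_apply (Suc n) (chain q S) (\<lambda>i. zero_mode q S i * \<phi> i) r)\<^sup>2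
       \<le> (zero_mode q S (Suc r))\<^sup>2 * (\<phi> (Suc r) - \<phi> r)\<^sup>2"
    and "(row_apply (Suc n) (chain q S) (\<lambda>i. zero_mode q S i * \<phi> i) r)\<^sup>2
       \<le> (zero_mode q S r)\<^sup>2 * (\<phi> (Suc r) - \<phi> r)\<^sup>2"
proof -
  have w: "(weight q S m)\<^sup>2 \<le> 1" for m
    using weight_bounds(2) by (simp add: abs_square_le_1)
  have eq: "weight q S (2 * int r + 1) * zero_mode q S (Suc r) = - weight q S (2 * int r) * zero_mode q S r"
    using weight_bounds(1) by simp
  show "(row_apply (Suc n) (chain q S) (\<lambda>i. zero_mode q S i * \<phi> i) r)\<^sup>2
       \<le> (zero_mode q S (Suc r))\<^sup>2 * (\<phi> (Suc r) - \<phi> r)\<^sup>2"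
    unfolding row_apply_gauge[OF assms] power_mult_distrib
    by (intro mult_right_mono mult_left_le_one_le w) auto
  show "(row_apply (Suc n) (chain q S) (\<lambda>i. zero_mode q S i * \<phi> i) r)\<^sup>2
       \<le> (zero_mode q S r)\<^sup>2 * (\<phi> (Suc r) - \<phi> r)\<^sup>2"
    unfolding row_apply_gauge[OF assms] eq power_mult_distrib power2_minus
    by (intro mult_right_mono mult_left_le_one_le w) auto
qed

end

text \<open>At most one summand is nonzero, so squaring commutes with the sum.\<close>

lemma square_sum_of_bool:
  fixes c :: "nat \<Rightarrow> real"
  assumes "\<And>k l. k < K \<Longrightarrow> l < K \<Longrightarrow> Q k \<Longrightarrow> Q l \<Longrightarrow> k = l"
  shows "(\<Sum>k<K. c k * of_bool (Q k))\<^sup>2 = (\<Sum>k<K. (c k)\<^sup>2 * of_bool (Q k))"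
proof (cases "\<exists>k<K. Q k")
  case True
  then obtain k where k: "k < K" "Q k" by blast
  then have "of_bool (Q l) = (of_bool (l = k) :: real)" if "l < K" for l
    using assms that by auto
  then have "(\<Sum>l<K. f l * of_bool (Q l)) = f k" for f :: "nat \<Rightarrow> real"
  proof -
    have "(\<Sum>l<K. f l * of_bool (Q l)) = (\<Sum>l<K. if l = k then f l else 0)"
      using \<open>\<And>l. l < K \<Longrightarrow> of_bool (Q l) = of_bool (l = k)\<close> by (intro sum.cong) auto
    then show ?thesis using k by simp
  qed
  then show ?thesis by simp
next
  case False
  then show ?thesis by simp
qed

text \<open>The trial vectors are the zero mode truncated to the intervals of \<open>legs_separated_peaks\<close>. Their
  images live at the two ends of the intervals, where \<open>z\<close> is smaller than at the peak by the factor
  \<open>\<bar>q\<bar> powi (h - 1)\<close>. Adjacent intervals may share the row between them, which costs a factor 2.\<close>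

lemma chain_count_lower:
  assumes q: "q \<noteq> 0" "\<bar>q\<bar> < 1" and h: "h \<ge> 1"
    and sys: "singular_system n (Suc n) (chain q S) v sv"
  shows "fst (legs h (hop_step S) n) div 2
           \<le> card {m. m < Suc n \<and> sv m \<le> 4 * (\<bar>q\<bar> powi (h - 1))\<^sup>2}"
proof -
  define K where "K = fst (legs h (hop_step S) n) div 2"
  define X where "X = walk (hop_step S)"
  define z where "z = zero_mode q S"
  define \<delta> where "\<delta> = \<bar>q\<bar> powi (h - 1)"
  obtain a b where
    ab: "\<forall>k<K. a k < b k \<and> b k \<le> n \<and>
            (\<exists>c. a k \<le> c \<and> c < b k \<and> X c - X (a k) \<ge> h - 1 \<and> X c - X (b k - 1) \<ge> h - 1)"
    and sep: "\<forall>l<K. \<forall>k<l. b k \<le> a l"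
    using legs_separated_peaks[of h "hop_step S" n, OF h hop_step_bound] unfolding K_def X_def by blast
  from ab have "\<forall>k. \<exists>c. k < K \<longrightarrow> a k \<le> c \<and> c < b k \<and> X c - X (a k) \<ge> h - 1 \<and> X c - X (b k - 1) \<ge> h - 1"
    by blast
  then obtain c where c: "\<And>k. k < K \<Longrightarrow> a k \<le> c k \<and> c k < b k \<and> X (c k) - X (a k) \<ge> h - 1 \<and> X (c k) - X (b k - 1) \<ge> h - 1"
    by metis
  have disj: "k = l" if "k < K" "l < K" "a k \<le> i" "i < b k" "a l \<le> i" "i < b l" for k l i
    using sep that by (metis leD le_less_trans linorder_neqE_nat)
  have abk: "a k < b k" "b k \<le> n" if "k < K" for k using ab that by auto
  have za: "(z (a k))\<^sup>2 \<le> \<delta>\<^sup>2 * (z (c k))\<^sup>2" and zb: "(z (b k - 1))\<^sup>2 \<le> \<delta>\<^sup>2 * (z (c k))\<^sup>2" if "k < K" for k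
    using zero_mode_decay[OF q] c[OF that] unfolding X_def z_def \<delta>_def
    by (auto simp: power_mult_distrib[symmetric] abs_le_square_iff[symmetric] abs_mult)
  define I where "I k i = (a k \<le> i \<and> i < b k)" for k i
  define \<psi> where "\<psi> k i = z i * of_bool (I k i)" for k i
  have norm: "dot (Suc n) (\<lambda>i. \<Sum>k<K. d k * \<psi> k i) (\<lambda>i. \<Sum>k<K. d k * \<psi> k i)
      = (\<Sum>k<K. (d k)\<^sup>2 * (\<Sum>i<Suc n. (z i)\<^sup>2 * of_bool (I k i)))" for d
  proof -
    have "dot (Suc n) (\<lambda>i. \<Sum>k<K. d k * \<psi> k i) (\<lambda>i. \<Sum>k<K. d k * \<psi> k i)
       = (\<Sum>i<Suc n. (z i)\<^sup>2 * (\<Sum>k<K. d k * of_bool (I k i))\<^sup>2)"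
      unfolding dot_def power2_eq_square[symmetric] power_mult_distrib[symmetric] \<psi>_def
      by (simp only: sum_distrib_left mult.left_commute)
    also have "\<dots> = (\<Sum>i<Suc n. (z i)\<^sup>2 * (\<Sum>k<K. (d k)\<^sup>2 * of_bool (I k i)))"
      by (subst square_sum_of_bool) (use disj I_def in blast)+
    also have "\<dots> = (\<Sum>k<K. (d k)\<^sup>2 * (\<Sum>i<Suc n. (z i)\<^sup>2 * of_bool (I k i)))"
      unfolding sum_distrib_left by (subst sum.swap) (simp only: mult.left_commute)
    finally show ?thesis .
  qed
  have peak: "(z (c k))\<^sup>2 \<le> (\<Sum>i<Suc n. (z i)\<^sup>2 * of_bool (I k i))" if "k < K" for k
  proof -
    have "(z (c k))\<^sup>2 * of_bool (I k (c k)) \<le> (\<Sum>i<Suc n. (z i)\<^sup>2 * of_bool (I k i))"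
      using c[OF that] abk[OF that] by (intro member_le_sum) auto
    then show ?thesis using c[OF that] by (simp add: I_def)
  qed
  have "K \<le> card {m. m < Suc n \<and> sv m \<le> 4 * \<delta>\<^sup>2}"
  proof (rule singular_count_lower[OF sys, where \<psi> = \<psi>])
    fix d :: "nat \<Rightarrow> real" and k assume k: "k < K" "d k \<noteq> 0"
    have "0 < (z (c k))\<^sup>2" using zero_mode_nz[OF q] by (simp add: z_def)
    then have "0 < (d k)\<^sup>2 * (\<Sum>i<Suc n. (z i)\<^sup>2 * of_bool (I k i))"
      using less_le_trans[OF _ peak[OF k(1)]] k(2) by (intro mult_pos_pos) simp_all
    also have "\<dots> \<le> (\<Sum>k<K. (d k)\<^sup>2 * (\<Sum>i<Suc n. (z i)\<^sup>2 * of_bool (I k i)))"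
      using k(1) by (intro member_le_sum[where f = "\<lambda>k. (d k)\<^sup>2 * (\<Sum>i<Suc n. (z i)\<^sup>2 * of_bool (I k i))"])
        (simp_all add: mult_nonneg_nonneg sum_nonneg del: sum.lessThan_Suc)
    finally show "0 < dot (Suc n) (\<lambda>i. \<Sum>k<K. d k * \<psi> k i) (\<lambda>i. \<Sum>k<K. d k * \<psi> k i)"
      unfolding norm .
  next
    fix d :: "nat \<Rightarrow> real"
    define \<phi> where "\<phi> i = (\<Sum>k<K. d k * of_bool (I k i))" for i
    have u: "(\<lambda>i. \<Sum>k<K. d k * \<psi> k i) = (\<lambda>i. z i * \<phi> i)"
      by (simp only: \<phi>_def \<psi>_def sum_distrib_left mult.left_commute)
    let ?\<rho> = "row_apply (Suc n) (chain q S) (\<lambda>i. z i * \<phi> i)"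
    have row: "(?\<rho> r)\<^sup>2 \<le> 2 * ((z (Suc r))\<^sup>2 * (\<Sum>k<K. (d k)\<^sup>2 * of_bool (Suc r = a k)))
         + 2 * ((z r)\<^sup>2 * (\<Sum>k<K. (d k)\<^sup>2 * of_bool (Suc r = b k)))" if r: "r < n" for r
    proof -
      define A where "A = (\<Sum>k<K. d k * of_bool (Suc r = a k))"
      define B where "B = (\<Sum>k<K. d k * of_bool (Suc r = b k))"
      have "\<phi> (Suc r) - \<phi> r = (\<Sum>k<K. d k * of_bool (Suc r = a k) - d k * of_bool (Suc r = b k))"
        unfolding \<phi>_def sum_subtractf[symmetric]
        using abk by (intro sum.cong) (fastforce simp: I_def of_bool_def)+
      then have AB: "\<phi> (Suc r) - \<phi> r = A - B" by (simp add: sum_subtractf A_def B_def)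
      have A2: "A\<^sup>2 = (\<Sum>k<K. (d k)\<^sup>2 * of_bool (Suc r = a k))"
        unfolding A_def using disj abk by (intro square_sum_of_bool) (metis order_refl)
      have B2: "B\<^sup>2 = (\<Sum>k<K. (d k)\<^sup>2 * of_bool (Suc r = b k))"
        unfolding B_def using disj abk
        by (intro square_sum_of_bool) (metis lessI less_Suc_eq_le)
      define \<rho> where "\<rho> = (?\<rho> r)\<^sup>2"
      have le: "\<rho> \<le> (z (Suc r))\<^sup>2 * (A - B)\<^sup>2" "\<rho> \<le> (z r)\<^sup>2 * (A - B)\<^sup>2"
        using row_apply_gauge_bound[OF q r, of S \<phi>] unfolding AB z_def \<rho>_def by auto
      \<comment> \<open>Whichever of the two ends meets row \<open>r\<close>, the row is bounded by the value of \<open>z\<close> inside the interval.\<close>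
      define w where "w = min ((z (Suc r))\<^sup>2) ((z r)\<^sup>2)"
      have w: "0 \<le> w" "w \<le> (z (Suc r))\<^sup>2" "w \<le> (z r)\<^sup>2" by (auto simp: w_def)
      have "\<rho> \<le> w * (A - B)\<^sup>2" using le by (auto simp: w_def min_def)
      also have "(A - B)\<^sup>2 \<le> 2 * A\<^sup>2 + 2 * B\<^sup>2"
        using zero_le_power2[of "A + B"] by (simp add: power2_eq_square algebra_simps)
      then have "w * (A - B)\<^sup>2 \<le> w * (2 * A\<^sup>2 + 2 * B\<^sup>2)" using w(1) by (rule mult_left_mono)
      also have "\<dots> = 2 * (w * A\<^sup>2) + 2 * (w * B\<^sup>2)" by (simp add: algebra_simps)
      also have "\<dots> \<le> 2 * ((z (Suc r))\<^sup>2 * A\<^sup>2) + 2 * ((z r)\<^sup>2 * B\<^sup>2)"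
        using w by (intro add_mono mult_left_mono mult_right_mono) auto
      finally show ?thesis unfolding A2 B2 \<rho>_def .
    qed
    have ends: "(\<Sum>r<n. (z (Suc r))\<^sup>2 * of_bool (Suc r = a k)) \<le> (z (a k))\<^sup>2"
      "(\<Sum>r<n. (z r)\<^sup>2 * of_bool (Suc r = b k)) \<le> (z (b k - 1))\<^sup>2" for k
    proof -
      have "(\<Sum>r<n. (z (Suc r))\<^sup>2 * of_bool (Suc r = a k)) = (\<Sum>r<n. if r = a k - 1 then (z (Suc r))\<^sup>2 * of_bool (Suc r = a k) else 0)"
        by (intro sum.cong) auto
      then show "(\<Sum>r<n. (z (Suc r))\<^sup>2 * of_bool (Suc r = a k)) \<le> (z (a k))\<^sup>2"
        by (auto simp: of_bool_def)
      have "(\<Sum>r<n. (z r)\<^sup>2 * of_bool (Suc r = b k)) = (\<Sum>r<n. if r = b k - 1 then (z r)\<^sup>2 * of_bool (Suc r = b k) else 0)"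
        by (intro sum.cong) auto
      then show "(\<Sum>r<n. (z r)\<^sup>2 * of_bool (Suc r = b k)) \<le> (z (b k - 1))\<^sup>2"
        by (auto simp: of_bool_def)
    qed
    have "dot n ?\<rho> ?\<rho> = (\<Sum>r<n. (?\<rho> r)\<^sup>2)" by (simp add: dot_def power2_eq_square)
    also have "\<dots> \<le> (\<Sum>r<n. 2 * ((z (Suc r))\<^sup>2 * (\<Sum>k<K. (d k)\<^sup>2 * of_bool (Suc r = a k)))
         + 2 * ((z r)\<^sup>2 * (\<Sum>k<K. (d k)\<^sup>2 * of_bool (Suc r = b k))))"
      by (intro sum_mono row) auto
    also have "\<dots> = 2 * (\<Sum>k<K. (d k)\<^sup>2 * (\<Sum>r<n. (z (Suc r))\<^sup>2 * of_bool (Suc r = a k)))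
         + 2 * (\<Sum>k<K. (d k)\<^sup>2 * (\<Sum>r<n. (z r)\<^sup>2 * of_bool (Suc r = b k)))"
      unfolding sum.distrib sum_distrib_left
      by (subst (1 2) sum.swap) (simp only: mult.left_commute)
    also have "\<dots> \<le> 2 * (\<Sum>k<K. (d k)\<^sup>2 * (\<delta>\<^sup>2 * (z (c k))\<^sup>2)) + 2 * (\<Sum>k<K. (d k)\<^sup>2 * (\<delta>\<^sup>2 * (z (c k))\<^sup>2))"
      by (intro add_mono mult_left_mono sum_mono order_trans[OF ends(1) za] order_trans[OF ends(2) zb])
         simp_all
    also have "\<dots> = 4 * \<delta>\<^sup>2 * (\<Sum>k<K. (d k)\<^sup>2 * (z (c k))\<^sup>2)"
      by (simp add: sum_distrib_left mult.left_commute mult.assoc)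
    also have "\<dots> \<le> 4 * \<delta>\<^sup>2 * (\<Sum>k<K. (d k)\<^sup>2 * (\<Sum>i<Suc n. (z i)\<^sup>2 * of_bool (I k i)))"
      using peak by (intro mult_left_mono sum_mono) auto
    finally show "dot n (row_apply (Suc n) (chain q S) (\<lambda>i. \<Sum>k<K. d k * \<psi> k i))
        (row_apply (Suc n) (chain q S) (\<lambda>i. \<Sum>k<K. d k * \<psi> k i))
       \<le> 4 * \<delta>\<^sup>2 * dot (Suc n) (\<lambda>i. \<Sum>k<K. d k * \<psi> k i) (\<lambda>i. \<Sum>k<K. d k * \<psi> k i)"
      unfolding norm unfolding u .
  qed
  then show ?thesis by (simp add: K_def \<delta>_def)
qed

lemma covers_between:
  assumes "covers h X c i" "min c i \<le> m" "m \<le> max c i"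
  shows "covers h X m i"
  using assms by (auto simp: covers_def min_def max_def split: if_splits)

text \<open>A covering site may be replaced by any site between it and \<open>i\<close>, in particular by the nearest
  multiple of \<open>L\<close>.\<close>

lemma nearby_cover:
  assumes "covers h X c i" "L \<ge> 1" "c \<le> n" "i \<le> n"
  shows "\<exists>m. (m = c \<or> L dvd m) \<and> m \<le> n \<and> covers h X m i \<and> m \<le> i + L \<and> i \<le> m + L"
proof -
  consider "c \<le> i + L" "i \<le> c + L" | "i > c + L" | "c > i + L" by linarith
  then show ?thesis
  proof cases
    case 1
    then show ?thesis using assms by blast
  next
    case 2
    define m where "m = L * (i div L)"
    have m: "m \<le> i" "i < m + L"
      using assms(2) mult_div_mod_eq[of L i] mod_less_divisor[of L i] unfolding m_def by linarith+
    then have "covers h X m i" using 2 by (intro covers_between[OF assms(1)]) auto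
    moreover have "L dvd m" "m \<le> n" "m \<le> i + L" "i \<le> m + L"
      using m assms(4) unfolding m_def by (simp, linarith+)
    ultimately show ?thesis by blast
  next
    case 3
    define m where "m = L * (i div L) + L"
    have m: "i \<le> m" "m \<le> i + L"
      using assms(2) mult_div_mod_eq[of L i] mod_less_divisor[of L i] unfolding m_def by linarith+
    then have "covers h X m i" using 3 by (intro covers_between[OF assms(1)]) auto
    moreover have "L dvd m" by (simp add: m_def)
    moreover have "m \<le> n" "m \<le> i + L" "i \<le> m + L" using m assms(3) 3 by linarith+
    ultimately show ?thesis by blast
  qed
qed

text \<open>Summing the gauged differences from the zero \<open>c\<close> of \<open>u\<close> to \<open>i\<close>. The factor \<open>z\<^sub>i / z\<^sub>k\<^sub>+\<^sub>1\<close> is at most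
  \<open>\<bar>q\<bar> powi (- h)\<close> because \<open>c\<close> covers \<open>i\<close>; the additional \<open>1 / \<bar>q\<bar>\<close> pays for the edge weight.\<close>

lemma chain_cover_bound:
  assumes q: "q \<noteq> 0" "\<bar>q\<bar> < 1" and cov: "covers h (walk (hop_step S)) c i" and "u c = 0"
    and "c \<le> n" "i \<le> n"
  shows "\<bar>u i\<bar> \<le> \<bar>q\<bar> powi (- h - 1) *
           (\<Sum>k\<in>{min c i..<max c i}. \<bar>row_apply (Suc n) (chain q S) u k\<bar>)"
proof -
  define z where "z = zero_mode q S"
  define \<phi> where "\<phi> j = u j / z j" for j
  let ?\<rho> = "row_apply (Suc n) (chain q S) u"
  have z: "z j \<noteq> 0" for j using zero_mode_nz[OF q] by (simp add: z_def)
  have u: "u = (\<lambda>j. z j * \<phi> j)" using z by (simp add: \<phi>_def)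
  have term_le: "\<bar>z i * (\<phi> (Suc k) - \<phi> k)\<bar> \<le> \<bar>q\<bar> powi (- h - 1) * \<bar>?\<rho> k\<bar>"
    if k: "min c i \<le> k" "k < max c i" for k
  proof -
    have kn: "k < n" using k assms by auto
    have \<rho>: "?\<rho> k = weight q S (2 * int k + 1) * z (Suc k) * (\<phi> (Suc k) - \<phi> k)"
      unfolding u z_def by (rule row_apply_gauge[OF q kn])
    have "walk (hop_step S) (Suc k) - walk (hop_step S) i \<ge> - h"
      using cov k unfolding covers_def by (auto dest!: spec[of _ "Suc k"])
    then have "\<bar>z i\<bar> \<le> \<bar>q\<bar> powi (- h) * \<bar>z (Suc k)\<bar>"
      unfolding z_def by (rule zero_mode_decay[OF q])
    also have "\<dots> = \<bar>q\<bar> powi (- h - 1) * (\<bar>q\<bar> * \<bar>z (Suc k)\<bar>)"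
      using q by (simp add: power_int_diff)
    also have "\<dots> \<le> \<bar>q\<bar> powi (- h - 1) * (\<bar>weight q S (2 * int k + 1)\<bar> * \<bar>z (Suc k)\<bar>)"
      using weight_bounds(3)[OF q] by (intro mult_left_mono mult_right_mono) auto
    finally have "\<bar>z i\<bar> * \<bar>\<phi> (Suc k) - \<phi> k\<bar>
       \<le> \<bar>q\<bar> powi (- h - 1) * (\<bar>weight q S (2 * int k + 1)\<bar> * \<bar>z (Suc k)\<bar>) * \<bar>\<phi> (Suc k) - \<phi> k\<bar>"
      by (rule mult_right_mono) simp
    then show ?thesis unfolding \<rho> abs_mult by (simp only: mult.assoc)
  qed
  have tel: "(\<Sum>k\<in>{min c i..<max c i}. \<phi> (Suc k) - \<phi> k) = \<phi> (max c i) - \<phi> (min c i)"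
    by (rule sum_Suc_diff') simp
  have "\<phi> c = 0" using \<open>u c = 0\<close> by (simp add: \<phi>_def)
  then have "\<bar>u i\<bar> = \<bar>z i * (\<phi> (max c i) - \<phi> (min c i))\<bar>"
    using z by (cases "c \<le> i") (auto simp: \<phi>_def abs_mult min_def max_def)
  also have "\<dots> = \<bar>\<Sum>k\<in>{min c i..<max c i}. z i * (\<phi> (Suc k) - \<phi> k)\<bar>"
    unfolding tel[symmetric] sum_distrib_left ..
  also have "\<dots> \<le> (\<Sum>k\<in>{min c i..<max c i}. \<bar>q\<bar> powi (- h - 1) * \<bar>?\<rho> k\<bar>)"
    by (rule order_trans[OF sum_abs]) (intro sum_mono term_le, auto)
  finally show ?thesis by (simp add: sum_distrib_left)
qed

text \<open>Vectors vanishing at the peaks and at the multiples of \<open>L\<close> satisfy a Poincare inequality. One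
  factor \<open>L\<close> comes from the Cauchy-Schwarz inequality for at most \<open>L\<close> differences, the factor \<open>2 L\<close>
  from the number of sites that use a given row.\<close>

lemma chain_count_upper:
  assumes q: "q \<noteq> 0" "\<bar>q\<bar> < 1" and h: "h \<ge> 1" and L: "L \<ge> 1"
    and sys: "singular_system n (Suc n) (chain q S) v sv"
  shows "card {m. m < Suc n \<and> sv m < (\<bar>q\<bar> powi (h + 1))\<^sup>2 / (2 * (real L)\<^sup>2)}
           \<le> fst (legs h (hop_step S) n) div 2 + 3 + n div L"
proof -
  obtain P where P: "finite P" "P \<subseteq> {..n}" "card P \<le> fst (legs h (hop_step S) n) div 2 + 2"
    "\<forall>i\<le>n. \<exists>c\<in>P. covers h (walk (hop_step S)) c i"
    using legs_peaks_cover[of h "hop_step S" n, OF h hop_step_bound] by blast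
  define Q where "Q = P \<union> (\<lambda>j. L * j) ` {..n div L}"
  have Qsub: "Q \<subseteq> {..<Suc n}"
    using P(2) L by (auto simp: Q_def less_Suc_eq_le less_eq_div_iff_mult_less_eq mult.commute)
  have Qmult: "m \<in> Q" if "L dvd m" "m \<le> n" for m
  proof -
    from that obtain k where k: "m = L * k" by (auto simp: dvd_def)
    then have "k \<le> n div L" using that(2) L by (simp add: less_eq_div_iff_mult_less_eq mult.commute)
    then show ?thesis using k by (auto simp: Q_def)
  qed
  have "card Q \<le> card P + card ((\<lambda>j. L * j) ` {..n div L})"
    unfolding Q_def by (rule card_Un_le)
  also have "\<dots> \<le> (fst (legs h (hop_step S) n) div 2 + 2) + (n div L + 1)"
    using P(3) card_image_le[of "{..n div L}" "\<lambda>j. L * j"] by (intro add_mono) auto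
  finally have cardQ: "card Q \<le> fst (legs h (hop_step S) n) div 2 + 3 + n div L" by simp
  define s where "s = (\<bar>q\<bar> powi (h + 1))\<^sup>2 / (2 * (real L)\<^sup>2)"
  define M where "M = \<bar>q\<bar> powi (- h - 1)"
  have M: "M > 0" "M * \<bar>q\<bar> powi (h + 1) = 1"
    using q by (simp_all add: M_def power_int_add[symmetric])
  then have sM: "s * (2 * (real L)\<^sup>2 * M\<^sup>2) = 1"
    using L by (simp add: s_def power_mult_distrib[symmetric] mult.commute)
  have "card {m. m < Suc n \<and> sv m < s} \<le> card Q"
  proof (rule singular_count_upper[OF sys _ Qsub])
    show "finite Q" using P(1) by (simp add: Q_def)
    fix u :: "nat \<Rightarrow> real" assume u0: "\<forall>c\<in>Q. u c = 0"
    let ?\<rho> = "row_apply (Suc n) (chain q S) u"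
    have ui: "(u i)\<^sup>2 \<le> M\<^sup>2 * L * (\<Sum>k<n. (?\<rho> k)\<^sup>2 * of_bool (i \<le> k + L \<and> k < i + L))" if i: "i \<le> n" for i
    proof -
      obtain c where c: "c \<in> P" "covers h (walk (hop_step S)) c i" using P(4) i by blast
      then have "c \<le> n" "c \<in> Q" using P(2) by (auto simp: Q_def)
      then obtain m where m: "m \<in> Q" "m \<le> n" "covers h (walk (hop_step S)) m i" "m \<le> i + L" "i \<le> m + L"
        using nearby_cover[OF c(2) L _ i] Qmult by blast
      have "\<bar>u i\<bar> \<le> M * (\<Sum>k\<in>{min m i..<max m i}. \<bar>?\<rho> k\<bar>)"
        unfolding M_def using u0 m i by (intro chain_cover_bound q) auto
      then have "(u i)\<^sup>2 \<le> (M * (\<Sum>k\<in>{min m i..<max m i}. \<bar>?\<rho> k\<bar>))\<^sup>2"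
        by (subst abs_le_square_iff[symmetric]) auto
      also have "\<dots> = M\<^sup>2 * (\<Sum>k\<in>{min m i..<max m i}. 1 * \<bar>?\<rho> k\<bar>)\<^sup>2"
        by (simp add: power_mult_distrib)
      also have "\<dots> \<le> M\<^sup>2 * ((\<Sum>k\<in>{min m i..<max m i}. 1\<^sup>2) * (\<Sum>k\<in>{min m i..<max m i}. \<bar>?\<rho> k\<bar>\<^sup>2))"
        by (intro mult_left_mono Cauchy_Schwarz_ineq_sum) auto
      also have "\<dots> \<le> M\<^sup>2 * (L * (\<Sum>k<n. (?\<rho> k)\<^sup>2 * of_bool (i \<le> k + L \<and> k < i + L)))"
      proof (intro mult_left_mono mult_mono)
        show "(\<Sum>k\<in>{min m i..<max m i}. (1::real)\<^sup>2) \<le> real L" using m by auto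
        have "(\<Sum>k\<in>{min m i..<max m i}. \<bar>?\<rho> k\<bar>\<^sup>2)
            = (\<Sum>k\<in>{min m i..<max m i}. (?\<rho> k)\<^sup>2 * of_bool (i \<le> k + L \<and> k < i + L))"
          using m by (intro sum.cong) auto
        also have "\<dots> \<le> (\<Sum>k<n. (?\<rho> k)\<^sup>2 * of_bool (i \<le> k + L \<and> k < i + L))"
          using m i by (intro sum_mono2) auto
        finally show "(\<Sum>k\<in>{min m i..<max m i}. \<bar>?\<rho> k\<bar>\<^sup>2) \<le> \<dots>" .
      qed (auto intro: sum_nonneg)
      finally show ?thesis by (simp add: mult.assoc)
    qed
    have cnt: "(\<Sum>i<Suc n. of_bool (i \<le> k + L \<and> k < i + L)) \<le> 2 * real L" for k
    proof -
      have "(\<Sum>i<Suc n. of_bool (i \<le> k + L \<and> k < i + L)) = real (card ({..<Suc n} \<inter> {i. i \<le> k + L \<and> k < i + L}))"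
        by (simp only: sum.inter_restrict[symmetric] sum_of_bool_eq finite_lessThan)
      also have "card ({..<Suc n} \<inter> {i. i \<le> k + L \<and> k < i + L}) \<le> card {Suc k - L..<Suc (k + L)}"
        by (intro card_mono) auto
      also have "card {Suc k - L..<Suc (k + L)} \<le> 2 * L" by simp
      finally show ?thesis by simp
    qed
    have "dot (Suc n) u u = (\<Sum>i<Suc n. (u i)\<^sup>2)" by (simp add: dot_def power2_eq_square)
    also have "\<dots> \<le> (\<Sum>i<Suc n. M\<^sup>2 * L * (\<Sum>k<n. (?\<rho> k)\<^sup>2 * of_bool (i \<le> k + L \<and> k < i + L)))"
      by (intro sum_mono ui) auto
    also have "\<dots> = M\<^sup>2 * L * (\<Sum>k<n. (?\<rho> k)\<^sup>2 * (\<Sum>i<Suc n. of_bool (i \<le> k + L \<and> k < i + L)))"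
      unfolding sum_distrib_left by (subst sum.swap) (rule refl)
    also have "\<dots> \<le> M\<^sup>2 * L * (\<Sum>k<n. (?\<rho> k)\<^sup>2 * (2 * real L))"
      by (intro mult_left_mono sum_mono cnt) simp_all
    also have "\<dots> = 2 * (real L)\<^sup>2 * M\<^sup>2 * dot n ?\<rho> ?\<rho>"
      by (simp add: dot_def sum_distrib_left power2_eq_square mult_ac)
    finally have "s * dot (Suc n) u u \<le> s * (2 * (real L)\<^sup>2 * M\<^sup>2 * dot n ?\<rho> ?\<rho>)"
      by (intro mult_left_mono) (auto simp: s_def)
    then show "s * dot (Suc n) u u \<le> dot n ?\<rho> ?\<rho>"
      using sM by (metis mult.assoc mult_1)
  qed
  then show ?thesis using cardQ unfolding s_def by linarith
qed

section \<open>From the lamplighter group to random hopping on the line\<close>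

definition hop :: "real \<Rightarrow> int set \<Rightarrow> (int \<Rightarrow> real) \<Rightarrow> int \<Rightarrow> real" where
  "hop q S u n = weight q S n * u (n + 1) + weight q S (n - 1) * u (n - 1)"

definition toggle :: "int set \<Rightarrow> int \<Rightarrow> int set" where
  "toggle G n = (if n \<in> G then G - {n} else insert n G)"

text \<open>Coordinates in which left multiplication by the generators moves \<open>n\<close> and toggles a lamp at the edge
  just crossed: the lamp configuration is recorded relative to the moving origin \<open>i - n\<close>, as the set
  \<open>G\<close> of lit edges, where edge \<open>n\<close> joins \<open>n\<close> and \<open>n + 1\<close>. The identity is at \<open>n = i\<close> for an
  arbitrary base point \<open>i\<close>; this freedom makes all diagonal entries equal in mean.\<close>

definition lamp_position :: "int \<Rightarrow> int set \<Rightarrow> int \<Rightarrow> (int \<Rightarrow> int) \<times> int" where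
  "lamp_position i G n = (\<lambda>j. of_bool (j + n - 1 \<in> G), i - n)"

text \<open>The coefficients of the powers of \<open>H\<close> in these coordinates.\<close>

primrec walk_coeff :: "real \<Rightarrow> int \<Rightarrow> nat \<Rightarrow> int set \<Rightarrow> int \<Rightarrow> real" where
  "walk_coeff p i 0 G n = of_bool (G = {} \<and> n = i)"
| "walk_coeff p i (Suc k) G n =
     p * (walk_coeff p i k G (n + 1) + walk_coeff p i k G (n - 1))
     + (1 - p) * (walk_coeff p i k (toggle G n) (n + 1) + walk_coeff p i k (toggle G (n - 1)) (n - 1))"

lemma toggle_in:
  "finite G \<Longrightarrow> finite (toggle G n)" "toggle G n \<subseteq> insert n G"
  by (auto simp: toggle_def)

lemma lamp_position_in_carrier:
  assumes "finite G"
  shows "lamp_position i G n \<in> carrier lamplighter"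
proof -
  have "{j. of_bool (j + n - 1 \<in> G) \<noteq> (0::int)} = (\<lambda>g. g - n + 1) ` G"
    by (auto simp: image_iff intro!: bexI[of _ "_ + n - 1"])
  then show ?thesis
    using assms by (auto simp: lamp_position_def lamplighter_simps carrier_lamps)
qed

lemma convolution_lamplighter_H:
  assumes G: "finite G"
  shows "convolution lamplighter (lamplighter_H p) \<psi> (lamp_position i G n)
    = of_real p * (\<psi> (lamp_position i G (n + 1)) + \<psi> (lamp_position i G (n - 1)))
     + of_real (1 - p) * (\<psi> (lamp_position i (toggle G n) (n + 1))
                         + \<psi> (lamp_position i (toggle G (n - 1)) (n - 1)))"
proof -
  let ?G = lamplighter
  interpret group ?G by (rule group_lamplighter)
  let ?e1 = "(\<lambda>_. 0, 1) :: (int \<Rightarrow> int) \<times> int" and ?e2 = "(\<lambda>_. 0, -1) :: (int \<Rightarrow> int) \<times> int"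
  let ?t1 = "(\<lambda>i. if i = 1 then 1 else 0, 1) :: (int \<Rightarrow> int) \<times> int"
  let ?t2 = "(\<lambda>i. if i = 0 then 1 else 0, -1) :: (int \<Rightarrow> int) \<times> int"
  let ?x = "lamp_position i G n"
  have car: "?e1 \<in> carrier ?G" "?e2 \<in> carrier ?G" "?t1 \<in> carrier ?G" "?t2 \<in> carrier ?G"
    by (auto simp: lamplighter_simps lamps_in_carrier)
  have inv: "inv\<^bsub>?G\<^esub> ?e1 = ?e2" "inv\<^bsub>?G\<^esub> ?t1 = ?t2"
    by (rule inv_equality; use car in \<open>auto simp: lamplighter_simps fun_eq_iff\<close>)+
  then have inv': "inv\<^bsub>?G\<^esub> ?e2 = ?e1" "inv\<^bsub>?G\<^esub> ?t2 = ?t1"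
    using car by (metis inv_inv)+
  have ne0: "(\<lambda>_. 0) \<noteq> (\<lambda>i. if i = 1 then 1 else 0 :: int)" "(\<lambda>_. 0) \<noteq> (\<lambda>i. if i = 0 then 1 else 0 :: int)"
    by (auto simp: fun_eq_iff)
  have ne: "?e1 \<noteq> ?e2" "?e1 \<noteq> ?t1" "?e1 \<noteq> ?t2" "?e2 \<noteq> ?t1" "?e2 \<noteq> ?t2" "?t1 \<noteq> ?t2"
    using ne0 by auto
  have mult: "?e2 \<otimes>\<^bsub>?G\<^esub> ?x = lamp_position i G (n + 1)" "?e1 \<otimes>\<^bsub>?G\<^esub> ?x = lamp_position i G (n - 1)"
    "?t2 \<otimes>\<^bsub>?G\<^esub> ?x = lamp_position i (toggle G n) (n + 1)"
    "?t1 \<otimes>\<^bsub>?G\<^esub> ?x = lamp_position i (toggle G (n - 1)) (n - 1)"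
    unfolding lamp_position_def lamplighter_simps
    by (auto simp: fun_eq_iff toggle_def algebra_simps)
  have "{x. lamplighter_H p x \<noteq> 0} \<subseteq> {?e1, ?e2, ?t1, ?t2}"
    unfolding lamplighter_H_eq delta_def by auto
  then have "convolution ?G (lamplighter_H p) \<psi> ?x
     = (\<Sum>y\<in>{?e1, ?e2, ?t1, ?t2}. lamplighter_H p y * \<psi> (inv\<^bsub>?G\<^esub> y \<otimes>\<^bsub>?G\<^esub> ?x))"
    using car by (intro convolution_superset lamp_position_in_carrier G) auto
  also have "\<dots> = lamplighter_H p ?e1 * \<psi> (lamp_position i G (n + 1))
      + lamplighter_H p ?e2 * \<psi> (lamp_position i G (n - 1))
      + lamplighter_H p ?t1 * \<psi> (lamp_position i (toggle G n) (n + 1))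
      + lamplighter_H p ?t2 * \<psi> (lamp_position i (toggle G (n - 1)) (n - 1))"
    using ne by (simp add: inv inv' mult)
  finally have eq: "convolution ?G (lamplighter_H p) \<psi> ?x = \<dots>" .
  have H: "lamplighter_H p ?e1 = of_real p" "lamplighter_H p ?e2 = of_real p"
     "lamplighter_H p ?t1 = of_real (1 - p)" "lamplighter_H p ?t2 = of_real (1 - p)"
    unfolding lamplighter_H_eq using ne by (simp_all add: delta_def)
  show ?thesis unfolding eq H by (simp only: distrib_left add.assoc)
qed

lemma convolution_power_eq_walk_coeff:
  "finite G \<Longrightarrow> (convolution lamplighter (lamplighter_H p) ^^ k) (delta \<one>\<^bsub>lamplighter\<^esub>) (lamp_position i G n)
     = of_real (walk_coeff p i k G n)"
proof (induction k arbitrary: G n)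
  case 0
  have "lamp_position i G n = (\<lambda>_. 0, 0) \<longleftrightarrow> G = {} \<and> n = i"
    by (auto simp: lamp_position_def fun_eq_iff intro: ccontr) (metis add_diff_cancel_right' diff_add_cancel)
  then show ?case by (simp add: delta_def lamplighter_simps)
next
  case (Suc k)
  then show ?case by (simp add: convolution_lamplighter_H toggle_in)
qed

lemma ell2_inner_delta:
  assumes "g \<in> carrier G"
  shows "ell2_inner G (delta g) \<psi> = \<psi> g"
proof -
  have "ell2_inner G (delta g) \<psi> = (\<Sum>\<^sub>\<infinity>x\<in>{g}. cnj (delta g x) * \<psi> x)"
    unfolding ell2_inner_def using assms
    by (intro infsum_cong_neutral) (auto simp: delta_def)
  then show ?thesis by (simp add: delta_def)
qed

lemma lamplighter_moment_eq_walk_coeff: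
  "ell2_inner lamplighter (delta \<one>\<^bsub>lamplighter\<^esub>)
     ((convolution lamplighter (lamplighter_H p) ^^ k) (delta \<one>\<^bsub>lamplighter\<^esub>))
   = of_real (walk_coeff p i k {} i)"
proof -
  interpret group lamplighter by (rule group_lamplighter)
  have "\<one>\<^bsub>lamplighter\<^esub> = lamp_position i {} i" by (simp add: lamp_position_def lamplighter_simps)
  then show ?thesis
    using convolution_power_eq_walk_coeff[of "{}" k p i i]
    by (subst ell2_inner_delta) (simp_all add: lamp_position_in_carrier)
qed

lemma walk_coeff_support: "\<bar>n - i\<bar> > int k \<Longrightarrow> walk_coeff p i k G n = 0"
  by (induction k arbitrary: G n) auto

lemma hop_power_support: "\<bar>n - i\<bar> > int k \<Longrightarrow> (hop q S ^^ k) (\<lambda>m. of_bool (m = i)) n = 0"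
  by (induction k arbitrary: n) (auto simp: hop_def)

lemma hop_power_parity: "odd (int k + n - i) \<Longrightarrow> (hop q S ^^ k) (\<lambda>m. of_bool (m = i)) n = 0"
proof (induction k arbitrary: n)
  case (Suc k)
  have "odd (int k + (n + 1) - i)" "odd (int k + (n - 1) - i)" using Suc.prems by (simp, argo)+
  then show ?case using Suc.IH by (simp add: hop_def[of _ _ _ n])
qed auto

lemma config_mean_add: "config_mean W (\<lambda>S. F S + F' S) = config_mean W F + config_mean W F'"
  by (simp add: config_mean_def sum.distrib add_divide_distrib)

lemma config_mean_scale: "config_mean W (\<lambda>S. c * F S) = c * config_mean W F"
  by (simp add: config_mean_def sum_distrib_left)

lemma config_mean_cong: "(\<And>S. S \<subseteq> W \<Longrightarrow> F S = F' S) \<Longrightarrow> config_mean W F = config_mean W F'"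
  by (simp add: config_mean_def)

lemma config_mean_const: "finite W \<Longrightarrow> config_mean W (\<lambda>S. c) = c"
  by (simp add: config_mean_def card_Pow)

lemma config_mean_mono: "(\<And>S. S \<subseteq> W \<Longrightarrow> F S \<le> F' S) \<Longrightarrow> config_mean W F \<le> config_mean W F'"
  unfolding config_mean_def by (intro divide_right_mono sum_mono) auto

lemma config_mean_sum: "config_mean W (\<lambda>S. \<Sum>i\<in>I. F i S) = (\<Sum>i\<in>I. config_mean W (F i))"
  unfolding config_mean_def sum_divide_distrib[symmetric] by (subst sum.swap) (rule refl)

text \<open>Orthogonality of characters: flipping the sign at a point of \<open>G\<close> cancels the terms in pairs.\<close>

lemma config_mean_character:
  assumes W: "finite W" and G: "G \<subseteq> W"
  shows "config_mean W (\<lambda>S. (-1) ^ card (S \<inter> G)) = of_bool (G = {})"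
proof (cases "G = {}")
  case True
  then show ?thesis using W by (simp add: config_mean_const)
next
  case False
  then obtain x where x: "x \<in> G" by blast
  define V where "V = W - {x}"
  have V: "finite V" "x \<notin> V" "W = insert x V" using W G x by (auto simp: V_def)
  have "(\<Sum>S\<in>Pow W. (-1::real) ^ card (S \<inter> G))
      = (\<Sum>S\<in>Pow V. (-1) ^ card (S \<inter> G) + (-1) ^ card (insert x S \<inter> G))"
    unfolding V(3) by (rule sum_Pow_insert[OF V(1,2)])
  also have "\<dots> = 0"
  proof (rule sum.neutral, rule ballI)
    fix S assume S: "S \<in> Pow V"
    then have "finite S" "x \<notin> S" using V finite_subset by auto
    then show "(-1::real) ^ card (S \<inter> G) + (-1) ^ card (insert x S \<inter> G) = 0"
      using x by simp
  qed
  finally show ?thesis using False by (simp add: config_mean_def)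
qed

lemma character_toggle:
  assumes "finite G"
  shows "(-1::real) ^ card (S \<inter> toggle G n) = (if n \<in> S then -1 else 1) * (-1) ^ card (S \<inter> G)"
proof (cases "n \<in> S")
  case True
  show ?thesis
  proof (cases "n \<in> G")
    case nG: True
    have "S \<inter> G = insert n (S \<inter> (G - {n}))" using True nG by auto
    moreover have "card (insert n (S \<inter> (G - {n}))) = Suc (card (S \<inter> (G - {n})))"
      using assms by simp
    ultimately have "card (S \<inter> G) = Suc (card (S \<inter> (G - {n})))" by simp
    then show ?thesis using True nG by (simp add: toggle_def)
  next
    case False
    have "S \<inter> insert n G = insert n (S \<inter> G)" using True by auto
    then show ?thesis using True False assms by (simp add: toggle_def)
  qed
next
  case False
  then have "S \<inter> toggle G n = S \<inter> G" by (auto simp: toggle_def)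
  then show ?thesis using False by simp
qed

text \<open>The Fourier transform: averaging a toggle against a character replaces \<open>p + (1 - p) \<sigma>\<close> by the
  edge weight. The window has to contain the edges reachable in \<open>k\<close> steps; further out both sides
  vanish by finite propagation.\<close>

lemma walk_coeff_eq_mean:
  assumes W: "finite W" and q: "q = 2 * p - 1"
  shows "G \<subseteq> W \<Longrightarrow> {i - int k..<i + int k} \<subseteq> W \<Longrightarrow>
    walk_coeff p i k G n
      = config_mean W (\<lambda>S. (-1) ^ card (S \<inter> G) * (hop q S ^^ k) (\<lambda>m. of_bool (m = i)) n)"
proof (induction k arbitrary: G n)
  case 0
  show ?case
    using config_mean_character[OF W 0(1)] config_mean_scale[of W "of_bool (n = i)" "\<lambda>S. (-1) ^ card (S \<inter> G)"]
    by (cases "n = i") (simp_all add: config_mean_const W)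
next
  case (Suc k)
  let ?u = "\<lambda>S. (hop q S ^^ k) (\<lambda>m. of_bool (m = i))"
  let ?M = "\<lambda>G n. config_mean W (\<lambda>S. (-1) ^ card (S \<inter> G) * ?u S n)"
  have Wk: "{i - int k..<i + int k} \<subseteq> W" using Suc.prems(2) by auto
  have fin: "finite G" using Suc.prems(1) W finite_subset by blast
  have step: "p * walk_coeff p i k G m + (1 - p) * walk_coeff p i k (toggle G l) m
      = config_mean W (\<lambda>S. (-1) ^ card (S \<inter> G) * (weight q S l * ?u S m))"
    if ml: "m = l + 1 \<or> m = l" for m l
  proof (cases "\<bar>m - i\<bar> > int k")
    case True
    then show ?thesis by (simp add: walk_coeff_support hop_power_support config_mean_const W)
  next
    case False
    then have "l \<in> {i - int (Suc k)..<i + int (Suc k)}" using ml by auto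
    then have "l \<in> W" using Suc.prems(2) by blast
    then have "toggle G l \<subseteq> W" using toggle_in(2)[of G l] Suc.prems(1) by blast
    then have "p * walk_coeff p i k G m + (1 - p) * walk_coeff p i k (toggle G l) m
        = p * ?M G m + (1 - p) * ?M (toggle G l) m"
      using Suc.IH[OF _ Wk] Suc.prems(1) by simp
    also have "\<dots> = config_mean W (\<lambda>S. p * ((-1) ^ card (S \<inter> G) * ?u S m)
          + (1 - p) * ((-1) ^ card (S \<inter> toggle G l) * ?u S m))"
      by (simp only: config_mean_add config_mean_scale)
    also have "\<dots> = config_mean W (\<lambda>S. (-1) ^ card (S \<inter> G) * (weight q S l * ?u S m))"
      by (intro config_mean_cong) (simp add: character_toggle[OF fin] weight_def q algebra_simps)
    finally show ?thesis .
  qed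
  have "walk_coeff p i (Suc k) G n
     = (p * walk_coeff p i k G (n + 1) + (1 - p) * walk_coeff p i k (toggle G n) (n + 1))
     + (p * walk_coeff p i k G (n - 1) + (1 - p) * walk_coeff p i k (toggle G (n - 1)) (n - 1))"
    by (simp add: algebra_simps)
  also have "\<dots> = config_mean W (\<lambda>S. (-1) ^ card (S \<inter> G) * (weight q S n * ?u S (n + 1)))
       + config_mean W (\<lambda>S. (-1) ^ card (S \<inter> G) * (weight q S (n - 1) * ?u S (n - 1)))"
    by (simp only: step simp_thms)
  also have "\<dots> = config_mean W (\<lambda>S. (-1) ^ card (S \<inter> G) * (hop q S ^^ Suc k) (\<lambda>m. of_bool (m = i)) n)"
    unfolding config_mean_add[symmetric]
    by (intro config_mean_cong) (simp add: hop_def algebra_simps)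
  finally show ?case .
qed

lemma mat_apply_gram_chain:
  assumes "i \<le> n"
  shows "mat_apply (Suc n) (gram n (chain q S)) u i
     = (if i < n then weight q S (2 * int i) * row_apply (Suc n) (chain q S) u i else 0)
     + (if 0 < i then weight q S (2 * int i - 1) * row_apply (Suc n) (chain q S) u (i - 1) else 0)"
proof -
  let ?\<rho> = "row_apply (Suc n) (chain q S) u"
  have "mat_apply (Suc n) (gram n (chain q S)) u i = (\<Sum>r<n. chain q S r i * ?\<rho> r)"
    by (rule mat_apply_gram)
  also have "\<dots> = (\<Sum>r<n. (if r = i then weight q S (2 * int i) * ?\<rho> i else 0)
        + (if r = i - 1 then (if 0 < i then weight q S (2 * int i - 1) * ?\<rho> (i - 1) else 0) else 0))"
    by (intro sum.cong refl) (auto simp: chain_def of_nat_diff algebra_simps)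
  also have "\<dots> = (if i < n then weight q S (2 * int i) * ?\<rho> i else 0)
     + (if 0 < i then weight q S (2 * int i - 1) * ?\<rho> (i - 1) else 0)"
    using assms by (auto simp: sum.distrib)
  finally show ?thesis .
qed

text \<open>Two hops lead from even sites to even sites. The ends of the chain are not felt within \<open>k\<close> double
  hops from a site at distance at least \<open>k\<close> from them.\<close>

lemma gram_chain_power_eq_hop:
  "k \<le> i \<Longrightarrow> i + k \<le> n \<Longrightarrow> j \<le> n \<Longrightarrow>
    (mat_apply (Suc n) (gram n (chain q S)) ^^ k) (\<lambda>j. of_bool (j = i)) j
     = (hop q S ^^ (2 * k)) (\<lambda>m. of_bool (m = 2 * int i)) (2 * int j)"
proof (induction k arbitrary: j)
  case 0
  then show ?case by simp
next
  case (Suc k)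
  let ?T = "mat_apply (Suc n) (gram n (chain q S))"
  let ?u = "(?T ^^ k) (\<lambda>j. of_bool (j = i))"
  let ?f = "(hop q S ^^ (2 * k)) (\<lambda>m. of_bool (m = 2 * int i))"
  have IH: "?u j = ?f (2 * int j)" if "j \<le> n" for j using Suc that by simp
  have row: "row_apply (Suc n) (chain q S) ?u r = hop q S ?f (2 * int r + 1)" if "r < n" for r
    unfolding row_apply_chain[OF that] using IH[of r] IH[of "Suc r"] that
    by (simp add: hop_def algebra_simps)
  have f0: "?f m = 0" if "m \<le> 0 \<or> m \<ge> 2 * int n" for m
    using that Suc.prems by (intro hop_power_support) auto
  have left: "(if 0 < j then weight q S (2 * int j - 1) * row_apply (Suc n) (chain q S) ?u (j - 1) else 0)
      = weight q S (2 * int j - 1) * hop q S ?f (2 * int j - 1)"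
  proof (cases "j = 0")
    case True
    then show ?thesis by (simp add: hop_def f0)
  next
    case False
    then have "2 * int (j - 1) + 1 = 2 * int j - 1" by (simp add: of_nat_diff)
    then show ?thesis using row[of "j - 1"] False Suc.prems(3) by simp
  qed
  have right: "(if j < n then weight q S (2 * int j) * row_apply (Suc n) (chain q S) ?u j else 0)
      = weight q S (2 * int j) * hop q S ?f (2 * int j + 1)"
  proof (cases "j = n")
    case True
    then show ?thesis by (simp add: hop_def f0)
  next
    case False
    then show ?thesis using row[of j] Suc.prems(3) by simp
  qed
  have "(?T ^^ Suc k) (\<lambda>j. of_bool (j = i)) j = ?T ?u j" by simp
  also have "\<dots> = hop q S (hop q S ?f) (2 * int j)"
    unfolding mat_apply_gram_chain[OF Suc.prems(3)] left right by (simp add: hop_def)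
  finally show ?case by simp
qed

lemma walk_coeff_odd:
  assumes "odd k"
  shows "walk_coeff p i k {} i = 0"
  using walk_coeff_eq_mean[of "{i - int k..<i + int k}" "2 * p - 1" p "{}" i k i] assms
  by (simp add: hop_power_parity config_mean_const)

lemma walk_coeff_even:
  assumes "k \<le> i" "i + k \<le> n"
  shows "walk_coeff p (2 * int i) (2 * k) {} (2 * int i)
    = config_mean {0..<2 * int n}
        (\<lambda>S. (mat_apply (Suc n) (gram n (chain (2 * p - 1) S)) ^^ k) (\<lambda>j. of_bool (j = i)) i)"
proof -
  have "walk_coeff p (2 * int i) (2 * k) {} (2 * int i) = config_mean {0..<2 * int n}
      (\<lambda>S. (-1) ^ card (S \<inter> {}) * (hop (2 * p - 1) S ^^ (2 * k)) (\<lambda>m. of_bool (m = 2 * int i)) (2 * int i))"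
    by (rule walk_coeff_eq_mean) (use assms in auto)
  then show ?thesis using assms by (simp add: gram_chain_power_eq_hop)
qed

lemma chain_singular_value_le:
  assumes q: "q \<noteq> 0" "\<bar>q\<bar> < 1" and sys: "singular_system n (Suc n) (chain q S) v sv" and m: "m < Suc n"
  shows "sv m \<le> 4"
proof -
  let ?\<rho> = "row_apply (Suc n) (chain q S) (v m)"
  have w: "(weight q S l)\<^sup>2 \<le> 1" for l
    using weight_bounds(2)[OF q] by (simp add: abs_square_le_1)
  have row: "(?\<rho> r)\<^sup>2 \<le> 2 * (v m r)\<^sup>2 + 2 * (v m (Suc r))\<^sup>2" if "r < n" for r
  proof -
    define x where "x = weight q S (2 * int r) * v m r"
    define y where "y = weight q S (2 * int r + 1) * v m (Suc r)"
    have "x\<^sup>2 \<le> (v m r)\<^sup>2" "y\<^sup>2 \<le> (v m (Suc r))\<^sup>2"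
      unfolding x_def y_def power_mult_distrib by (intro mult_left_le_one_le w; simp)+
    moreover have "(x + y)\<^sup>2 \<le> 2 * x\<^sup>2 + 2 * y\<^sup>2"
      using zero_le_power2[of "x - y"] by (simp add: power2_eq_square algebra_simps)
    ultimately show ?thesis
      unfolding row_apply_chain[OF that] x_def[symmetric] y_def[symmetric] by linarith
  qed
  have "sv m = (\<Sum>r<n. (?\<rho> r)\<^sup>2)"
    using singular_value_eq[OF sys m] by (simp add: dot_def power2_eq_square)
  also have "\<dots> \<le> (\<Sum>r<n. 2 * (v m r)\<^sup>2 + 2 * (v m (Suc r))\<^sup>2)"
    by (intro sum_mono row) auto
  also have "\<dots> = 2 * (\<Sum>r<n. (v m r)\<^sup>2) + 2 * (\<Sum>r<n. (v m (Suc r))\<^sup>2)"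
    by (simp add: sum.distrib sum_distrib_left)
  also have "\<dots> \<le> 2 * (\<Sum>r<Suc n. (v m r)\<^sup>2) + 2 * (\<Sum>r<Suc n. (v m r)\<^sup>2)"
  proof -
    have "(\<Sum>r<n. (v m r)\<^sup>2) \<le> (\<Sum>r<Suc n. (v m r)\<^sup>2)" by simp
    moreover have "(\<Sum>r<n. (v m (Suc r))\<^sup>2) \<le> (\<Sum>r<Suc n. (v m r)\<^sup>2)"
      unfolding sum.lessThan_Suc_shift by simp
    ultimately show ?thesis by linarith
  qed
  also have "(\<Sum>r<Suc n. (v m r)\<^sup>2) = dot (Suc n) (v m) (v m)"
    by (simp add: dot_def power2_eq_square)
  also have "\<dots> = 1" using singular_orth[OF sys m m] by simp
  finally show ?thesis by simp
qed

section \<open>Determinacy and limits of moments\<close>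

text \<open>The moments grow at most geometrically, so the Taylor expansion of the characteristic function
  converges to it, and characteristic functions determine the distribution.\<close>

lemma real_distribution_eq_of_moments:
  fixes M1 M2 :: "real measure"
  assumes M: "real_distribution M1" "real_distribution M2"
    and int: "\<And>k. integrable M1 (\<lambda>x. x ^ k)" "\<And>k. integrable M2 (\<lambda>x. x ^ k)"
    and eq: "\<And>k. (\<integral>x. x ^ k \<partial>M1) = (\<integral>x. x ^ k \<partial>M2)"
    and le: "\<And>k. even k \<Longrightarrow> (\<integral>x. x ^ k \<partial>M2) \<le> B ^ k" and B: "B \<ge> 0"
  shows "M1 = M2"
proof (rule Levy_uniqueness[OF M])
  interpret M1: real_distribution M1 by fact
  interpret M2: real_distribution M2 by fact
  show "char M1 = char M2"
  proof
    fix t :: real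
    define e where "e k = 4 * ((\<bar>t\<bar> * B) ^ (2 * k) / fact (2 * k))" for k
    define T where "T n = (\<Sum>k\<le>n. (\<i> * t) ^ k / fact k * (\<integral>x. x ^ k \<partial>M2))" for n
    have "cmod (char M1 t - char M2 t) \<le> e j" for j
    proof -
      let ?n = "2 * j"
      have abs: "\<bar>x\<bar> ^ ?n = x ^ ?n" for x :: real by (simp add: power_even_abs)
      have "cmod (char M1 t - T ?n) \<le> (2 * \<bar>t\<bar> ^ ?n / fact ?n) * (\<integral>x. x ^ ?n \<partial>M2)"
        using M1.char_approx1[of ?n t] int(1) unfolding T_def eq[symmetric] abs by simp
      moreover have "cmod (char M2 t - T ?n) \<le> (2 * \<bar>t\<bar> ^ ?n / fact ?n) * (\<integral>x. x ^ ?n \<partial>M2)"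
        using M2.char_approx1[of ?n t] int(2) unfolding T_def abs by simp
      moreover have "(2 * \<bar>t\<bar> ^ ?n / fact ?n) * (\<integral>x. x ^ ?n \<partial>M2) \<le> (2 * \<bar>t\<bar> ^ ?n / fact ?n) * B ^ ?n"
        by (intro mult_left_mono le) auto
      moreover have "cmod (char M1 t - char M2 t) \<le> cmod (char M1 t - T ?n) + cmod (char M2 t - T ?n)"
        using norm_triangle_ineq4[of "char M1 t - T ?n" "char M2 t - T ?n"] by simp
      ultimately show ?thesis by (simp add: e_def power_mult_distrib)
    qed
    moreover have "e \<longlonglongrightarrow> 0"
    proof -
      have "(\<lambda>k. inverse (fact k) * (\<bar>t\<bar> * B) ^ k) \<longlonglongrightarrow> 0"
        by (rule summable_LIMSEQ_zero[OF summable_exp])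
      from LIMSEQ_subseq_LIMSEQ[OF this, of "\<lambda>k. 2 * k"]
      have "(\<lambda>k. inverse (fact (2 * k)) * (\<bar>t\<bar> * B) ^ (2 * k)) \<longlonglongrightarrow> 0"
        by (simp add: strict_mono_def o_def)
      from tendsto_mult_left[OF this, of 4] show ?thesis
        unfolding e_def by (simp add: field_simps)
    qed
    ultimately have "cmod (char M1 t - char M2 t) \<le> 0"
      by (intro tendsto_lowerbound[of e 0 sequentially]) auto
    then show "char M1 t = char M2 t" by simp
  qed
qed

text \<open>Helly selection yields a weak limit. It inherits the compact support, tested with the bounded
  continuous \<open>g\<close> vanishing exactly on \<open>[-B, B]\<close>, and then the moments, tested with powers of the
  truncation \<open>c\<close>.\<close>

lemma moments_limit_exists:
  fixes L :: "nat \<Rightarrow> real measure"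
  assumes L: "\<And>n. real_distribution (L n)" and supp: "\<And>n. AE x in L n. \<bar>x\<bar> \<le> B"
    and B: "B \<ge> 0" and mom: "\<And>k. (\<lambda>n. \<integral>x. x ^ k \<partial>L n) \<longlonglongrightarrow> m k"
  shows "\<exists>r M. strict_mono (r :: nat \<Rightarrow> nat) \<and> real_distribution M \<and> weak_conv_m (L \<circ> r) M \<and>
           (\<forall>k. integrable M (\<lambda>x. x ^ k) \<and> (\<integral>x. x ^ k \<partial>M) = m k)"
proof -
  have "tight L"
    unfolding tight_def
  proof (intro conjI allI impI L)
    fix \<epsilon> :: real assume "\<epsilon> > 0"
    have "measure (L n) {- B - 1<..B} = 1" for n
    proof -
      interpret real_distribution "L n" by (rule L)
      have "AE x in L n. x \<in> {- B - 1<..B}" using supp[of n] by eventually_elim auto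
      then show ?thesis by (subst prob_eq_1) auto
    qed
    then show "\<exists>a b. a < b \<and> (\<forall>n. measure (L n) {a<..b} > 1 - \<epsilon>)"
      using B \<open>\<epsilon> > 0\<close> by (intro exI[of _ "- B - 1"] exI[of _ B]) auto
  qed
  from tight_imp_convergent_subsubsequence[OF this strict_mono_id]
  obtain r M where r: "strict_mono r" and M: "real_distribution M" and conv: "weak_conv_m (L \<circ> r) M"
    by (auto simp: o_def id_def)
  interpret M: real_distribution M by fact
  have lim: "(\<lambda>n. integral\<^sup>L (L (r n)) f) \<longlonglongrightarrow> integral\<^sup>L M f"
    if "continuous_on UNIV f" "\<And>x. \<bar>f x\<bar> \<le> b" for f :: "real \<Rightarrow> real" and b
    using weak_conv_imp_integral_bdd_continuous_conv[OF _ M conv, of f b] L that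
    by (simp add: continuous_on_eq_continuous_at o_def)
  define g where "g x = min 1 (max 0 (\<bar>x\<bar> - B))" for x :: real
  have gc: "continuous_on UNIV g" unfolding g_def by (intro continuous_intros)
  have g1: "\<bar>g x\<bar> \<le> 1" for x by (auto simp: g_def)
  have "integral\<^sup>L (L n) g = 0" for n
    by (rule integral_eq_zero_AE) (use supp[of n] in \<open>eventually_elim, auto simp: g_def\<close>)
  then have "integral\<^sup>L M g = 0" using lim[OF gc g1] by (simp add: LIMSEQ_const_iff)
  moreover have "integrable M g"
    using g1 borel_measurable_continuous_onI[OF gc] by (intro M.integrable_const_bound[of _ 1]) auto
  ultimately have "AE x in M. g x = 0"
    by (subst (asm) integral_nonneg_eq_0_iff_AE) (auto simp: g_def)
  then have Msupp: "AE x in M. \<bar>x\<bar> \<le> B" by eventually_elim (auto simp: g_def min_def max_def split: if_splits)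
  define c where "c x = max (- B) (min B x)" for x :: real
  have cabs: "\<bar>c x\<bar> \<le> B" for x using B by (auto simp: c_def)
  have ceq: "c x = x" if "\<bar>x\<bar> \<le> B" for x using that by (auto simp: c_def)
  have ccont: "continuous_on UNIV (\<lambda>x. c x ^ k)" for k unfolding c_def by (intro continuous_intros)
  have cb: "\<bar>c x ^ k\<bar> \<le> B ^ k" for x k unfolding power_abs by (intro power_mono cabs) auto
  have clip: "(\<integral>x. c x ^ k \<partial>N) = (\<integral>x. x ^ k \<partial>N)" if N: "real_distribution N" and "AE x in N. \<bar>x\<bar> \<le> B" for N k
  proof -
    interpret N: real_distribution N by fact
    show ?thesis
    proof (rule integral_cong_AE)
      show "(\<lambda>x. c x ^ k) \<in> borel_measurable N"
        using borel_measurable_continuous_onI[OF ccont] by simp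
      show "AE x in N. c x ^ k = x ^ k" using that(2) by eventually_elim (simp add: ceq)
    qed simp
  qed
  have "(\<integral>x. x ^ k \<partial>M) = m k" for k
  proof -
    have "(\<lambda>n. \<integral>x. x ^ k \<partial>L (r n)) \<longlonglongrightarrow> (\<integral>x. x ^ k \<partial>M)"
      using lim[OF ccont cb, of k] clip[OF L supp] clip[OF M Msupp] by simp
    moreover have "(\<lambda>n. \<integral>x. x ^ k \<partial>L (r n)) \<longlonglongrightarrow> m k"
      using LIMSEQ_subseq_LIMSEQ[OF mom r] by (simp add: o_def)
    ultimately show ?thesis by (rule LIMSEQ_unique)
  qed
  moreover have "integrable M (\<lambda>x. x ^ k)" for k
  proof (rule M.integrable_const_bound)
    show "AE x in M. norm (x ^ k) \<le> B ^ k"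
      using Msupp by eventually_elim (auto simp: power_abs intro: power_mono)
  qed simp
  ultimately show ?thesis using r M conv by blast
qed

section \<open>The spectral measure as a limit of finite chains\<close>

definition sq_singular_value :: "nat \<Rightarrow> real \<Rightarrow> int set \<Rightarrow> nat \<Rightarrow> real" where
  "sq_singular_value n q S = (SOME sv. \<exists>v. singular_system n (Suc n) (chain q S) v sv)"

lemma sq_singular_value_system: "\<exists>v. singular_system n (Suc n) (chain q S) v (sq_singular_value n q S)"
proof -
  have "\<exists>sv v. singular_system n (Suc n) (chain q S) v sv"
    using singular_system_exists by blast
  then show ?thesis unfolding sq_singular_value_def by (rule someI_ex)
qed

text \<open>The law of a uniformly chosen singular value with a uniform sign, in a uniformly random
  configuration. The signs account for the symmetry of the spectrum of a bipartite hopping operator.\<close>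

definition level_measure :: "real \<Rightarrow> nat \<Rightarrow> real measure" where
  "level_measure q n =
     distr (measure_pmf (pmf_of_set (Pow {0..<2 * int n} \<times> {..n} \<times> {-1, 1}))) borel
       (\<lambda>(S, m, s). s * sqrt (sq_singular_value n q S m))"

lemma real_distribution_level_measure: "real_distribution (level_measure q n)"
  unfolding level_measure_def
  by (intro prob_space.real_distribution_distr measure_pmf.prob_space_axioms) simp

lemma integral_level_measure:
  assumes f: "f \<in> borel_measurable borel"
  shows "integral\<^sup>L (level_measure q n) f = config_mean {0..<2 * int n}
     (\<lambda>S. (\<Sum>m\<le>n. (f (- sqrt (sq_singular_value n q S m)) + f (sqrt (sq_singular_value n q S m))) / 2) / real (n + 1))"
proof -
  let ?W = "{0..<2 * int n}"
  have "integral\<^sup>L (level_measure q n) f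
     = (\<integral>x. f (case x of (S, m, s) \<Rightarrow> s * sqrt (sq_singular_value n q S m))
          \<partial>measure_pmf (pmf_of_set (Pow ?W \<times> {..n} \<times> {-1, 1})))"
    unfolding level_measure_def using f by (subst integral_distr) auto
  also have "\<dots> = (\<Sum>x\<in>Pow ?W \<times> {..n} \<times> {-1, 1}. f (case x of (S, m, s) \<Rightarrow> s * sqrt (sq_singular_value n q S m)))
        / card (Pow ?W \<times> {..n} \<times> {-1, 1::real})"
    by (subst integral_pmf_of_set) auto
  also have "(\<Sum>x\<in>Pow ?W \<times> {..n} \<times> {-1, 1}. f (case x of (S, m, s) \<Rightarrow> s * sqrt (sq_singular_value n q S m)))
      = (\<Sum>S\<in>Pow ?W. \<Sum>m\<le>n. f (- sqrt (sq_singular_value n q S m)) + f (sqrt (sq_singular_value n q S m)))"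
    by (simp add: sum.cartesian_product')
  also have "real (card (Pow ?W \<times> {..n} \<times> {-1, 1::real})) = 2 ^ card ?W * (2 * real (n + 1))"
    by (simp add: card_cartesian_product card_Pow distrib_left)
  also have "(\<Sum>S\<in>Pow ?W. \<Sum>m\<le>n. f (- sqrt (sq_singular_value n q S m)) + f (sqrt (sq_singular_value n q S m))) / \<dots>
    = config_mean ?W
     (\<lambda>S. (\<Sum>m\<le>n. (f (- sqrt (sq_singular_value n q S m)) + f (sqrt (sq_singular_value n q S m))) / 2) / real (n + 1))"
    unfolding config_mean_def sum_divide_distrib[symmetric]
    by (simp add: divide_divide_eq_left algebra_simps)
  finally show ?thesis .
qed

lemma sq_singular_value_bounds:
  assumes "q \<noteq> 0" "\<bar>q\<bar> < 1" "m \<le> n"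
  shows "0 \<le> sq_singular_value n q S m" "sq_singular_value n q S m \<le> 4"
proof -
  obtain v where v: "singular_system n (Suc n) (chain q S) v (sq_singular_value n q S)"
    using sq_singular_value_system by blast
  show "0 \<le> sq_singular_value n q S m" "sq_singular_value n q S m \<le> 4"
    using singular_value_nonneg[OF v, of m] chain_singular_value_le[OF assms(1,2) v, of m] assms(3) by auto
qed

lemma level_measure_support:
  assumes q: "q \<noteq> 0" "\<bar>q\<bar> < 1"
  shows "AE x in level_measure q n. \<bar>x\<bar> \<le> 2"
proof -
  have "sqrt (sq_singular_value n q S m) \<le> 2" if "m \<le> n" for S m
    using sq_singular_value_bounds(2)[OF q that, of S] by (intro real_le_lsqrt) auto
  moreover have "0 \<le> sqrt (sq_singular_value n q S m)" if "m \<le> n" for S m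
    using sq_singular_value_bounds(1)[OF q that, of S] by simp
  moreover have ne: "Pow {0..<2 * int n} \<times> {..n} \<times> {-1, 1::real} \<noteq> {}" by auto
  ultimately show ?thesis
    unfolding level_measure_def
    by (subst AE_distr_iff) (auto simp: AE_measure_pmf_iff set_pmf_of_set[OF ne] abs_mult)
qed

definition moment :: "real \<Rightarrow> nat \<Rightarrow> real" where
  "moment p k = walk_coeff p 0 k {} 0"

text \<open>All base points describe the same moment of the group element.\<close>

lemma walk_coeff_diagonal: "walk_coeff p i k {} i = moment p k"
  using lamplighter_moment_eq_walk_coeff[where p = p and k = k and i = i]
    lamplighter_moment_eq_walk_coeff[where p = p and k = k and i = 0]
  by (simp add: moment_def)

definition diag_mean :: "real \<Rightarrow> nat \<Rightarrow> nat \<Rightarrow> nat \<Rightarrow> real" where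
  "diag_mean q n k i = config_mean {0..<2 * int n}
     (\<lambda>S. (mat_apply (Suc n) (gram n (chain q S)) ^^ k) (\<lambda>j. of_bool (j = i)) i)"

lemma diag_mean_bulk: "k \<le> i \<Longrightarrow> i + k \<le> n \<Longrightarrow> diag_mean (2 * p - 1) n k i = moment p (2 * k)"
  using walk_coeff_even[of k i n p] by (simp add: diag_mean_def walk_coeff_diagonal)

lemma diag_mean_bounds:
  assumes q: "q \<noteq> 0" "\<bar>q\<bar> < 1" and i: "i \<le> n"
  shows "0 \<le> diag_mean q n k i" "diag_mean q n k i \<le> 4 ^ k"
proof -
  have "0 \<le> (mat_apply (Suc n) (gram n (chain q S)) ^^ k) (\<lambda>j. of_bool (j = i)) i \<and>
    (mat_apply (Suc n) (gram n (chain q S)) ^^ k) (\<lambda>j. of_bool (j = i)) i \<le> 4 ^ k" for S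
  proof -
    obtain v where v: "singular_system n (Suc n) (chain q S) v (sq_singular_value n q S)"
      using sq_singular_value_system by blast
    have i': "i < Suc n" using i by simp
    have "(\<Sum>m<Suc n. sq_singular_value n q S m ^ k * (v m i)\<^sup>2) \<le> (\<Sum>m<Suc n. 4 ^ k * (v m i)\<^sup>2)"
      using sq_singular_value_bounds[OF q] by (intro sum_mono mult_right_mono power_mono) auto
    also have "\<dots> = 4 ^ k" using singular_diagonal_one[OF v i'] by (simp only: sum_distrib_left[symmetric])
    finally show ?thesis unfolding singular_power_diagonal[OF v i']
      using sq_singular_value_bounds[OF q] by (auto intro!: sum_nonneg simp del: sum.lessThan_Suc)
  qed
  then have "config_mean {0..<2 * int n} (\<lambda>S. 0) \<le> diag_mean q n k i"
    "diag_mean q n k i \<le> config_mean {0..<2 * int n} (\<lambda>S. 4 ^ k)"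
    unfolding diag_mean_def by (auto intro!: config_mean_mono)
  then show "0 \<le> diag_mean q n k i" "diag_mean q n k i \<le> 4 ^ k"
    by (simp_all add: config_mean_const)
qed

lemma level_measure_even_moment:
  assumes q: "q \<noteq> 0" "\<bar>q\<bar> < 1"
  shows "(\<integral>x. x ^ (2 * k) \<partial>level_measure q n) = (\<Sum>i\<le>n. diag_mean q n k i) / real (n + 1)"
proof -
  have "(\<integral>x. x ^ (2 * k) \<partial>level_measure q n) = config_mean {0..<2 * int n}
     (\<lambda>S. (\<Sum>m\<le>n. ((- sqrt (sq_singular_value n q S m)) ^ (2 * k) + sqrt (sq_singular_value n q S m) ^ (2 * k)) / 2) / real (n + 1))"
    by (subst integral_level_measure) simp_all
  also have "\<dots> = config_mean {0..<2 * int n}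
     (\<lambda>S. (1 / real (n + 1)) * (\<Sum>i\<le>n. (mat_apply (Suc n) (gram n (chain q S)) ^^ k) (\<lambda>j. of_bool (j = i)) i))"
  proof (rule config_mean_cong)
    fix S
    obtain v where v: "singular_system n (Suc n) (chain q S) v (sq_singular_value n q S)"
      using sq_singular_value_system by blast
    have "(\<Sum>m\<le>n. ((- sqrt (sq_singular_value n q S m)) ^ (2 * k) + sqrt (sq_singular_value n q S m) ^ (2 * k)) / 2)
        = (\<Sum>m\<le>n. sq_singular_value n q S m ^ k)"
      using sq_singular_value_bounds[OF q] by (intro sum.cong) (auto simp: power_mult)
    also have "\<dots> = (\<Sum>i\<le>n. (mat_apply (Suc n) (gram n (chain q S)) ^^ k) (\<lambda>j. of_bool (j = i)) i)"
      using singular_trace[OF v, of k] by (simp only: lessThan_Suc_atMost)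
    finally show "(\<Sum>m\<le>n. ((- sqrt (sq_singular_value n q S m)) ^ (2 * k) + sqrt (sq_singular_value n q S m) ^ (2 * k)) / 2) / real (n + 1)
      = (1 / real (n + 1)) * (\<Sum>i\<le>n. (mat_apply (Suc n) (gram n (chain q S)) ^^ k) (\<lambda>j. of_bool (j = i)) i)"
      by simp
  qed
  also have "\<dots> = (1 / real (n + 1)) * (\<Sum>i\<le>n. diag_mean q n k i)"
    unfolding config_mean_scale config_mean_sum diag_mean_def ..
  finally show ?thesis by simp
qed

lemma level_measure_odd_moment:
  assumes "odd k"
  shows "(\<integral>x. x ^ k \<partial>level_measure q n) = 0"
  using assms by (subst integral_level_measure) (simp_all add: config_mean_const)

definition hat :: "real \<Rightarrow> real \<Rightarrow> real" where
  "hat \<epsilon> x = max 0 (min 1 (2 - \<bar>x\<bar> / \<epsilon>))"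

lemma hat_bounds: "0 \<le> hat \<epsilon> x" "hat \<epsilon> x \<le> 1"
  by (auto simp: hat_def)

lemma hat_continuous: "\<epsilon> > 0 \<Longrightarrow> continuous_on UNIV (hat \<epsilon>)"
  unfolding hat_def by (intro continuous_intros) auto

lemma hat_eq_1: "\<epsilon> > 0 \<Longrightarrow> \<bar>x\<bar> \<le> \<epsilon> \<Longrightarrow> hat \<epsilon> x = 1"
  by (simp add: hat_def field_simps)

lemma hat_eq_0: "\<epsilon> > 0 \<Longrightarrow> \<bar>x\<bar> \<ge> 2 * \<epsilon> \<Longrightarrow> hat \<epsilon> x = 0"
  by (simp add: hat_def field_simps)

lemma half_le_div2: "(real N - 1) / 2 \<le> real (N div 2)"
proof -
  have "N \<le> 2 * (N div 2) + 1" by presburger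
  then have "real N \<le> real (2 * (N div 2) + 1)" by (rule of_nat_mono)
  then show ?thesis by simp
qed

lemma config_mean_divide: "config_mean W (\<lambda>S. F S / c) = config_mean W F / c"
  by (simp add: config_mean_def sum_divide_distrib mult.commute)

context
  fixes p q :: real
  assumes q: "q \<noteq> 0" "\<bar>q\<bar> < 1" and pq: "q = 2 * p - 1"
begin

lemma moment_even_bounds: "0 \<le> moment p (2 * k)" "moment p (2 * k) \<le> 4 ^ k"
  using diag_mean_bounds[OF q, of k "2 * k" k] diag_mean_bulk[of k k "2 * k" p] by (simp_all add: pq)

text \<open>The trace is a sum over sites; all but the \<open>2 j\<close> sites near the ends contribute exactly the
  moment, and the others are bounded.\<close>

lemma level_measure_moment_tendsto:
  "(\<lambda>n. \<integral>x. x ^ k \<partial>level_measure q n) \<longlonglongrightarrow> moment p k"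
proof (cases "even k")
  case False
  then have "moment p k = 0" by (simp add: moment_def walk_coeff_odd)
  then show ?thesis using False by (simp add: level_measure_odd_moment)
next
  case True
  then obtain j where k: "k = 2 * j" by (elim evenE)
  have bound: "\<bar>(\<integral>x. x ^ k \<partial>level_measure q n) - moment p k\<bar> \<le> (4 ^ j * (2 * j)) / real (n + 1)" for n
  proof -
    have each: "\<bar>diag_mean q n j i - moment p k\<bar> \<le> 4 ^ j * of_bool (i < j \<or> n < i + j)" if "i \<le> n" for i
    proof (cases "i < j \<or> n < i + j")
      case True
      then show ?thesis
        using diag_mean_bounds[OF q that, of j] moment_even_bounds[of j] by (auto simp: k)
    next
      case False
      then show ?thesis using diag_mean_bulk[of j i n p] by (simp add: pq k)
    qed
    have "(\<integral>x. x ^ k \<partial>level_measure q n) - moment p k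
        = (\<Sum>i\<le>n. diag_mean q n j i - moment p k) / real (n + 1)"
      unfolding k level_measure_even_moment[OF q] by (simp add: sum_subtractf field_simps)
    then have "\<bar>(\<integral>x. x ^ k \<partial>level_measure q n) - moment p k\<bar>
        = \<bar>\<Sum>i\<le>n. diag_mean q n j i - moment p k\<bar> / real (n + 1)" by simp
    also have "\<dots> \<le> (\<Sum>i\<le>n. 4 ^ j * of_bool (i < j \<or> n < i + j)) / real (n + 1)"
      by (intro divide_right_mono order_trans[OF sum_abs] sum_mono each) auto
    also have "(\<Sum>i\<le>n. 4 ^ j * of_bool (i < j \<or> n < i + j) :: real)
        = 4 ^ j * real (card ({..n} \<inter> {i. i < j \<or> n < i + j}))"
      by (simp only: sum_distrib_left[symmetric] sum_of_bool_eq finite_atMost)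
    also have "card ({..n} \<inter> {i. i < j \<or> n < i + j}) \<le> card ({..<j} \<union> {Suc n - j..<Suc n})"
      by (intro card_mono) auto
    also have "card ({..<j} \<union> {Suc n - j..<Suc n}) \<le> 2 * j"
      by (rule order_trans[OF card_Un_le]) auto
    finally show ?thesis by (simp add: divide_right_mono)
  qed
  have "(\<lambda>n. (4 ^ j * (2 * real j)) / real (n + 1)) \<longlonglongrightarrow> 0"
    by real_asymp
  then have "(\<lambda>n. (\<integral>x. x ^ k \<partial>level_measure q n) - moment p k) \<longlonglongrightarrow> 0"
    by (rule Lim_null_comparison[rotated]) (use bound in auto)
  then show ?thesis by (simp add: LIM_zero_iff)
qed

lemma spectral_measure_limit:
  obtains r where "strict_mono (r :: nat \<Rightarrow> nat)"
    "real_distribution (spectral_measure lamplighter (lamplighter_H p))"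
    "weak_conv_m (level_measure q \<circ> r) (spectral_measure lamplighter (lamplighter_H p))"
proof -
  obtain r M where r: "strict_mono (r :: nat \<Rightarrow> nat)" and M: "real_distribution M"
    and conv: "weak_conv_m (level_measure q \<circ> r) M"
    and mom: "\<And>k. integrable M (\<lambda>x. x ^ k)" "\<And>k. (\<integral>x. x ^ k \<partial>M) = moment p k"
    using moments_limit_exists[OF real_distribution_level_measure level_measure_support[OF q] _
      level_measure_moment_tendsto] by auto
  interpret M: real_distribution M by fact
  have spec_iff: "is_spectral_measure lamplighter (lamplighter_H p) N \<longleftrightarrow>
      sets N = sets borel \<and> (\<forall>k. integrable N (\<lambda>x. x ^ k) \<and> (\<integral>x. x ^ k \<partial>N) = moment p k)" for N
    unfolding is_spectral_measure_def lamplighter_moment_eq_walk_coeff[where p = p and i = 0] moment_def[symmetric]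
      of_real_eq_iff by auto
  have "spectral_measure lamplighter (lamplighter_H p) = M"
    unfolding spectral_measure_def
  proof (rule the_equality)
    show "is_spectral_measure lamplighter (lamplighter_H p) M"
      unfolding spec_iff using mom by simp
    fix N assume "is_spectral_measure lamplighter (lamplighter_H p) N"
    then have N: "sets N = sets borel" "\<And>k. integrable N (\<lambda>x. x ^ k)" "\<And>k. (\<integral>x. x ^ k \<partial>N) = moment p k"
      unfolding spec_iff by auto
    have fin: "emeasure N (space N) < \<infinity>"
      using N(2)[of 0] by (simp add: integrable_iff_bounded)
    have "measure N (space N) = 1"
      using N(3)[of 0] by (simp add: moment_def)
    then have "prob_space N"
      using fin by (intro prob_spaceI) (simp add: emeasure_eq_ennreal_measure less_top)
    then have "real_distribution N"
      using N(1) by (simp add: real_distribution_def real_distribution_axioms_def)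
    then show "N = M"
    proof (rule real_distribution_eq_of_moments[OF _ M N(2) mom(1), of 2])
      show "(\<integral>x. x ^ k \<partial>M) \<le> 2 ^ k" if ev: "even k" for k
      proof -
        obtain j where "k = 2 * j" using ev by (elim evenE)
        then show ?thesis using moment_even_bounds(2)[of j] unfolding \<open>k = 2 * j\<close> mom(2) by (simp add: power_mult)
      qed
    qed (simp_all add: N(3) mom(2))
  qed
  then show ?thesis using that[OF r] M conv by simp
qed

text \<open>Singular values up to \<open>\<epsilon>\<close> are counted by a continuous test function supported in
  \<open>[- 2 \<epsilon>, 2 \<epsilon>]\<close>, which passes to the weak limit. There are at least as many as completed pairs
  of legs, hence the density \<open>1 / (2 G)\<close> with \<open>G = 2 h (h + 1)\<close>.\<close>

lemma spectral_measure_lower: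
  fixes h :: nat
  assumes h: "h \<ge> 1"
  shows "1 / (4 * real h * (real h + 1))
     \<le> measure (spectral_measure lamplighter (lamplighter_H p)) {- 4 * \<bar>q\<bar> ^ (h - 1)<..<4 * \<bar>q\<bar> ^ (h - 1)}"
proof -
  define \<epsilon> where "\<epsilon> = 2 * \<bar>q\<bar> ^ (h - 1)"
  have \<epsilon>: "\<epsilon> > 0" using q by (simp add: \<epsilon>_def)
  define f where "f = hat \<epsilon>"
  define \<mu> where "\<mu> = spectral_measure lamplighter (lamplighter_H p)"
  define G where "G = 2 * real h * (real h + 1)"
  have G: "G > 0" using h by (simp add: G_def)
  obtain r where r: "strict_mono r" and M: "real_distribution \<mu>"
    and conv: "weak_conv_m (level_measure q \<circ> r) \<mu>"
    unfolding \<mu>_def by (rule spectral_measure_limit)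
  interpret real_distribution \<mu> by (rule M)
  have lim: "(\<lambda>n. integral\<^sup>L (level_measure q (r n)) f) \<longlonglongrightarrow> integral\<^sup>L \<mu> f"
    using weak_conv_imp_integral_bdd_continuous_conv[OF _ M conv, of f 1] real_distribution_level_measure
      hat_continuous[OF \<epsilon>] hat_bounds[of \<epsilon>]
    by (simp add: f_def continuous_on_eq_continuous_at o_def)
  have low: "((n / G - 1) - 1) / 2 / real (n + 1) \<le> integral\<^sup>L (level_measure q n) f" for n
  proof -
    let ?N = "\<lambda>S. fst (legs (int h) (hop_step S) n)"
    have "((n / G - 1) - 1) / 2 \<le> (config_mean {0..<2 * int n} (\<lambda>S. real (?N S)) - 1) / 2"
      using config_mean_legs_bounds(1)[of "int h" n] h
      by (intro divide_right_mono diff_right_mono) (simp_all add: G_def)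
    also have "\<dots> = config_mean {0..<2 * int n} (\<lambda>S. (1 / 2) * (real (?N S) + (- 1)))"
      unfolding config_mean_scale config_mean_add by (simp add: config_mean_const)
    also have "\<dots> \<le> config_mean {0..<2 * int n}
        (\<lambda>S. \<Sum>m\<le>n. (f (- sqrt (sq_singular_value n q S m)) + f (sqrt (sq_singular_value n q S m))) / 2)"
    proof (rule config_mean_mono)
      fix S
      obtain v where v: "singular_system n (Suc n) (chain q S) v (sq_singular_value n q S)"
        using sq_singular_value_system by blast
      let ?C = "{m. m < Suc n \<and> sq_singular_value n q S m \<le> 4 * (\<bar>q\<bar> powi (int h - 1))\<^sup>2}"
      have "(1 / 2) * (real (?N S) + (- 1)) \<le> real (?N S div 2)"
        using half_le_div2[of "?N S"] by simp
      also have "\<dots> \<le> real (card ?C)"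
        using chain_count_lower[OF q _ v, of "int h"] h by simp
      also have "\<dots> = (\<Sum>m\<in>?C. 1)" by simp
      also have "\<dots> \<le> (\<Sum>m\<in>?C. (f (- sqrt (sq_singular_value n q S m)) + f (sqrt (sq_singular_value n q S m))) / 2)"
      proof (rule sum_mono)
        fix m assume m: "m \<in> ?C"
        have "int h - 1 = int (h - 1)" using h by simp
        then have "\<bar>q\<bar> powi (int h - 1) = \<bar>q\<bar> ^ (h - 1)" by (simp only: power_int_of_nat)
        then have "4 * (\<bar>q\<bar> powi (int h - 1))\<^sup>2 = \<epsilon>\<^sup>2"
          unfolding \<epsilon>_def power_mult_distrib by (simp only:) simp
        then have "sq_singular_value n q S m \<le> \<epsilon>\<^sup>2" using m by simp
        then have "sqrt (sq_singular_value n q S m) \<le> \<epsilon>" using \<epsilon> by (intro real_le_lsqrt) auto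
        moreover have "0 \<le> sqrt (sq_singular_value n q S m)" using sq_singular_value_bounds(1)[OF q] m by simp
        ultimately show "1 \<le> (f (- sqrt (sq_singular_value n q S m)) + f (sqrt (sq_singular_value n q S m))) / 2"
          using hat_eq_1[OF \<epsilon>, of "sqrt (sq_singular_value n q S m)"] hat_eq_1[OF \<epsilon>, of "- sqrt (sq_singular_value n q S m)"]
          by (simp add: f_def)
      qed
      also have "\<dots> \<le> (\<Sum>m\<le>n. (f (- sqrt (sq_singular_value n q S m)) + f (sqrt (sq_singular_value n q S m))) / 2)"
        using hat_bounds[of \<epsilon>] by (intro sum_mono2) (auto simp: f_def)
      finally show "(1 / 2) * (real (?N S) + (- 1))
          \<le> (\<Sum>m\<le>n. (f (- sqrt (sq_singular_value n q S m)) + f (sqrt (sq_singular_value n q S m))) / 2)" .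
    qed
    finally have "((n / G - 1) - 1) / 2 / real (n + 1) \<le> config_mean {0..<2 * int n}
        (\<lambda>S. \<Sum>m\<le>n. (f (- sqrt (sq_singular_value n q S m)) + f (sqrt (sq_singular_value n q S m))) / 2) / real (n + 1)"
      by (rule divide_right_mono) simp
    also have "\<dots> = integral\<^sup>L (level_measure q n) f"
      using borel_measurable_continuous_onI[OF hat_continuous[OF \<epsilon>]]
      by (subst integral_level_measure) (simp_all only: f_def config_mean_divide)
    finally show ?thesis .
  qed
  have "(\<lambda>n. ((real n / G - 1) - 1) / 2 / real (n + 1)) \<longlonglongrightarrow> inverse G / 2"
    using G by real_asymp
  from LIMSEQ_subseq_LIMSEQ[OF this r]
  have "inverse G / 2 \<le> integral\<^sup>L \<mu> f"
    using low by (intro LIMSEQ_le[OF _ lim]) (auto simp: o_def)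
  also have "\<dots> \<le> measure \<mu> {- (2 * \<epsilon>)<..<2 * \<epsilon>}"
  proof -
    have "integral\<^sup>L \<mu> f \<le> integral\<^sup>L \<mu> (indicator {- (2 * \<epsilon>)<..<2 * \<epsilon>})"
      using hat_bounds[of \<epsilon>] hat_eq_0[OF \<epsilon>] borel_measurable_continuous_onI[OF hat_continuous[OF \<epsilon>]]
      by (intro integral_mono integrable_const_bound[of _ 1]) (auto simp: f_def indicator_def)
    then show ?thesis by simp
  qed
  finally show ?thesis unfolding G_def \<epsilon>_def \<mu>_def by (simp add: inverse_eq_divide)
qed

text \<open>The term \<open>1 / L\<close> is the density of the additional zeros at the multiples of \<open>L\<close>.\<close>

lemma spectral_measure_upper:
  fixes h L :: nat
  assumes h: "h \<ge> 1" and L: "L \<ge> 1"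
  shows "measure (spectral_measure lamplighter (lamplighter_H p))
           {- (\<bar>q\<bar> ^ (h + 1) / (4 * L))<..<\<bar>q\<bar> ^ (h + 1) / (4 * L)}
     \<le> 1 / (4 * real h * (real h + 1)) + 1 / L"
proof -
  define \<epsilon> where "\<epsilon> = \<bar>q\<bar> ^ (h + 1) / (4 * L)"
  have \<epsilon>: "\<epsilon> > 0" using q L by (simp add: \<epsilon>_def)
  define f where "f = hat \<epsilon>"
  define \<mu> where "\<mu> = spectral_measure lamplighter (lamplighter_H p)"
  define G where "G = 2 * real h * (real h + 1)"
  have G: "G > 0" using h by (simp add: G_def)
  have Lpos: "real L > 0" using L by simp
  obtain r where r: "strict_mono r" and M: "real_distribution \<mu>"
    and conv: "weak_conv_m (level_measure q \<circ> r) \<mu>"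
    unfolding \<mu>_def by (rule spectral_measure_limit)
  interpret real_distribution \<mu> by (rule M)
  have lim: "(\<lambda>n. integral\<^sup>L (level_measure q (r n)) f) \<longlonglongrightarrow> integral\<^sup>L \<mu> f"
    using weak_conv_imp_integral_bdd_continuous_conv[OF _ M conv, of f 1] real_distribution_level_measure
      hat_continuous[OF \<epsilon>] hat_bounds[of \<epsilon>]
    by (simp add: f_def continuous_on_eq_continuous_at o_def)
  have up: "integral\<^sup>L (level_measure q n) f \<le> (n / G / 2 + (3 + n / L)) / real (n + 1)" for n
  proof -
    let ?N = "\<lambda>S. fst (legs (int h) (hop_step S) n)"
    have "config_mean {0..<2 * int n}
        (\<lambda>S. \<Sum>m\<le>n. (f (- sqrt (sq_singular_value n q S m)) + f (sqrt (sq_singular_value n q S m))) / 2)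
       \<le> config_mean {0..<2 * int n} (\<lambda>S. (1 / 2) * real (?N S) + (3 + n / L))"
    proof (rule config_mean_mono)
      fix S
      obtain v where v: "singular_system n (Suc n) (chain q S) v (sq_singular_value n q S)"
        using sq_singular_value_system by blast
      let ?C = "{m. m < Suc n \<and> sq_singular_value n q S m < (\<bar>q\<bar> powi (int h + 1))\<^sup>2 / (2 * (real L)\<^sup>2)}"
      have zero: "f (- sqrt (sq_singular_value n q S m)) = 0 \<and> f (sqrt (sq_singular_value n q S m)) = 0" if "m \<le> n" "m \<notin> ?C" for m
      proof -
        have "(2 * \<epsilon>)\<^sup>2 = (\<bar>q\<bar> ^ (h + 1))\<^sup>2 / (4 * (real L)\<^sup>2)"
          by (simp add: \<epsilon>_def power_divide power_mult_distrib)
        also have "\<dots> \<le> (\<bar>q\<bar> ^ (h + 1))\<^sup>2 / (2 * (real L)\<^sup>2)"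
          using Lpos by (intro divide_left_mono) auto
        also have "\<dots> = (\<bar>q\<bar> powi (int h + 1))\<^sup>2 / (2 * (real L)\<^sup>2)"
        proof -
          have "int h + 1 = int (h + 1)" by simp
          then show ?thesis by (simp only: power_int_of_nat)
        qed
        also have "\<dots> \<le> sq_singular_value n q S m" using that by auto
        finally have "2 * \<epsilon> \<le> sqrt (sq_singular_value n q S m)" by (rule real_le_rsqrt)
        then show ?thesis using hat_eq_0[OF \<epsilon>] \<epsilon> by (auto simp: f_def)
      qed
      have "(\<Sum>m\<le>n. (f (- sqrt (sq_singular_value n q S m)) + f (sqrt (sq_singular_value n q S m))) / 2)
          = (\<Sum>m\<in>?C. (f (- sqrt (sq_singular_value n q S m)) + f (sqrt (sq_singular_value n q S m))) / 2)"
        using zero by (intro sum.mono_neutral_right) auto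
      also have "\<dots> \<le> (\<Sum>m\<in>?C. 1)"
      proof (rule sum_mono)
        fix m
        show "(f (- sqrt (sq_singular_value n q S m)) + f (sqrt (sq_singular_value n q S m))) / 2 \<le> 1"
          using add_mono[OF hat_bounds(2)[of \<epsilon> "- sqrt (sq_singular_value n q S m)"] hat_bounds(2)[of \<epsilon> "sqrt (sq_singular_value n q S m)"]]
          unfolding f_def by simp
      qed
      also have "\<dots> = real (card ?C)" by simp
      also have "\<dots> \<le> real (?N S div 2 + 3 + n div L)"
        using chain_count_upper[OF q _ L v, of "int h"] h by simp
      also have "\<dots> = real (?N S div 2) + 3 + real (n div L)" by simp
      also have "\<dots> \<le> (1 / 2) * real (?N S) + (3 + n / L)"
        using of_nat_div_le_of_nat[of n L, where ?'a = real] of_nat_div_le_of_nat[of "?N S" 2, where ?'a = real] by simp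
      finally show "(\<Sum>m\<le>n. (f (- sqrt (sq_singular_value n q S m)) + f (sqrt (sq_singular_value n q S m))) / 2)
         \<le> (1 / 2) * real (?N S) + (3 + n / L)" .
    qed
    also have "\<dots> = (1 / 2) * config_mean {0..<2 * int n} (\<lambda>S. real (?N S)) + (3 + n / L)"
      unfolding config_mean_add config_mean_scale by (simp add: config_mean_const)
    also have "\<dots> \<le> n / G / 2 + (3 + n / L)"
      using config_mean_legs_bounds(2)[of "int h" n] h by (simp add: G_def)
    finally have "config_mean {0..<2 * int n}
        (\<lambda>S. \<Sum>m\<le>n. (f (- sqrt (sq_singular_value n q S m)) + f (sqrt (sq_singular_value n q S m))) / 2) / real (n + 1)
       \<le> (n / G / 2 + (3 + n / L)) / real (n + 1)"
      by (rule divide_right_mono) simp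
    moreover have "integral\<^sup>L (level_measure q n) f = config_mean {0..<2 * int n}
        (\<lambda>S. \<Sum>m\<le>n. (f (- sqrt (sq_singular_value n q S m)) + f (sqrt (sq_singular_value n q S m))) / 2) / real (n + 1)"
      using borel_measurable_continuous_onI[OF hat_continuous[OF \<epsilon>]]
      by (subst integral_level_measure) (simp_all only: f_def config_mean_divide)
    ultimately show ?thesis by simp
  qed
  have "measure \<mu> {- \<epsilon><..<\<epsilon>} \<le> integral\<^sup>L \<mu> f"
  proof -
    have "integral\<^sup>L \<mu> (indicator {- \<epsilon><..<\<epsilon>}) \<le> integral\<^sup>L \<mu> f"
      using hat_bounds[of \<epsilon>] hat_eq_1[OF \<epsilon>] borel_measurable_continuous_onI[OF hat_continuous[OF \<epsilon>]]
      by (intro integral_mono integrable_const_bound[of _ 1]) (auto simp: f_def indicator_def)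
    then show ?thesis by simp
  qed
  also have "(\<lambda>n. (real n / G / 2 + (3 + real n / real L)) / real (n + 1)) \<longlonglongrightarrow> inverse G / 2 + inverse (real L)"
    using G Lpos by real_asymp
  from LIMSEQ_subseq_LIMSEQ[OF this r]
  have "integral\<^sup>L \<mu> f \<le> inverse G / 2 + inverse (real L)"
    using up by (intro LIMSEQ_le[OF lim]) (auto simp: o_def)
  finally show ?thesis unfolding G_def \<epsilon>_def \<mu>_def by (simp add: inverse_eq_divide)
qed

end

section \<open>The asymptotics\<close>

text \<open>The two bounds are applied with heights \<open>h\<close> depending on \<open>\<epsilon>\<close>. From above, \<open>h\<close> is
  \<open>ln \<epsilon> / ln \<bar>q\<bar>\<close> reduced by \<open>sqrt (- ln \<epsilon>)\<close>: this is negligible compared to \<open>h\<close> but absorbs the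
  logarithm of \<open>L = h\<^sup>3\<close>, and \<open>1 / L\<close> is negligible compared to \<open>1 / h\<^sup>2\<close>. From below a bounded
  correction suffices.\<close>

theorem mainTheorem7:
  fixes p :: real
  assumes "0 < p" and "p < 1" and "p \<noteq> 1/2"
  shows "(\<lambda>\<epsilon>::real. measure (spectral_measure lamplighter (lamplighter_H p)) {-\<epsilon><..<\<epsilon>})
           \<sim>[at_right 0] (\<lambda>\<epsilon>. (1/4 * (ln \<bar>2 * p - 1\<bar>)\<^sup>2) / \<bar>ln \<epsilon>\<bar>\<^sup>2)"
proof -
  define q where "q = 2 * p - 1"
  have q: "q \<noteq> 0" "\<bar>q\<bar> < 1" using assms by (auto simp: q_def)
  define l where "l = - ln \<bar>q\<bar>"
  have l: "l > 0" using q by (simp add: l_def)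
  have qpow: "ln (\<bar>q\<bar> ^ n) = - (real n * l)" for n
    using q by (simp add: l_def ln_realpow)
  define \<mu> where "\<mu> = spectral_measure lamplighter (lamplighter_H p)"
  interpret \<mu>: real_distribution \<mu>
    unfolding \<mu>_def using spectral_measure_limit[OF q q_def] by blast
  have mono: "measure \<mu> {-a<..<a} \<le> measure \<mu> {-b<..<b}" if "a \<le> b" for a b :: real
    using that by (intro \<mu>.finite_measure_mono) auto
  define x where "x \<epsilon> = - ln \<epsilon> / l - sqrt (- ln \<epsilon>)" for \<epsilon> :: real
  define y where "y \<epsilon> = (- ln \<epsilon> + ln 4) / l" for \<epsilon> :: real
  have ev: "eventually (\<lambda>\<epsilon>. 0 < \<epsilon> \<and> \<epsilon> < 1 \<and> x \<epsilon> \<ge> 3 \<and> l + ln 4 + 3 * ln (x \<epsilon>) \<le> l * sqrt (- ln \<epsilon>)) (at_right (0::real))"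
  proof (intro eventually_conj)
    show "eventually (\<lambda>\<epsilon>. x \<epsilon> \<ge> 3) (at_right (0::real))" unfolding x_def using l by real_asymp
    show "eventually (\<lambda>\<epsilon>. l + ln 4 + 3 * ln (x \<epsilon>) \<le> l * sqrt (- ln \<epsilon>)) (at_right (0::real))"
      unfolding x_def using l by real_asymp
  qed real_asymp+
  have upper: "measure \<mu> {-\<epsilon><..<\<epsilon>} \<le> 1 / (4 * (x \<epsilon> - 1) * x \<epsilon>) + 1 / (x \<epsilon> - 1) ^ 3"
    if \<epsilon>: "0 < \<epsilon>" "\<epsilon> < 1" "x \<epsilon> \<ge> 3" "l + ln 4 + 3 * ln (x \<epsilon>) \<le> l * sqrt (- ln \<epsilon>)" for \<epsilon>
  proof -
    define h where "h = nat \<lfloor>x \<epsilon>\<rfloor>"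
    have h: "real h \<le> x \<epsilon>" "x \<epsilon> - 1 \<le> real h" "h \<ge> 1" using \<epsilon>(3) unfolding h_def by linarith+
    have "ln \<epsilon> = - (l * x \<epsilon> + l * sqrt (- ln \<epsilon>))" using l by (simp add: x_def right_diff_distrib)
    also have "\<dots> \<le> - (real (h + 1) * l) - (ln 4 + 3 * ln (real h))"
    proof -
      have "ln (real h) \<le> ln (x \<epsilon>)" using h by simp
      moreover have "real h * l \<le> l * x \<epsilon>" using h l by (simp add: mult.commute)
      ultimately show ?thesis using \<epsilon>(4) by (simp add: algebra_simps)
    qed
    also have "\<dots> = ln (\<bar>q\<bar> ^ (h + 1) / (4 * real (h ^ 3)))"
    proof -
      have "ln (4 * real (h ^ 3)) = ln 4 + 3 * ln (real h)"
        using h by (simp add: ln_mult ln_realpow)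
      moreover have "ln (\<bar>q\<bar> ^ (h + 1) / (4 * real (h ^ 3))) = ln (\<bar>q\<bar> ^ (h + 1)) - ln (4 * real (h ^ 3))"
        using q h by (subst ln_div) auto
      ultimately show ?thesis unfolding qpow by simp
    qed
    finally have "\<epsilon> \<le> \<bar>q\<bar> ^ (h + 1) / (4 * real (h ^ 3))"
      using \<epsilon>(1) q h by (subst (asm) ln_le_cancel_iff) auto
    then have "measure \<mu> {-\<epsilon><..<\<epsilon>} \<le> 1 / (4 * real h * (real h + 1)) + 1 / real (h ^ 3)"
      using spectral_measure_upper[OF q q_def h(3), of "h ^ 3"] h(3)
        mono[of \<epsilon> "\<bar>q\<bar> ^ (h + 1) / (4 * real (h ^ 3))"]
      unfolding \<mu>_def[symmetric] by (simp del: of_nat_power power_Suc)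
    also have "\<dots> \<le> 1 / (4 * (x \<epsilon> - 1) * x \<epsilon>) + 1 / (x \<epsilon> - 1) ^ 3"
    proof (rule add_mono)
      have "(x \<epsilon> - 1) * x \<epsilon> \<le> real h * (real h + 1)"
        using h \<epsilon>(3) by (intro mult_mono) linarith+
      moreover have "0 < (x \<epsilon> - 1) * x \<epsilon>" using \<epsilon>(3) by simp
      ultimately show "1 / (4 * real h * (real h + 1)) \<le> 1 / (4 * (x \<epsilon> - 1) * x \<epsilon>)"
        unfolding mult.assoc by (intro frac_le) simp_all
      have "(x \<epsilon> - 1) ^ 3 \<le> real h ^ 3" using h \<epsilon>(3) by (intro power_mono) linarith+
      moreover have "0 < (x \<epsilon> - 1) ^ 3" using \<epsilon>(3) by simp
      ultimately show "1 / real (h ^ 3) \<le> 1 / (x \<epsilon> - 1) ^ 3"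
        unfolding of_nat_power by (intro frac_le) simp_all
    qed
    finally show ?thesis .
  qed
  have lower: "1 / (4 * (y \<epsilon> + 2) * (y \<epsilon> + 3)) \<le> measure \<mu> {-\<epsilon><..<\<epsilon>}"
    if \<epsilon>: "0 < \<epsilon>" "\<epsilon> < 1" for \<epsilon>
  proof -
    define h where "h = nat \<lceil>y \<epsilon>\<rceil> + 1"
    have "0 \<le> y \<epsilon>" using \<epsilon> l by (simp add: y_def)
    then have h: "real h \<le> y \<epsilon> + 2" "y \<epsilon> \<le> real (h - 1)" "h \<ge> 1" unfolding h_def by linarith+
    have "ln (4 * \<bar>q\<bar> ^ (h - 1)) = ln 4 - real (h - 1) * l"
      using q by (subst ln_mult) (simp_all add: qpow)
    also have "\<dots> \<le> ln 4 - y \<epsilon> * l" using h(2) l by simp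
    also have "\<dots> = ln \<epsilon>" using l by (simp add: y_def)
    finally have "4 * \<bar>q\<bar> ^ (h - 1) \<le> \<epsilon>" using \<epsilon>(1) q by (subst (asm) ln_le_cancel_iff) auto
    then have "1 / (4 * real h * (real h + 1)) \<le> measure \<mu> {-\<epsilon><..<\<epsilon>}"
      using spectral_measure_lower[OF q q_def h(3)] mono[of "4 * \<bar>q\<bar> ^ (h - 1)" \<epsilon>]
      unfolding \<mu>_def[symmetric] by simp
    moreover have "1 / (4 * (y \<epsilon> + 2) * (y \<epsilon> + 3)) \<le> 1 / (4 * real h * (real h + 1))"
    proof -
      have "real h * (real h + 1) \<le> (y \<epsilon> + 2) * (y \<epsilon> + 3)"
        using h \<open>0 \<le> y \<epsilon>\<close> by (intro mult_mono) linarith+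
      moreover have "0 < real h * (real h + 1)" using h(3) by simp
      ultimately show ?thesis unfolding mult.assoc by (intro frac_le) simp_all
    qed
    ultimately show ?thesis by simp
  qed
  define g where "g \<epsilon> = l * l / 4 / (ln \<epsilon>)\<^sup>2" for \<epsilon> :: real
  have "((\<lambda>\<epsilon>. measure \<mu> {-\<epsilon><..<\<epsilon>} / g \<epsilon>) \<longlongrightarrow> 1) (at_right 0)"
  proof (rule tendsto_sandwich)
    show "((\<lambda>\<epsilon>. (1 / (4 * (y \<epsilon> + 2) * (y \<epsilon> + 3))) / g \<epsilon>) \<longlongrightarrow> 1) (at_right 0)"
      unfolding y_def g_def using l by real_asymp
    show "((\<lambda>\<epsilon>. (1 / (4 * (x \<epsilon> - 1) * x \<epsilon>) + 1 / (x \<epsilon> - 1) ^ 3) / g \<epsilon>) \<longlongrightarrow> 1) (at_right 0)"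
      unfolding x_def g_def using l by real_asymp
    show "\<forall>\<^sub>F \<epsilon> in at_right 0. measure \<mu> {-\<epsilon><..<\<epsilon>} / g \<epsilon>
        \<le> (1 / (4 * (x \<epsilon> - 1) * x \<epsilon>) + 1 / (x \<epsilon> - 1) ^ 3) / g \<epsilon>"
      using ev by eventually_elim (intro divide_right_mono upper, auto simp: g_def)
    show "\<forall>\<^sub>F \<epsilon> in at_right 0. (1 / (4 * (y \<epsilon> + 2) * (y \<epsilon> + 3))) / g \<epsilon> \<le> measure \<mu> {-\<epsilon><..<\<epsilon>} / g \<epsilon>"
      using ev by eventually_elim (intro divide_right_mono lower, auto simp: g_def)
  qed
  moreover have "g = (\<lambda>\<epsilon>. (1/4 * (ln \<bar>2 * p - 1\<bar>)\<^sup>2) / \<bar>ln \<epsilon>\<bar>\<^sup>2)"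
    by (simp add: fun_eq_iff g_def l_def q_def power2_eq_square)
  ultimately show ?thesis
    unfolding \<mu>_def by (intro asymp_equivI') simp
qed

end
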